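(* Let $V\subset\mathcal{A}(\mathbb{C}^2)$ be a quasi-Banach space such that the inclusion $\iota\colon V\hookrightarrow\mathcal{A}(\mathbb{C}^2)$ is continuous. Assume: (1) for all but finitely many $p\in\mathbb{C}^2$, the map $\kappa_p^{n,\mathrm{hol}}$ is injective for infinitely many $n\ge 0$; and (2) $\langle\mathcal{G}_2(V)\rangle_{\mathbb{C}}=\mathrm{M}_2(\mathbb{C})$. If a polynomial automorphism $f\colon\mathbb{C}^2\to\mathbb{C}^2$ induces a bounded linear composition operator $C_f$ on $V$, then $f(z)=Az+b$ for some $A\in\mathrm{GL}_2(\mathbb{C})$ and $b\in\mathbb{C}^2$.
   Context: $\mathcal{A}(\mathbb{C}^2)$ is the space of holomorphic functions on $\mathbb{C}^2$ with the topology of uniform convergence on compact sets. A quasi-Banach space is a complete Hausdorff complex topological vector space with a bounded neighborhood of $0$ (equivalently, complete with respect to a quasi-norm); $V$ is a linear subspace of $\mathcal{A}(\mathbb{C}^2)$ with its own quasi-Banach topology. For a holomorphic map $g\colon\mathbb{C}^2\to\mathbb{C}^2$, $C_g h:=h\circ g$; "$C_g$ is bounded on $V$" means that $h\circ g\in V$ for all $h\in V$ and $C_g\colon V\to V$ is bounded (continuous). A polynomial automorphism of $\mathbb{C}^2$ is a map $f=(f_1,f_2)$ with polynomial components for which there is a polynomial map $g\colon\mathbb{C}^2\to\mathbb{C}^2$ with $f\circ g=g\circ f=\mathrm{id}$. $\mathcal{G}_2(V):=\{A\in\mathrm{GL}_2(\mathbb{C}): C_{A(\cdot)+b}\text{ is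 bounded on }V\text{ for some }b\in\mathbb{C}^2\}$, and $\langle S\rangle_{\mathbb{C}}$ is the complex linear span of $S$ (here in $\mathrm{M}_2(\mathbb{C})$, the $2\times2$ complex matrices). For $p\in\mathbb{C}^2$ and $n\ge0$ let $\mathcal{D}^{\mathrm{hol}}_n(\mathbb{C}^2)_p\subset\mathcal{A}(\mathbb{C}^2)'$ (strong dual) be the span of the functionals $h\mapsto(\partial_{z_1}^{n_1}\partial_{z_2}^{n_2}h)(p)$ with $n_1+n_2\le n$, and $\mathcal{D}^{\mathrm{hol}}_{-1}(\mathbb{C}^2)_p=\{0\}$. With $\iota'\colon\mathcal{A}(\mathbb{C}^2)'\to V'$ the dual map of $\iota$, $\kappa_p^{n,\mathrm{hol}}\colon\mathcal{D}^{\mathrm{hol}}_n(\mathbb{C}^2)_p/\mathcal{D}^{\mathrm{hol}}_{n-1}(\mathbb{C}^2)_p\to\iota'(\mathcal{D}^{\mathrm{hol}}_n(\mathbb{C}^2)_p)/\iota'(\mathcal{D}^{\mathrm{hol}}_{n-1}(\mathbb{C}^2)_p)$ is the surjective linear map induced by $\iota'$. *)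

theory Defs
  imports
    "HOL-Analysis.Analysis"
    "HOL-Library.Function_Algebras"
    "HOL-Library.Set_Algebras"
begin

section \<open>Complex vector spaces of functions and of matrices\<close>

text \<open>
  Addition of functions is the pointwise one of \<^theory>\<open>HOL-Library.Function_Algebras\<close>.
  \<open>fscale\<close> serves both for functions of two complex variables and for functionals on spaces of
  such functions.
\<close>

definition fscale :: "complex \<Rightarrow> ('a \<Rightarrow> complex) \<Rightarrow> 'a \<Rightarrow> complex" where
  "fscale c h = (\<lambda>x. c * h x)"

definition mscale :: "complex \<Rightarrow> complex^2^2 \<Rightarrow> complex^2^2" where
  "mscale c = map_matrix ((*) c)"

interpretation cfun: vector_space fscale
  by unfold_locales (auto simp: fscale_def fun_eq_iff algebra_simps)

interpretation cmat: vector_space mscale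
  by unfold_locales (auto simp: mscale_def vec_eq_iff algebra_simps)

section \<open>Quasi-Banach spaces of functions\<close>

text \<open>The topology \<open>T\<close> has \<open>V\<close> as its underlying set; it need not be a subspace topology.\<close>

definition complex_tvs :: "('a \<Rightarrow> complex) set \<Rightarrow> ('a \<Rightarrow> complex) topology \<Rightarrow> bool" where
  "complex_tvs V T \<longleftrightarrow>
     cfun.subspace V \<and> topspace T = V \<and>
     continuous_map (prod_topology T T) T (\<lambda>(x, y). x + y) \<and>
     continuous_map (prod_topology euclidean T) T (\<lambda>(c, x). fscale c x)"

definition tvs_bounded :: "('a \<Rightarrow> complex) topology \<Rightarrow> ('a \<Rightarrow> complex) set \<Rightarrow> bool" where
  "tvs_bounded T B \<longleftrightarrow>
     B \<subseteq> topspace T \<and>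
     (\<forall>U. openin T U \<and> 0 \<in> U \<longrightarrow> (\<exists>r>0. \<forall>c. r \<le> cmod c \<longrightarrow> B \<subseteq> fscale c ` U))"

definition tvs_cauchy :: "('a \<Rightarrow> complex) topology \<Rightarrow> ('a \<Rightarrow> complex) filter \<Rightarrow> bool" where
  "tvs_cauchy T F \<longleftrightarrow>
     (\<forall>U. openin T U \<and> 0 \<in> U \<longrightarrow> (\<forall>\<^sub>F (x, y) in F \<times>\<^sub>F F. x - y \<in> U))"

definition tvs_complete :: "('a \<Rightarrow> complex) topology \<Rightarrow> bool" where
  "tvs_complete T \<longleftrightarrow>
     (\<forall>F. F \<noteq> bot \<and> F \<le> principal (topspace T) \<and> tvs_cauchy T F \<longrightarrow>
        (\<exists>l. limitin T (\<lambda>x. x) l F))"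

definition quasi_banach :: "('a \<Rightarrow> complex) set \<Rightarrow> ('a \<Rightarrow> complex) topology \<Rightarrow> bool" where
  "quasi_banach V T \<longleftrightarrow>
     complex_tvs V T \<and> Hausdorff_space T \<and> tvs_complete T \<and>
     (\<exists>U. openin T U \<and> 0 \<in> U \<and> tvs_bounded T U)"

section \<open>Holomorphic functions of two variables\<close>

definition hol2 :: "(complex^2 \<Rightarrow> complex) set" where
  "hol2 = {h. \<forall>z. \<exists>D. (h has_derivative D) (at z) \<and> (\<forall>c v. D (c *s v) = c * D v)}"

definition hol2_nbhd ::
    "(complex^2 \<Rightarrow> complex) \<Rightarrow> (complex^2) set \<Rightarrow> real \<Rightarrow> (complex^2 \<Rightarrow> complex) set" where
  "hol2_nbhd h K e = {g \<in> hol2. \<forall>z\<in>K. cmod (g z - h z) < e}"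

definition hol2_topology :: "(complex^2 \<Rightarrow> complex) topology" where
  "hol2_topology = topology (\<lambda>U. U \<subseteq> hol2 \<and>
     (\<forall>h\<in>U. \<exists>K e. compact K \<and> e > 0 \<and> hol2_nbhd h K e \<subseteq> U))"

lemma openin_hol2_topology:
  "openin hol2_topology U \<longleftrightarrow>
     U \<subseteq> hol2 \<and> (\<forall>h\<in>U. \<exists>K e. compact K \<and> e > 0 \<and> hol2_nbhd h K e \<subseteq> U)"
proof -
  define Q :: "(complex^2 \<Rightarrow> complex) set \<Rightarrow> (complex^2 \<Rightarrow> complex) \<Rightarrow> bool"
    where "Q U h \<longleftrightarrow> (\<exists>K e. compact K \<and> e > 0 \<and> hol2_nbhd h K e \<subseteq> U)" for U h
  define P where "P U \<longleftrightarrow> U \<subseteq> hol2 \<and> (\<forall>h\<in>U. Q U h)" for U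
  have Q_mono: "Q U h" if "Q S h" "S \<subseteq> U" for S U h
    using that unfolding Q_def by (meson order_trans)
  have Q_Int: "Q (S \<inter> T) h" if Qs: "Q S h" "Q T h" for S T h
  proof -
    obtain K e where K: "compact K" "e > 0" "hol2_nbhd h K e \<subseteq> S"
      using Qs(1) unfolding Q_def by metis
    obtain L d where L: "compact L" "d > 0" "hol2_nbhd h L d \<subseteq> T"
      using Qs(2) unfolding Q_def by metis
    have "hol2_nbhd h (K \<union> L) (min e d) \<subseteq> hol2_nbhd h K e \<inter> hol2_nbhd h L d"
      unfolding hol2_nbhd_def by auto
    then have "hol2_nbhd h (K \<union> L) (min e d) \<subseteq> S \<inter> T"
      using K(3) L(3) by blast
    moreover have "compact (K \<union> L)" "min e d > 0"
      using K L by (simp_all add: compact_Un)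
    ultimately show ?thesis
      unfolding Q_def by metis
  qed
  have "istopology P"
    unfolding istopology_def
  proof (intro conjI allI impI)
    fix S T assume S: "P S" and T: "P T"
    show "P (S \<inter> T)"
      using S T Q_Int unfolding P_def by auto
  next
    fix \<K> assume *: "\<forall>U\<in>\<K>. P U"
    show "P (\<Union>\<K>)"
      unfolding P_def
    proof (intro conjI ballI)
      show "\<Union>\<K> \<subseteq> hol2" using * unfolding P_def by auto
      fix h assume "h \<in> \<Union>\<K>"
      then obtain U where U: "U \<in> \<K>" "h \<in> U" by auto
      then have "Q U h" using * unfolding P_def by auto
      then show "Q (\<Union>\<K>) h" by (rule Q_mono) (use U in auto)
    qed
  qed
  moreover have "hol2_topology = topology P"
    unfolding hol2_topology_def P_def Q_def ..
  ultimately have "openin hol2_topology = P"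
    by (metis topology_inverse')
  then show ?thesis
    by (simp only: P_def Q_def)
qed

lemma topspace_hol2_topology: "topspace hol2_topology = hol2"
proof
  show "topspace hol2_topology \<subseteq> hol2"
    unfolding topspace_def openin_hol2_topology by blast
  have "openin hol2_topology hol2"
    unfolding openin_hol2_topology hol2_nbhd_def
    by (auto intro!: exI[of _ "{}"] exI[of _ "1::real"])
  then show "hol2 \<subseteq> topspace hol2_topology"
    by (rule openin_subset)
qed

section \<open>Composition operators and polynomial automorphisms\<close>

definition bounded_comp ::
    "(complex^2 \<Rightarrow> complex) set \<Rightarrow> (complex^2 \<Rightarrow> complex) topology \<Rightarrow>
     (complex^2 \<Rightarrow> complex^2) \<Rightarrow> bool" where
  "bounded_comp V T g \<longleftrightarrow> (\<forall>h\<in>V. h \<circ> g \<in> V) \<and> continuous_map T T (\<lambda>h. h \<circ> g)"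

definition G2 ::
    "(complex^2 \<Rightarrow> complex) set \<Rightarrow> (complex^2 \<Rightarrow> complex) topology \<Rightarrow>
     (complex^2^2) set" where
  "G2 V T = {A. invertible A \<and> (\<exists>b. bounded_comp V T (\<lambda>z. A *v z + b))}"

definition poly_fun2 :: "(complex^2 \<Rightarrow> complex) \<Rightarrow> bool" where
  "poly_fun2 h \<longleftrightarrow> (\<exists>d (c :: nat \<Rightarrow> nat \<Rightarrow> complex).
     \<forall>z. h z = (\<Sum>i\<le>d. \<Sum>j\<le>d. c i j * (z $ 1) ^ i * (z $ 2) ^ j))"

definition poly_map2 :: "(complex^2 \<Rightarrow> complex^2) \<Rightarrow> bool" where
  "poly_map2 f \<longleftrightarrow> (\<forall>k. poly_fun2 (\<lambda>z. f z $ k))"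

definition poly_automorphism2 :: "(complex^2 \<Rightarrow> complex^2) \<Rightarrow> bool" where
  "poly_automorphism2 f \<longleftrightarrow>
     poly_map2 f \<and> (\<exists>g. poly_map2 g \<and> f \<circ> g = id \<and> g \<circ> f = id)"

section \<open>Holomorphic differential functionals\<close>

definition pd :: "2 \<Rightarrow> (complex^2 \<Rightarrow> complex) \<Rightarrow> complex^2 \<Rightarrow> complex" where
  "pd k h = (\<lambda>z. deriv (\<lambda>w. h (\<chi> j. if j = k then w else z $ j)) (z $ k))"

text \<open>
  A functional on a set \<open>W\<close> of functions is encoded as a function on the whole type that vanishes
  outside \<open>W\<close>, so that the pointwise operations are those of the dual space, and restriction
  along an inclusion \<open>V \<subseteq> W\<close>, i.e. the dual map \<open>\<phi> \<mapsto> \<phi> \<circ> \<iota>\<close>, is truncation to \<open>V\<close>.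
\<close>

type_synonym functional2 = "(complex^2 \<Rightarrow> complex) \<Rightarrow> complex"

definition diff_functional :: "complex^2 \<Rightarrow> nat \<Rightarrow> nat \<Rightarrow> functional2" where
  "diff_functional p m n = (\<lambda>h. if h \<in> hol2 then ((pd 1 ^^ m) ((pd 2 ^^ n) h)) p else 0)"

text \<open>The order is an integer; for the order \<open>-1\<close> the spanning set is empty.\<close>

definition Dhol :: "int \<Rightarrow> complex^2 \<Rightarrow> functional2 set" where
  "Dhol n p = cfun.span {diff_functional p n1 n2 | n1 n2. int n1 + int n2 \<le> n}"

lemma Dhol_minus_one: "Dhol (-1) p = {0}"
proof -
  have "{diff_functional p n1 n2 | n1 n2. int n1 + int n2 \<le> -1} = {}" by auto
  then show ?thesis unfolding Dhol_def by (simp only: cfun.span_empty)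
qed

definition dual_incl :: "(complex^2 \<Rightarrow> complex) set \<Rightarrow> functional2 \<Rightarrow> functional2" where
  "dual_incl V \<phi> = (\<lambda>h. if h \<in> V then \<phi> h else 0)"

definition quotient_cosets :: "functional2 set \<Rightarrow> functional2 set \<Rightarrow> functional2 set set" where
  "quotient_cosets X Y = (\<lambda>\<phi>. \<phi> +o Y) ` X"

text \<open>
  The map induced by \<^term>\<open>dual_incl V\<close> on cosets is the direct image of cosets; the two lemmas
  below show that it sends the class of \<open>\<phi>\<close> to the class of \<open>dual_incl V \<phi>\<close> and is onto.
\<close>

definition kappa_map :: "(complex^2 \<Rightarrow> complex) set \<Rightarrow> functional2 set \<Rightarrow> functional2 set" where
  "kappa_map V C = dual_incl V ` C"

lemma kappa_map_coset: "kappa_map V (\<phi> +o Y) = dual_incl V \<phi> +o (dual_incl V ` Y)"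
proof -
  have "dual_incl V (\<phi> + \<psi>) = dual_incl V \<phi> + dual_incl V \<psi>" for \<psi>
    by (auto simp: dual_incl_def fun_eq_iff)
  moreover have "\<xi> +o Z = (\<lambda>\<psi>. \<xi> + \<psi>) ` Z" for \<xi> :: functional2 and Z
    by (auto simp: elt_set_plus_def)
  ultimately show ?thesis
    by (simp add: kappa_map_def image_image)
qed

lemma kappa_map_onto:
  "kappa_map V ` quotient_cosets X Y = quotient_cosets (dual_incl V ` X) (dual_incl V ` Y)"
  by (simp add: quotient_cosets_def image_image kappa_map_coset)

definition kappa_injective :: "(complex^2 \<Rightarrow> complex) set \<Rightarrow> nat \<Rightarrow> complex^2 \<Rightarrow> bool" where
  "kappa_injective V n p \<longleftrightarrow>
     inj_on (kappa_map V) (quotient_cosets (Dhol (int n) p) (Dhol (int n - 1) p))"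

end

theory Submission
  imports Defs "HOL-Complex_Analysis.Great_Picard" "HOL-Computational_Algebra.Fundamental_Theorem_Algebra"
begin

text \<open>
  Suppose \<open>f\<close> is not affine. The leading homogeneous parts of \<open>f\<close> and of \<open>g = f\<inverse>\<close> are
  \<open>l(z) ^ d v\<close> and \<open>l'(z) ^ e v'\<close> with linear forms \<open>l, l'\<close> such that \<open>l v' = l' v = 0\<close>, because a fibre of
  a linear combination of the components of \<open>f\<close> is a polynomially parametrized line and so has a
  single direction at infinity. Since \<open>G2\<close> spans all matrices, some \<open>A\<close> in it satisfies \<open>l (A v) \<noteq> 0\<close>;
  then \<open>F z = f (A z + b)\<close> still acts boundedly on \<open>V\<close>, and it behaves like a Henon map: in a forward
  invariant region the coordinate \<open>\<xi> = l \<circ> A\<close> grows quadratically as soon as it is large.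

  Along the line \<open>t v\<close> the polynomial \<open>\<xi> \<circ> F ^ n\<close> has degree at least \<open>2 ^ n\<close>. At the point \<open>t\<close> of
  largest modulus with \<open>\<bar>\<xi> (F ^ n (t v))\<bar> \<le> \<rho>\<close> its derivative is at least \<open>2 ^ n / 2\<close>. Comparing the
  radii of the discs around \<open>t\<close> on which the successive iterates stay bounded yields exponentially
  small discs on which some iterate \<open>F ^ j\<close> is bounded but oscillates by a definite amount. By
  Montel's theorem their rescalings converge to a nonconstant holomorphic disc \<open>\<psi>\<close>. As
  \<open>\<bar>h \<circ> F ^ n\<bar>\<close> grows at most exponentially on compact sets for \<open>h\<close> in \<open>V\<close>, all derivatives of \<open>h \<circ> \<psi>\<close> of
  large order \<open>M\<close> vanish. The derivative of order \<open>M\<close> along \<open>\<psi>\<close> is a differential functional of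
  order exactly \<open>M\<close>, so \<open>\<kappa>\<close> fails to be injective for all large \<open>M\<close> at infinitely many points.
\<close>

section \<open>Growth of iterates on compact sets\<close>

text \<open>The continuous function \<open>cmod (g z)\<close> attains its maximum on the compact
  set, so this maximum stays strictly below \<open>e\<close>; the gap is the radius of a
  neighborhood of \<open>g\<close>.\<close>

lemma openin_hol2_sup_less:
  assumes "compact K" "e > 0"
  shows "openin hol2_topology {g \<in> hol2. \<forall>z\<in>K. cmod (g z) < e}"
  unfolding openin_hol2_topology
proof (intro conjI ballI)
  fix g assume g: "g \<in> {g \<in> hol2. \<forall>z\<in>K. cmod (g z) < e}"
  have "isCont g z" for z
    using g has_derivative_continuous[of g _ z UNIV] unfolding hol2_def by blast
  then have "continuous_on K g"
    by (simp add: continuous_at_imp_continuous_on)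
  then have cont: "continuous_on K (\<lambda>z. cmod (g z))"
    by (intro continuous_intros)
  have "\<exists>m<e. \<forall>z\<in>K. cmod (g z) \<le> m"
  proof (cases "K = {}")
    case True
    then show ?thesis using \<open>e > 0\<close> by (auto intro!: exI[of _ 0])
  next
    case False
    then obtain x where "x \<in> K" "\<forall>y\<in>K. cmod (g y) \<le> cmod (g x)"
      using continuous_attains_sup[OF assms(1) _ cont] by blast
    then show ?thesis using g by blast
  qed
  then obtain m where m: "m < e" "\<forall>z\<in>K. cmod (g z) \<le> m" by blast
  have "cmod (k z) < e" if "z \<in> K" "cmod (k z - g z) < e - m" for k z
    using norm_triangle_sub[of "k z" "g z"] m that by fastforce
  then have "hol2_nbhd g K (e - m) \<subseteq> {g \<in> hol2. \<forall>z\<in>K. cmod (g z) < e}"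
    unfolding hol2_nbhd_def by auto
  then show "\<exists>L d. compact L \<and> d > 0 \<and> hol2_nbhd g L d \<subseteq> {g \<in> hol2. \<forall>z\<in>K. cmod (g z) < e}"
    using assms m by (intro exI[of _ K] exI[of _ "e - m"]) auto
qed auto

text \<open>The bounded neighborhood \<open>U\<close> of 0 plays the role of a unit ball and
  \<open>r\<close> that of the norm of composition with \<open>F\<close>. Only \<open>c\<close>
  depends on \<open>h\<close>; because one rate \<open>r\<close> serves all of \<open>V\<close>, one
  threshold for the order of the derivatives will later serve all of \<open>V\<close>.\<close>

lemma bounded_comp_iterate_bound:
  assumes qb: "quasi_banach V T"
    and incl: "continuous_map T hol2_topology (\<lambda>h. h)"
    and bc: "bounded_comp V T F"
    and K: "compact K"
  obtains r :: real where "r > 0"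
    and "\<And>h. h \<in> V \<Longrightarrow> \<exists>c\<ge>0. \<forall>n. \<forall>z\<in>K. cmod (h ((F ^^ n) z)) \<le> c * r ^ n"
proof -
  from qb have tvs: "complex_tvs V T" unfolding quasi_banach_def by blast
  from qb obtain U where U: "openin T U" "0 \<in> U" "tvs_bounded T U"
    unfolding quasi_banach_def by blast
  have top: "topspace T = V" and sub: "cfun.subspace V"
    and scl: "continuous_map (prod_topology euclidean T) T (\<lambda>(c, x). fscale c x)"
    using tvs unfolding complex_tvs_def by auto
  have V0: "0 \<in> V" using sub by (rule cfun.subspace_0)
  have absorb: "\<exists>r::real>0. U \<subseteq> fscale (of_real r) ` W" if W: "openin T W" "0 \<in> W" for W
  proof -
    obtain r where r: "r > 0" "\<forall>c. r \<le> cmod c \<longrightarrow> U \<subseteq> fscale c ` W"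
      using U(3) W unfolding tvs_bounded_def by blast
    then have "U \<subseteq> fscale (of_real r) ` W" by simp
    then show ?thesis using r by blast
  qed
  \<comment> \<open>The inclusion of \<open>U\<close> in a multiple \<open>r W\<close> of this
    preimage says that composition with \<open>F\<close> maps \<open>U\<close> into
    \<open>r U\<close>.\<close>
  define W where "W = {h \<in> topspace T. h \<circ> F \<in> U}"
  have "continuous_map T T (\<lambda>h. h \<circ> F)" using bc unfolding bounded_comp_def by blast
  then have "openin T W"
    unfolding W_def using U(1) by (rule openin_continuous_map_preimage)
  moreover have "0 \<in> W"
    using U(2) V0 top unfolding W_def by (simp add: comp_def zero_fun_def)
  ultimately obtain r :: real where r: "r > 0" "U \<subseteq> fscale (of_real r) ` W"
    using absorb by blast
  have iter: "\<exists>u\<in>U. \<forall>z. h ((F ^^ n) z) = of_real r ^ n * u z" if "h \<in> U" for h n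
  proof (induction n)
    case 0
    show ?case using that by (intro bexI[of _ h]) auto
  next
    case (Suc n)
    then obtain u where u: "u \<in> U" "\<forall>z. h ((F ^^ n) z) = of_real r ^ n * u z" by blast
    then obtain w where w: "w \<in> W" "u = fscale (of_real r) w" using r(2) by blast
    have "h ((F ^^ Suc n) z) = of_real r ^ Suc n * (w \<circ> F) z" for z
      using u(2)[rule_format, of "F z"] w(2)
      by (simp add: fscale_def funpow_swap1)
    moreover have "w \<circ> F \<in> U" using w(1) unfolding W_def by blast
    ultimately show ?case by blast
  qed
  \<comment> \<open>Continuity of the inclusion makes \<open>W2\<close> a neighborhood of 0, so the
    bounded set \<open>U\<close> is uniformly bounded on \<open>K\<close>.\<close>
  define W2 where "W2 = {h \<in> topspace T. h \<in> {g \<in> hol2. \<forall>z\<in>K. cmod (g z) < 1}}"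
  have "openin T W2"
    unfolding W2_def by (rule openin_continuous_map_preimage[OF incl openin_hol2_sup_less[OF K]]) simp
  moreover have "0 \<in> W2"
  proof -
    have "0 \<in> hol2"
      using continuous_map_image_subset_topspace[OF incl] V0 top topspace_hol2_topology by auto
    then show ?thesis unfolding W2_def using V0 top by simp
  qed
  ultimately obtain s :: real where s: "s > 0" "U \<subseteq> fscale (of_real s) ` W2"
    using absorb by blast
  have Ub: "cmod (u z) \<le> s" if "u \<in> U" "z \<in> K" for u z
  proof -
    have "u \<in> fscale (of_real s) ` W2" using that s(2) by blast
    then obtain w where "w \<in> W2" "u = fscale (of_real s) w" by blast
    then show ?thesis using that s(1) unfolding W2_def fscale_def
      by (auto simp: norm_mult intro: less_imp_le)
  qed
  show thesis
  proof (rule that[OF r(1)])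
    fix h assume h: "h \<in> V"
    \<comment> \<open>Scalar multiplication is continuous, so some nonzero multiple
      \<open>c h\<close> lies in \<open>U\<close>, and the estimate on \<open>U\<close> passes to
      \<open>h\<close>.\<close>
    have "continuous_map euclidean T ((\<lambda>(c, x). fscale c x) \<circ> (\<lambda>c. (c, h)))"
      by (rule continuous_map_compose[OF _ scl])
         (simp add: continuous_map_pairedI h top)
    then have "continuous_map euclidean T (\<lambda>c. fscale c h)" by (simp add: comp_def)
    then have "openin euclidean {c \<in> topspace euclidean. fscale c h \<in> U}"
      using U(1) by (rule openin_continuous_map_preimage)
    then have op: "open {c. fscale c h \<in> U}" by simp
    have "0 \<in> {c. fscale c h \<in> U}"
      using U(2) by (simp add: fscale_def zero_fun_def)
    then obtain e where e: "e > 0" "ball 0 e \<subseteq> {c. fscale c h \<in> U}"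
      using op open_contains_ball by blast
    define c where "c = (of_real (e / 2) :: complex)"
    have c: "c \<noteq> 0" "fscale c h \<in> U"
      using e unfolding c_def by (auto simp: subset_iff dist_norm)
    have "cmod (h ((F ^^ n) z)) \<le> s / cmod c * r ^ n" if "z \<in> K" for n z
    proof -
      obtain u where u: "u \<in> U" "\<forall>z. fscale c h ((F ^^ n) z) = of_real r ^ n * u z"
        using iter[OF c(2)] by blast
      have "c * h ((F ^^ n) z) = of_real r ^ n * u z"
        using u(2) by (simp add: fscale_def)
      then have "cmod c * cmod (h ((F ^^ n) z)) = r ^ n * cmod (u z)"
        using r(1) by (metis abs_of_pos norm_mult norm_of_real norm_power)
      also have "\<dots> \<le> r ^ n * s"
        using Ub[OF u(1) that] r(1) by (intro mult_left_mono) auto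
      finally show ?thesis using c(1) by (simp add: field_simps)
    qed
    then show "\<exists>c\<ge>0. \<forall>n. \<forall>z\<in>K. cmod (h ((F ^^ n) z)) \<le> c * r ^ n"
      using s(1) by (intro exI[of _ "s / cmod c"]) auto
  qed
qed

lemma bounded_comp_compose:
  assumes "bounded_comp V T f" "bounded_comp V T g"
  shows "bounded_comp V T (f \<circ> g)"
proof -
  have "continuous_map T T ((\<lambda>h. h \<circ> g) \<circ> (\<lambda>h. h \<circ> f))"
    using assms unfolding bounded_comp_def by (blast intro: continuous_map_compose)
  then show ?thesis
    using assms unfolding bounded_comp_def by (auto simp: comp_def)
qed

section \<open>Jets along holomorphic curves\<close>

lemma vec2_eq_iff: "x = y \<longleftrightarrow> x $ 1 = y $ 1 \<and> x $ 2 = y $ 2" for x y :: "complex^2"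
  by (auto simp: vec_eq_iff forall_2)

lemma vec2_collapse [simp]: "vector [z $ 1, z $ 2] = z" for z :: "complex^2"
  by (simp add: vec2_eq_iff)

lemma norm_vec2_le: "norm z \<le> cmod (z $ 1) + cmod (z $ 2)" for z :: "complex^2"
  unfolding norm_vec_def using L2_set_le_sum[of UNIV "\<lambda>i. cmod (z $ i)"] by (simp add: sum_2)

lemma bounded_linear_vector2: "bounded_linear (\<lambda>p. vector [fst p, snd p] :: complex^2)"
proof (rule bounded_linear_intro[where K = 2])
  fix p :: "complex \<times> complex"
  have "cmod (fst p) \<le> norm p" "cmod (snd p) \<le> norm p"
    by (metis norm_fst_le prod.collapse, metis norm_snd_le prod.collapse)
  then show "norm (vector [fst p, snd p] :: complex^2) \<le> norm p * 2"
    using norm_vec2_le[of "vector [fst p, snd p]"] by simp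
qed (simp_all add: vec2_eq_iff)

text \<open>The chain rule gives a real derivative along the curve; complex homogeneity of
  \<open>D\<close> turns it into multiplication by a single complex number.\<close>

lemma hol2_has_field_derivative:
  assumes "h \<in> hol2"
    and "(f has_field_derivative a) (at t)" "(g has_field_derivative b) (at t)"
  shows "\<exists>D. ((\<lambda>t. h (vector [f t, g t])) has_field_derivative D) (at t)"
proof -
  obtain D where D: "(h has_derivative D) (at (vector [f t, g t]))" "\<And>c v. D (c *s v) = c * D v"
    using assms(1) unfolding hol2_def by blast
  have "((\<lambda>t. (f t, g t)) has_derivative (\<lambda>k. (a * k, b * k))) (at t)"
    using assms(2,3) unfolding has_field_derivative_def by (rule has_derivative_Pair)
  then have "((\<lambda>t. vector [f t, g t] :: complex^2) has_derivative (\<lambda>k. vector [a * k, b * k])) (at t)"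
    using bounded_linear.has_derivative[OF bounded_linear_vector2] by fastforce
  from has_derivative_compose[OF this D(1)]
  have "((\<lambda>t. h (vector [f t, g t])) has_derivative (\<lambda>k. D (vector [a * k, b * k]))) (at t)" .
  moreover have "vector [a * k, b * k] = k *s (vector [a, b] :: complex^2)" for k
    by (simp add: vec2_eq_iff)
  then have "(\<lambda>k. D (vector [a * k, b * k])) = (*) (D (vector [a, b]))"
    by (simp add: D(2) fun_eq_iff)
  ultimately have "((\<lambda>t. h (vector [f t, g t])) has_derivative (*) (D (vector [a, b]))) (at t)"
    by simp
  then show ?thesis unfolding has_field_derivative_def by blast
qed

lemma hol2_holomorphic_on:
  assumes "h \<in> hol2" "f holomorphic_on S" "g holomorphic_on S" "open S"
  shows "(\<lambda>t. h (vector [f t, g t])) holomorphic_on S"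
  using hol2_has_field_derivative[OF assms(1)] assms(2-4)
  by (simp add: holomorphic_on_open) blast

lemma hol2_continuous_on: "h \<in> hol2 \<Longrightarrow> continuous_on A h"
  unfolding hol2_def
  by (intro continuous_at_imp_continuous_on) (blast intro: has_derivative_continuous)

text \<open>Local boundedness, which follows from continuity, is what the Cauchy estimates need, and unlike
  joint differentiability it visibly passes to partial derivatives.\<close>

definition sep_hol :: "(complex \<Rightarrow> complex \<Rightarrow> complex) \<Rightarrow> bool" where
  "sep_hol g \<longleftrightarrow> (\<forall>s. g s holomorphic_on UNIV) \<and> (\<forall>t. (\<lambda>s. g s t) holomorphic_on UNIV) \<and>
     (\<forall>R. \<exists>B. \<forall>s t. cmod s \<le> R \<longrightarrow> cmod t \<le> R \<longrightarrow> cmod (g s t) \<le> B)"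

lemma sep_holD:
  assumes "sep_hol g"
  shows "g s holomorphic_on A" "(\<lambda>s. g s t) holomorphic_on A"
    "\<exists>B\<ge>0. \<forall>s t. cmod s \<le> R \<longrightarrow> cmod t \<le> R \<longrightarrow> cmod (g s t) \<le> B"
proof -
  show "g s holomorphic_on A" "(\<lambda>s. g s t) holomorphic_on A"
    using assms unfolding sep_hol_def by (meson holomorphic_on_subset subset_UNIV)+
  obtain B where "\<forall>s t. cmod s \<le> R \<longrightarrow> cmod t \<le> R \<longrightarrow> cmod (g s t) \<le> B"
    using assms unfolding sep_hol_def by blast
  then show "\<exists>B\<ge>0. \<forall>s t. cmod s \<le> R \<longrightarrow> cmod t \<le> R \<longrightarrow> cmod (g s t) \<le> B"
    by (intro exI[of _ "max B 0"]) (auto simp: le_max_iff_disj)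
qed

lemma sep_hol_swap: "sep_hol g \<Longrightarrow> sep_hol (\<lambda>t s. g s t)"
  unfolding sep_hol_def by meson

lemma hol2_sep_hol:
  assumes "h \<in> hol2"
  shows "sep_hol (\<lambda>s t. h (vector [s, t]))"
  unfolding sep_hol_def
proof (intro conjI allI)
  show "(\<lambda>t. h (vector [s, t])) holomorphic_on UNIV" "(\<lambda>s. h (vector [s, t])) holomorphic_on UNIV" for s t
    by (intro hol2_holomorphic_on[OF assms] holomorphic_intros; simp)+
  fix R :: real
  have "compact (h ` cball 0 (2 * R))"
    by (intro compact_continuous_image hol2_continuous_on assms compact_cball)
  then obtain B where B: "\<forall>x\<in>h ` cball 0 (2 * R). norm x \<le> B"
    using compact_imp_bounded bounded_iff by blast
  have "cmod (h (vector [s, t])) \<le> B" if "cmod s \<le> R" "cmod t \<le> R" for s t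
    using B norm_vec2_le[of "vector [s, t]"] that by (auto simp: dist_norm)
  then show "\<exists>B. \<forall>s t. cmod s \<le> R \<longrightarrow> cmod t \<le> R \<longrightarrow> cmod (h (vector [s, t])) \<le> B" by blast
qed

lemma entire_deriv_bound:
  assumes "f holomorphic_on UNIV" "\<And>w. cmod (w - z) \<le> r \<Longrightarrow> cmod (f w) \<le> B" "r > 0"
  shows "cmod ((deriv ^^ n) f z) \<le> fact n * B / r ^ n"
  using assms
  by (intro Cauchy_inequality holomorphic_on_imp_continuous_on)
     (auto intro: holomorphic_on_subset simp: norm_minus_commute)

text \<open>Cauchy's estimate on unit discs in the second variable turns a bound for radius
  \<open>R + 1\<close> into one for radius \<open>R\<close>.\<close>

lemma sep_hol_higher_deriv_bound:
  assumes "sep_hol g"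
  shows "\<exists>B\<ge>0. \<forall>s t. cmod s \<le> R \<longrightarrow> cmod t \<le> R \<longrightarrow> cmod ((deriv ^^ n) (g s) t) \<le> B"
proof -
  obtain B where B: "B \<ge> 0" "\<forall>s t. cmod s \<le> R + 1 \<longrightarrow> cmod t \<le> R + 1 \<longrightarrow> cmod (g s t) \<le> B"
    using sep_holD(3)[OF assms] by blast
  have "cmod ((deriv ^^ n) (g s) t) \<le> fact n * B / 1 ^ n" if "cmod s \<le> R" "cmod t \<le> R" for s t
  proof (rule entire_deriv_bound)
    show "cmod (g s w) \<le> B" if "cmod (w - t) \<le> 1" for w
      using B(2) norm_triangle_sub[of w t] that \<open>cmod s \<le> R\<close> \<open>cmod t \<le> R\<close> by fastforce
  qed (use sep_holD[OF assms] in auto)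
  then show ?thesis using B(1) by (intro exI[of _ "fact n * B"]) auto
qed

text \<open>Taylor's formula in \<open>t\<close> alone, with a constant uniform in \<open>s\<close>.
  This uniformity permits both differentiation under the parameter and substitution of a curve for
  \<open>(s, t)\<close>.\<close>

lemma sep_hol_Taylor:
  assumes "sep_hol g"
  shows "\<exists>C\<ge>0. \<forall>s t. cmod s \<le> R \<longrightarrow> cmod (t - t0) \<le> 1 \<longrightarrow>
    cmod (g s t - (\<Sum>i\<le>n. (deriv ^^ i) (g s) t0 * (t - t0) ^ i / fact i)) \<le> C * cmod (t - t0) ^ Suc n"
proof -
  \<comment> \<open>The radius covers both the parameters \<open>s\<close> and the unit disc around
    \<open>t0\<close>.\<close>
  obtain B where B: "B \<ge> 0" "\<forall>s t. cmod s \<le> max R (cmod t0 + 1) \<longrightarrow> cmod t \<le> max R (cmod t0 + 1) \<longrightarrow>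
      cmod ((deriv ^^ Suc n) (g s) t) \<le> B"
    using sep_hol_higher_deriv_bound[OF assms] by blast
  have "cmod ((deriv ^^ 0) (g s) t - (\<Sum>i\<le>n. (deriv ^^ i) (g s) t0 * (t - t0) ^ i / fact i)) \<le>
      B * cmod (t - t0) ^ Suc n / fact n" if "cmod s \<le> R" "cmod (t - t0) \<le> 1" for s t
  proof (rule complex_Taylor[where f = "\<lambda>i. (deriv ^^ i) (g s)"])
    show "convex (cball t0 1)" by simp
    show "((deriv ^^ i) (g s) has_field_derivative (deriv ^^ Suc i) (g s) x) (at x within cball t0 1)" for i x
      using holomorphic_derivI[OF holomorphic_higher_deriv[where n = i, OF sep_holD(1)[OF assms, of s UNIV]]]
      by (simp add: has_field_derivative_at_within)
    show "cmod ((deriv ^^ Suc n) (g s) x) \<le> B" if "x \<in> cball t0 1" for x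
    proof -
      have "cmod x \<le> cmod t0 + 1"
        using that norm_triangle_sub[of x t0] by (simp add: dist_norm norm_minus_commute)
      then show ?thesis using B(2) \<open>cmod s \<le> R\<close> by auto
    qed
  qed (use that in \<open>auto simp: dist_norm norm_minus_commute\<close>)
  then show ?thesis
    using B(1) by (intro exI[of _ "B / fact n"]) auto
qed

text \<open>The delicate clause is holomorphy of the \<open>t\<close>-derivative in
  \<open>s\<close>. Difference quotients in \<open>t\<close> are holomorphic in \<open>s\<close>
  and, by the uniform Taylor estimate of order 1, converge uniformly on discs.\<close>

lemma sep_hol_deriv:
  assumes g: "sep_hol g"
  shows "sep_hol (\<lambda>s. deriv (g s))"
  unfolding sep_hol_def
proof (intro conjI allI)
  show "deriv (g s) holomorphic_on UNIV" for s
    using sep_holD(1)[OF g] by (intro holomorphic_deriv) auto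
  show "\<exists>B. \<forall>s t. cmod s \<le> R \<longrightarrow> cmod t \<le> R \<longrightarrow> cmod (deriv (g s) t) \<le> B" for R
    using sep_hol_higher_deriv_bound[OF g, of R 1] by auto
  fix t0
  define q where "q n s = (g s (t0 + of_real (inverse (Suc n))) - g s t0) * of_nat (Suc n)" for n s
  show "(\<lambda>s. deriv (g s) t0) holomorphic_on UNIV"
  proof (rule holomorphic_uniform_sequence[where f = q])
    show "q n holomorphic_on UNIV" for n
      unfolding q_def by (intro holomorphic_intros sep_holD(2)[OF g])
    fix x :: complex
    obtain C where C: "C \<ge> 0" "\<forall>s t. cmod s \<le> cmod x + 1 \<longrightarrow> cmod (t - t0) \<le> 1 \<longrightarrow>
      cmod (g s t - (\<Sum>i\<le>1. (deriv ^^ i) (g s) t0 * (t - t0) ^ i / fact i)) \<le> C * cmod (t - t0) ^ Suc 1"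
      using sep_hol_Taylor[OF g, of "cmod x + 1" t0 1] by blast
    have qb: "cmod (q n s - deriv (g s) t0) \<le> C * inverse (Suc n)" if "s \<in> cball x 1" for n s
    proof -
      let ?e = "of_real (inverse (Suc n)) :: complex"
      have s: "cmod s \<le> cmod x + 1"
        using that norm_triangle_sub[of s x] by (simp add: dist_norm norm_minus_commute)
      have e1: "cmod ?e \<le> 1" by (simp only: norm_of_real) (simp add: divide_simps)
      have "q n s - deriv (g s) t0 = (g s (t0 + ?e) - (g s t0 + deriv (g s) t0 * ?e)) * of_nat (Suc n)"
        unfolding q_def by (simp add: algebra_simps del: of_nat_Suc)
      then have "cmod (q n s - deriv (g s) t0)
          = cmod (g s (t0 + ?e) - (g s t0 + deriv (g s) t0 * ?e)) * Suc n"
        by (simp add: norm_mult del: of_nat_Suc)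
      also have "\<dots> \<le> (C * cmod ?e ^ Suc 1) * Suc n"
        using C(2)[rule_format, OF s, of "t0 + ?e"] e1
        by (intro mult_right_mono) (simp_all add: algebra_simps)
      also have "\<dots> = C * inverse (Suc n)"
        by (simp add: field_simps power2_eq_square norm_divide norm_inverse del: of_nat_Suc)
      finally show ?thesis .
    qed
    have "uniform_limit (cball x 1) q (\<lambda>s. deriv (g s) t0) sequentially"
    proof (rule uniform_limitI)
      fix e :: real assume "e > 0"
      have "(\<lambda>n. C * inverse (real (Suc n))) \<longlonglongrightarrow> C * 0"
        by (intro tendsto_intros LIMSEQ_inverse_real_of_nat)
      then have "\<forall>\<^sub>F n in sequentially. C * inverse (Suc n) < e"
        using \<open>e > 0\<close> by (intro order_tendstoD(2)) auto
      then show "\<forall>\<^sub>F n in sequentially. \<forall>y\<in>cball x 1. dist (q n y) (deriv (g y) t0) < e"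
        by eventually_elim (auto simp: dist_norm intro!: le_less_trans[OF qb])
    qed
    then show "\<exists>d>0. cball x d \<subseteq> UNIV \<and> uniform_limit (cball x d) q (\<lambda>s. deriv (g s) t0) sequentially"
      by (intro exI[of _ 1]) auto
  qed auto
qed

lemma sep_hol_higher_deriv: "sep_hol g \<Longrightarrow> sep_hol (\<lambda>s. (deriv ^^ n) (g s))"
  by (induction n) (auto dest: sep_hol_deriv)

section \<open>Iterated partial derivatives and orders of vanishing along curves\<close>

lemma pd_1_funpow: "(pd 1 ^^ n) h z = (deriv ^^ n) (\<lambda>s. h (vector [s, z $ 2])) (z $ 1)"
proof (induction n arbitrary: z)
  case (Suc n)
  have "(\<chi> j. if j = 1 then w else z $ j) = vector [w, z $ 2]" for w
    by (simp add: vec2_eq_iff)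
  then show ?case by (simp add: pd_def[of _ "(pd 1 ^^ n) h"] Suc)
qed simp

lemma pd_2_funpow: "(pd 2 ^^ n) h z = (deriv ^^ n) (\<lambda>t. h (vector [z $ 1, t])) (z $ 2)"
proof (induction n arbitrary: z)
  case (Suc n)
  have "(\<chi> j. if j = 2 then w else z $ j) = vector [z $ 1, w]" for w
    by (simp add: vec2_eq_iff)
  then show ?case by (simp add: pd_def[of _ "(pd 2 ^^ n) h"] Suc)
qed simp

text \<open>Cauchy's estimate on the circle of radius \<open>e\<close> bounds the derivative by a
  multiple of \<open>e ^ (Suc n - k)\<close>, which tends to 0 with \<open>e\<close>.\<close>

lemma higher_deriv_eq_0:
  assumes "f holomorphic_on ball z r" "r > 0"
    and bd: "\<And>w. w \<in> ball z r \<Longrightarrow> cmod (f w) \<le> C * cmod (w - z) ^ Suc n"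
    and "k \<le> n"
  shows "(deriv ^^ k) f z = 0"
proof -
  have "cmod ((deriv ^^ k) f z) \<le> fact k * C * e ^ (Suc n - k)" if e: "e > 0" "e < r" for e
  proof -
    have "cmod ((deriv ^^ k) f z) \<le> fact k * (C * e ^ Suc n) / e ^ k"
    proof (rule Cauchy_inequality)
      show "f holomorphic_on ball z e"
        using assms(1) e by (auto intro: holomorphic_on_subset)
      show "continuous_on (cball z e) f"
        using assms(1) e by (auto intro!: holomorphic_on_imp_continuous_on intro: holomorphic_on_subset)
      show "cmod (f x) \<le> C * e ^ Suc n" if "cmod (z - x) = e" for x
        using bd[of x] that e by (simp add: dist_norm norm_minus_commute)
    qed (use e in auto)
    also have "\<dots> = fact k * C * e ^ (Suc n - k)"
      using e \<open>k \<le> n\<close> by (simp add: power_diff)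
    finally show ?thesis .
  qed
  then have "\<forall>\<^sub>F e in at_right 0. cmod ((deriv ^^ k) f z) \<le> fact k * C * e ^ (Suc n - k)"
    using \<open>r > 0\<close> unfolding eventually_at_right_field by blast
  moreover have "((\<lambda>e. fact k * C * e ^ (Suc n - k)) \<longlongrightarrow> fact k * C * 0 ^ (Suc n - k)) (at_right 0)"
    by (intro tendsto_intros)
  ultimately have "cmod ((deriv ^^ k) f z) \<le> fact k * C * 0 ^ (Suc n - k)"
    by (intro tendsto_lowerbound) auto
  then show ?thesis using \<open>k \<le> n\<close> by (simp add: power_0_left)
qed

lemma higher_deriv_sum:
  assumes "\<And>i. i \<in> I \<Longrightarrow> f i holomorphic_on S" "open S" "z \<in> S"
  shows "(deriv ^^ n) (\<lambda>w. \<Sum>i\<in>I. f i w) z = (\<Sum>i\<in>I. (deriv ^^ n) (f i) z)"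
  using assms(1)
proof (induction I rule: infinite_finite_induct)
  case (insert i I)
  then show ?case
    using assms(2,3) by (simp add: higher_deriv_add[where S = S] holomorphic_on_sum)
qed auto

text \<open>Difference quotients converge, so they are bounded near \<open>z\<close>. The additional
  bound by 1 keeps the curve inside the unit disc in which \<open>sep_hol_Taylor\<close> is
  valid.\<close>

lemma holomorphic_local_Lipschitz:
  assumes "f holomorphic_on ball z r" "r > 0"
  shows "\<exists>L>0. \<exists>d>0. d \<le> r \<and> (\<forall>w\<in>ball z d. cmod (f w - f z) \<le> L * cmod (w - z) \<and> cmod (f w - f z) \<le> 1)"
proof -
  obtain D where "(f has_field_derivative D) (at z)"
    using assms by (meson centre_in_ball holomorphic_on_open open_ball)
  then have "((\<lambda>w. (f w - f z) / (w - z)) \<longlongrightarrow> D) (at z)"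
    by (simp add: has_field_derivative_iff)
  then have "((\<lambda>w. cmod ((f w - f z) / (w - z))) \<longlongrightarrow> cmod D) (at z)"
    by (rule tendsto_norm)
  then have "\<forall>\<^sub>F w in at z. cmod ((f w - f z) / (w - z)) < cmod D + 1"
    by (rule order_tendstoD) simp
  then obtain d where d: "d > 0" "\<forall>w. w \<noteq> z \<and> dist w z < d \<longrightarrow> cmod ((f w - f z) / (w - z)) < cmod D + 1"
    unfolding eventually_at by blast
  define L where "L = cmod D + 1"
  define e where "e = min (min d r) (1 / L)"
  have L: "L > 0" unfolding L_def by (simp add: add_nonneg_pos)
  have "cmod (f w - f z) \<le> L * cmod (w - z)" if "w \<in> ball z e" for w
  proof (cases "w = z")
    case False
    then have "cmod ((f w - f z) / (w - z)) < L"
      using d(2) that unfolding e_def L_def by (auto simp: dist_commute)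
    then show ?thesis using False by (simp add: norm_divide divide_simps split: if_splits)
  qed simp
  moreover have "L * cmod (w - z) \<le> 1" if "w \<in> ball z e" for w
  proof -
    have "cmod (w - z) \<le> 1 / L"
      using that unfolding e_def by (auto simp: dist_norm norm_minus_commute)
    then show ?thesis using L by (simp add: field_simps)
  qed
  ultimately show ?thesis
    using L d(1) assms(2)
    by (intro exI[of _ L] conjI exI[of _ e]) (fastforce simp: e_def)+
qed

lemma sum_fun_apply: "(\<Sum>i\<in>I. f i) x = (\<Sum>i\<in>I. f i x)"
  for f :: "'i \<Rightarrow> 'a \<Rightarrow> complex"
  by (induction I rule: infinite_finite_induct) auto

text \<open>Each increment is of size at most a multiple of \<open>cmod (w - z)\<close>, so the
  product vanishes at \<open>z\<close> to order \<open>a + b\<close>.\<close>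

lemma higher_deriv_monomial_eq_0:
  assumes "f holomorphic_on ball z r" "g holomorphic_on ball z r" "r > 0" "k < a + b"
  shows "(deriv ^^ k) (\<lambda>w. (f w - f z) ^ a * (g w - g z) ^ b) z = 0"
proof -
  obtain L d where L: "L > 0" "d > 0" "d \<le> r" "\<forall>w\<in>ball z d. cmod (f w - f z) \<le> L * cmod (w - z)"
    using holomorphic_local_Lipschitz[OF assms(1,3)] by blast
  obtain L' d' where L': "L' > 0" "d' > 0" "d' \<le> r" "\<forall>w\<in>ball z d'. cmod (g w - g z) \<le> L' * cmod (w - z)"
    using holomorphic_local_Lipschitz[OF assms(2,3)] by blast
  show ?thesis
  proof (rule higher_deriv_eq_0[where r = "min d d'" and n = "a + b - 1" and C = "L ^ a * L' ^ b"])
    show "(\<lambda>w. (f w - f z) ^ a * (g w - g z) ^ b) holomorphic_on ball z (min d d')"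
      using L(3) by (intro holomorphic_intros holomorphic_on_subset[OF assms(1)]
          holomorphic_on_subset[OF assms(2)]) auto
    fix w assume w: "w \<in> ball z (min d d')"
    have "cmod ((f w - f z) ^ a * (g w - g z) ^ b) \<le> (L * cmod (w - z)) ^ a * (L' * cmod (w - z)) ^ b"
      unfolding norm_mult norm_power
      by (intro mult_mono power_mono) (use w L L' in auto)
    also have "\<dots> = L ^ a * L' ^ b * cmod (w - z) ^ (a + b)"
      by (simp only: power_mult_distrib power_add mult_ac)
    also have "a + b = Suc (a + b - 1)" using assms(4) by simp
    finally show "cmod ((f w - f z) ^ a * (g w - g z) ^ b)
      \<le> L ^ a * L' ^ b * cmod (w - z) ^ Suc (a + b - 1)" .
  qed (use L L' assms(4) in auto)
qed

text \<open>Split off one factor and apply Leibniz: the term \<open>i = 0\<close> contains the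
  increment at \<open>z\<close> itself, and for \<open>i > 1\<close> the remaining power is
  differentiated too few times. Only \<open>i = 1\<close> survives.\<close>

lemma higher_deriv_power_diff:
  assumes f: "f holomorphic_on ball z r" and r: "r > 0"
  shows "(deriv ^^ n) (\<lambda>w. (f w - f z) ^ n) z = fact n * deriv f z ^ n"
proof (induction n)
  case (Suc n)
  let ?u = "\<lambda>w. f w - f z"
  have "(deriv ^^ Suc n) (\<lambda>w. ?u w * ?u w ^ n) z =
      (\<Sum>i = 0..Suc n. of_nat (Suc n choose i) * (deriv ^^ i) ?u z * (deriv ^^ (Suc n - i)) (\<lambda>w. ?u w ^ n) z)"
    by (intro higher_deriv_mult[where S = "ball z r"] holomorphic_intros f) (use r in auto)
  also have "\<dots> = (\<Sum>i\<in>{1}. of_nat (Suc n choose i) * (deriv ^^ i) ?u z * (deriv ^^ (Suc n - i)) (\<lambda>w. ?u w ^ n) z)"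
  proof (rule sum.mono_neutral_right)
    show "\<forall>i\<in>{0..Suc n} - {1}. of_nat (Suc n choose i) * (deriv ^^ i) ?u z *
        (deriv ^^ (Suc n - i)) (\<lambda>w. ?u w ^ n) z = 0"
    proof
      fix i assume i: "i \<in> {0..Suc n} - {1}"
      show "of_nat (Suc n choose i) * (deriv ^^ i) ?u z * (deriv ^^ (Suc n - i)) (\<lambda>w. ?u w ^ n) z = 0"
      proof (cases "i = 0")
        case False
        then have "Suc n - i < n + 0" using i by auto
        from higher_deriv_monomial_eq_0[OF f f r this] show ?thesis by simp
      qed simp
    qed
  qed auto
  also have "deriv ?u z = deriv f z"
    using holomorphic_on_imp_differentiable_at[OF f open_ball] r by (subst deriv_diff) auto
  then have "(\<Sum>i\<in>{1}. of_nat (Suc n choose i) * (deriv ^^ i) ?u z * (deriv ^^ (Suc n - i)) (\<lambda>w. ?u w ^ n) z)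
      = of_nat (Suc n) * deriv f z * (fact n * deriv f z ^ n)"
    using Suc.IH by simp
  finally show ?case by (simp add: algebra_simps)
qed simp

text \<open>Along the curve, \<open>g\<close> differs from its Taylor polynomial by a term vanishing
  to order \<open>M + 1\<close>, which the derivative of order \<open>M\<close> does not see. The
  polynomial is taken over the square \<open>a, b \<le> M\<close>, so that the two variables can be
  expanded one after the other.\<close>

lemma curve_jet_eq:
  assumes g: "sep_hol g"
    and f1: "f1 holomorphic_on ball z r" and f2: "f2 holomorphic_on ball z r" and r: "r > 0"
    and gf: "(\<lambda>w. g (f1 w) (f2 w)) holomorphic_on ball z r"
  shows "(deriv ^^ M) (\<lambda>w. g (f1 w) (f2 w)) z =
    (\<Sum>b\<le>M. \<Sum>a\<le>M. (deriv ^^ M) (\<lambda>w. (f1 w - f1 z) ^ a * (f2 w - f2 z) ^ b) z / (fact a * fact b) *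
       (deriv ^^ a) (\<lambda>s. (deriv ^^ b) (g s) (f2 z)) (f1 z))"
proof -
  \<comment> \<open>The coefficients of the expansion in the second variable are again separately
    holomorphic in their parameters, so they can be expanded in the first variable.\<close>
  define c where "c b = (\<lambda>s. (deriv ^^ b) (g s) (f2 z))" for b
  define k where "k a b = (deriv ^^ a) (c b) (f1 z) / (fact a * fact b)" for a b
  define m where "m a b w = (f1 w - f1 z) ^ a * (f2 w - f2 z) ^ b" for a b w
  obtain L1 d1 where L1: "L1 > 0" "d1 > 0" "d1 \<le> r"
    "\<And>w. w \<in> ball z d1 \<Longrightarrow> cmod (f1 w - f1 z) \<le> L1 * cmod (w - z)"
    "\<And>w. w \<in> ball z d1 \<Longrightarrow> cmod (f1 w - f1 z) \<le> 1"
    using holomorphic_local_Lipschitz[OF f1 r] by blast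
  obtain L2 d2 where L2: "L2 > 0" "d2 > 0" "d2 \<le> r"
    "\<And>w. w \<in> ball z d2 \<Longrightarrow> cmod (f2 w - f2 z) \<le> L2 * cmod (w - z)"
    "\<And>w. w \<in> ball z d2 \<Longrightarrow> cmod (f2 w - f2 z) \<le> 1"
    using holomorphic_local_Lipschitz[OF f2 r] by blast
  define d where "d = min d1 d2"
  have dball: "ball z d \<subseteq> ball z r" using L1(3) unfolding d_def by auto
  obtain C where C: "C \<ge> 0" "\<And>s t. cmod s \<le> cmod (f1 z) + 1 \<Longrightarrow> cmod (t - f2 z) \<le> 1 \<Longrightarrow>
      cmod (g s t - (\<Sum>b\<le>M. c b s * (t - f2 z) ^ b / fact b)) \<le> C * cmod (t - f2 z) ^ Suc M"
    using sep_hol_Taylor[OF g, of "cmod (f1 z) + 1" "f2 z" M] unfolding c_def by blast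
  define e where "e b s = cmod (c b s - (\<Sum>a\<le>M. (deriv ^^ a) (c b) (f1 z) * (s - f1 z) ^ a / fact a))" for b s
  have "\<exists>B\<ge>0. \<forall>s. cmod (s - f1 z) \<le> 1 \<longrightarrow> e b s \<le> B * cmod (s - f1 z) ^ Suc M" for b
    using sep_hol_Taylor[OF sep_hol_swap[OF sep_hol_higher_deriv[OF g, of b]], of "cmod (f2 z)" "f1 z" M]
    unfolding c_def e_def by blast
  then obtain B where B: "\<And>b. B b \<ge> 0" "\<And>b s. cmod (s - f1 z) \<le> 1 \<Longrightarrow> e b s \<le> B b * cmod (s - f1 z) ^ Suc M"
    by metis
  have hol: "m a b holomorphic_on ball z r" for a b
    unfolding m_def by (intro holomorphic_intros f1 f2)
  \<comment> \<open>The constant \<open>C\<close> collects the remainder of the expansion in the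
    second variable and those of the coefficients \<open>c b\<close> in the first.\<close>
  have "(deriv ^^ M) (\<lambda>w. g (f1 w) (f2 w) - (\<Sum>b\<le>M. \<Sum>a\<le>M. k a b * m a b w)) z = 0"
  proof (rule higher_deriv_eq_0[where r = d and n = M and
        C = "C * L2 ^ Suc M + (\<Sum>b\<le>M. B b * L1 ^ Suc M)"])
    show "(\<lambda>w. g (f1 w) (f2 w) - (\<Sum>b\<le>M. \<Sum>a\<le>M. k a b * m a b w)) holomorphic_on ball z d"
      by (intro holomorphic_intros holomorphic_on_subset[OF gf dball] holomorphic_on_subset[OF hol dball])
    fix w assume "w \<in> ball z d"
    then have w: "w \<in> ball z d1" "w \<in> ball z d2" unfolding d_def by auto
    let ?s = "f1 w - f1 z" and ?t = "f2 w - f2 z"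
    have "cmod (f1 w) \<le> cmod (f1 z) + 1"
      using L1(5)[OF w(1)] norm_triangle_sub[of "f1 w" "f1 z"] by simp
    then have "cmod (g (f1 w) (f2 w) - (\<Sum>b\<le>M. c b (f1 w) * ?t ^ b / fact b)) \<le> C * cmod ?t ^ Suc M"
      using L2(5)[OF w(2)] by (rule C(2))
    also have "\<dots> \<le> C * (L2 * cmod (w - z)) ^ Suc M"
      by (intro mult_left_mono power_mono L2(4) w C(1)) auto
    finally have 1: "cmod (g (f1 w) (f2 w) - (\<Sum>b\<le>M. c b (f1 w) * ?t ^ b / fact b))
        \<le> C * L2 ^ Suc M * cmod (w - z) ^ Suc M" by (simp add: power_mult_distrib mult_ac)
    have 2: "cmod (c b (f1 w) * ?t ^ b / fact b - (\<Sum>a\<le>M. k a b * m a b w))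
        \<le> B b * L1 ^ Suc M * cmod (w - z) ^ Suc M" for b
    proof -
      have "c b (f1 w) * ?t ^ b / fact b - (\<Sum>a\<le>M. k a b * m a b w) =
          (c b (f1 w) - (\<Sum>a\<le>M. (deriv ^^ a) (c b) (f1 z) * ?s ^ a / fact a)) * (?t ^ b / fact b)"
      proof -
        have "(\<Sum>a\<le>M. k a b * m a b w) =
            (\<Sum>a\<le>M. (deriv ^^ a) (c b) (f1 z) * ?s ^ a / fact a) * (?t ^ b / fact b)"
          unfolding k_def m_def sum_distrib_right by (intro sum.cong refl) (simp add: field_simps)
        then show ?thesis by (simp add: left_diff_distrib diff_divide_distrib)
      qed
      then have "cmod (c b (f1 w) * ?t ^ b / fact b - (\<Sum>a\<le>M. k a b * m a b w)) =
          cmod (c b (f1 w) - (\<Sum>a\<le>M. (deriv ^^ a) (c b) (f1 z) * ?s ^ a / fact a)) * (cmod ?t ^ b / fact b)"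
        by (simp add: norm_mult norm_divide norm_power)
      also have "\<dots> \<le> (B b * cmod ?s ^ Suc M) * 1"
      proof (intro mult_mono B(2)[unfolded e_def] L1(5) w)
        have "cmod ?t ^ b \<le> 1" by (intro power_le_one L2(5) w) auto
        also have "(1::real) \<le> fact b" by simp
        finally show "cmod ?t ^ b / fact b \<le> 1" by (simp add: divide_simps)
      qed (use B(1) in auto)
      also have "\<dots> \<le> B b * (L1 * cmod (w - z)) ^ Suc M * 1"
        by (intro mult_left_mono mult_right_mono power_mono L1(4) w B(1)) auto
      finally show ?thesis by (simp add: power_mult_distrib mult_ac)
    qed
    have "cmod (g (f1 w) (f2 w) - (\<Sum>b\<le>M. \<Sum>a\<le>M. k a b * m a b w)) =
       cmod ((g (f1 w) (f2 w) - (\<Sum>b\<le>M. c b (f1 w) * ?t ^ b / fact b)) +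
         (\<Sum>b\<le>M. c b (f1 w) * ?t ^ b / fact b - (\<Sum>a\<le>M. k a b * m a b w)))"
      by (simp add: sum_subtractf)
    also have "\<dots> \<le> C * L2 ^ Suc M * cmod (w - z) ^ Suc M + (\<Sum>b\<le>M. B b * L1 ^ Suc M * cmod (w - z) ^ Suc M)"
      by (intro norm_triangle_mono 1 sum_norm_le 2)
    finally show "cmod (g (f1 w) (f2 w) - (\<Sum>b\<le>M. \<Sum>a\<le>M. k a b * m a b w))
        \<le> (C * L2 ^ Suc M + (\<Sum>b\<le>M. B b * L1 ^ Suc M)) * cmod (w - z) ^ Suc M"
      by (simp only: distrib_right sum_distrib_right)
  qed (use L1 L2 in \<open>auto simp: d_def\<close>)
  moreover have "(deriv ^^ M) (\<lambda>w. g (f1 w) (f2 w) - (\<Sum>b\<le>M. \<Sum>a\<le>M. k a b * m a b w)) z =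
      (deriv ^^ M) (\<lambda>w. g (f1 w) (f2 w)) z - (deriv ^^ M) (\<lambda>w. \<Sum>b\<le>M. \<Sum>a\<le>M. k a b * m a b w) z"
    by (rule higher_deriv_diff[where S = "ball z r"]) (intro holomorphic_intros gf hol | use r in simp)+
  moreover have "(deriv ^^ M) (\<lambda>w. \<Sum>b\<le>M. \<Sum>a\<le>M. k a b * m a b w) z = (\<Sum>b\<le>M. \<Sum>a\<le>M. k a b * (deriv ^^ M) (m a b) z)"
  proof -
    have "(deriv ^^ M) (\<lambda>w. \<Sum>b\<le>M. \<Sum>a\<le>M. k a b * m a b w) z = (\<Sum>b\<le>M. (deriv ^^ M) (\<lambda>w. \<Sum>a\<le>M. k a b * m a b w) z)"
      by (rule higher_deriv_sum[where S = "ball z r"]) (intro holomorphic_intros hol | use r in simp)+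
    also have "\<dots> = (\<Sum>b\<le>M. \<Sum>a\<le>M. (deriv ^^ M) (\<lambda>w. k a b * m a b w) z)"
      by (intro sum.cong refl higher_deriv_sum[where S = "ball z r"]) (intro holomorphic_intros hol | use r in simp)+
    also have "\<dots> = (\<Sum>b\<le>M. \<Sum>a\<le>M. k a b * (deriv ^^ M) (m a b) z)"
      by (intro sum.cong refl higher_deriv_cmult[OF hol]) (use r in auto)
    finally show ?thesis .
  qed
  ultimately have "(deriv ^^ M) (\<lambda>w. g (f1 w) (f2 w)) z = (\<Sum>b\<le>M. \<Sum>a\<le>M. k a b * (deriv ^^ M) (m a b) z)"
    by simp
  then show ?thesis
    unfolding k_def c_def m_def by (simp add: mult_ac)
qed

section \<open>Derivatives along a curve as differential functionals of exact order\<close>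

definition curve_functional :: "(complex \<Rightarrow> complex) \<Rightarrow> (complex \<Rightarrow> complex) \<Rightarrow> complex \<Rightarrow> nat \<Rightarrow> functional2" where
  "curve_functional f1 f2 z n =
     (\<lambda>h. if h \<in> hol2 then (deriv ^^ n) (\<lambda>w. h (vector [f1 w, f2 w])) z else 0)"

lemma curve_functional_in_Dhol:
  assumes f: "f1 holomorphic_on ball z r" "f2 holomorphic_on ball z r" and r: "r > 0"
  shows "curve_functional f1 f2 z n \<in> Dhol (int n) (vector [f1 z, f2 z])"
proof -
  let ?p = "vector [f1 z, f2 z] :: complex^2"
  define K where "K a b = (deriv ^^ n) (\<lambda>w. (f1 w - f1 z) ^ a * (f2 w - f2 z) ^ b) z / (fact a * fact b)" for a b
  \<comment> \<open>Both sides are truncated to 0 outside \<open>hol2\<close>, so this is an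
    equality of functions on the whole type.\<close>
  have "curve_functional f1 f2 z n = (\<Sum>b\<le>n. \<Sum>a\<le>n. fscale (K a b) (diff_functional ?p a b))"
  proof
    fix h
    show "curve_functional f1 f2 z n h = (\<Sum>b\<le>n. \<Sum>a\<le>n. fscale (K a b) (diff_functional ?p a b)) h"
    proof (cases "h \<in> hol2")
      case True
      have "(pd 1 ^^ a) ((pd 2 ^^ b) h) ?p =
          (deriv ^^ a) (\<lambda>s. (deriv ^^ b) (\<lambda>t. h (vector [s, t])) (f2 z)) (f1 z)" for a b
        by (simp add: pd_1_funpow pd_2_funpow)
      then show ?thesis
        using curve_jet_eq[OF hol2_sep_hol[OF True] f r hol2_holomorphic_on[OF True f open_ball], of n] True
        by (simp add: curve_functional_def diff_functional_def fscale_def sum_fun_apply K_def)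
    qed (simp add: curve_functional_def diff_functional_def fscale_def sum_fun_apply)
  qed
  moreover have "fscale (K a b) (diff_functional ?p a b) \<in> Dhol (int n) ?p" for a b
  proof (cases "a + b \<le> n")
    case True
    then have "diff_functional ?p a b \<in> {diff_functional ?p a b | a b. int a + int b \<le> int n}"
      by force
    then show ?thesis unfolding Dhol_def by (intro cfun.span_scale cfun.span_base)
  next
    case False
    \<comment> \<open>The corners of the square with \<open>a + b > n\<close> drop out because the
      monomial in the increments vanishes to order greater than \<open>n\<close>.\<close>
    then have "K a b = 0"
      unfolding K_def using higher_deriv_monomial_eq_0[OF f r, of n a b] by simp
    then show ?thesis unfolding Dhol_def by (simp add: cfun.span_zero)
  qed
  ultimately show ?thesis
    unfolding Dhol_def by (auto intro!: cfun.span_sum)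
qed

text \<open>The test function vanishes to order \<open>n\<close> at \<open>p\<close>, so it detects
  whether a functional really has order \<open>n\<close>.\<close>

lemma Dhol_coordinate_power:
  assumes \<Lambda>: "\<Lambda> \<in> Dhol (int n - 1) p"
  shows "\<Lambda> (\<lambda>z. (z $ k - p $ k) ^ n) = 0"
proof -
  let ?h = "\<lambda>z :: complex^2. (z $ k - p $ k) ^ n"
  have zero: "(deriv ^^ a) (\<lambda>s. (s - c) ^ n) c = 0" if "a < n" for a and c :: complex
  proof (rule higher_deriv_eq_0[where r = 1 and C = 1 and n = "n - 1"])
    show "(\<lambda>s. (s - c) ^ n) holomorphic_on ball c 1" by (intro holomorphic_intros)
  qed (use that in \<open>auto simp: norm_power\<close>)
  have *: "(pd 1 ^^ a) ((pd 2 ^^ b) ?h) p = 0" if "a + b < n" for a b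
  proof (cases "k = 1")
    case True
    then show ?thesis
      using zero[of a "p $ 1"] that by (cases "b = 0") (simp_all add: pd_1_funpow pd_2_funpow)
  next
    case False
    then have "k = 2" using exhaust_2 by blast
    then show ?thesis
      using zero[of b "p $ 2"] that by (simp add: pd_1_funpow pd_2_funpow)
  qed
  have "cfun.subspace {\<Lambda> :: functional2. \<Lambda> ?h = 0}"
    by (rule cfun.subspaceI) (auto simp: fscale_def)
  moreover have "{diff_functional p a b | a b. int a + int b \<le> int n - 1} \<subseteq> {\<Lambda>. \<Lambda> ?h = 0}"
    using * by (auto simp: diff_functional_def)
  ultimately show ?thesis
    using cfun.span_minimal \<Lambda> unfolding Dhol_def by blast
qed

lemma coordinate_power_in_hol2: "(\<lambda>z. (z $ k - c) ^ n) \<in> hol2"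
proof -
  have "((\<lambda>z. (z $ k - c) ^ n) has_derivative (\<lambda>v. of_nat n * (v $ k) * (z $ k - c) ^ (n - 1))) (at z)"
    for z :: "complex^2"
    by (rule derivative_eq_intros bounded_linear_imp_has_derivative bounded_linear_vec_nth | simp)+
  then show ?thesis
    unfolding hol2_def by (auto intro!: exI simp: algebra_simps)
qed

text \<open>The derivative of order \<open>n\<close> along an immersed curve has order exactly
  \<open>n\<close>, so its class is nonzero; if it annihilates \<open>V\<close>, the induced map
  sends this class to zero.\<close>

lemma not_kappa_injective:
  assumes V: "V \<subseteq> hol2"
    and f: "f1 holomorphic_on ball z r" "f2 holomorphic_on ball z r" and r: "r > 0"
    and nz: "deriv f1 z \<noteq> 0 \<or> deriv f2 z \<noteq> 0"
    and van: "\<And>h. h \<in> V \<Longrightarrow> (deriv ^^ n) (\<lambda>w. h (vector [f1 w, f2 w])) z = 0"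
  shows "\<not> kappa_injective V n (vector [f1 z, f2 z])"
proof
  let ?p = "vector [f1 z, f2 z] :: complex^2"
  let ?X = "Dhol (int n) ?p" and ?Y = "Dhol (int n - 1) ?p"
  let ?L = "curve_functional f1 f2 z n"
  assume inj: "kappa_injective V n ?p"
  have "dual_incl V ?L = dual_incl V 0"
    using van V by (auto simp: dual_incl_def curve_functional_def fun_eq_iff)
  then have "kappa_map V (?L +o ?Y) = kappa_map V (0 +o ?Y)"
    by (simp only: kappa_map_coset)
  moreover have "?L +o ?Y \<in> quotient_cosets ?X ?Y"
    unfolding quotient_cosets_def using curve_functional_in_Dhol[OF f r] by blast
  moreover have "0 \<in> ?X" "0 \<in> ?Y" unfolding Dhol_def by (rule cfun.span_zero)+
  moreover have "0 +o ?Y \<in> quotient_cosets ?X ?Y"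
    unfolding quotient_cosets_def using \<open>0 \<in> ?X\<close> by blast
  ultimately have "?L +o ?Y = 0 +o ?Y"
    using inj unfolding kappa_injective_def by (blast dest: inj_onD)
  then have L: "?L \<in> ?Y"
    using \<open>0 \<in> ?Y\<close> by (metis add.right_neutral set_zero_plus set_plus_intro2)
  \<comment> \<open>A functional of order below \<open>n\<close> would give 0 on both powers, while
    one of the two components has nonzero derivative.\<close>
  have "?L (\<lambda>w. (w $ 1 - ?p $ 1) ^ n) = fact n * deriv f1 z ^ n"
    "?L (\<lambda>w. (w $ 2 - ?p $ 2) ^ n) = fact n * deriv f2 z ^ n"
    by (simp_all add: curve_functional_def coordinate_power_in_hol2 higher_deriv_power_diff[OF f(1) r] higher_deriv_power_diff[OF f(2) r])
  then show False
    using Dhol_coordinate_power[OF L, of 1] Dhol_coordinate_power[OF L, of 2] nz by auto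
qed

section \<open>Iteration of polynomials with quadratic escape\<close>

text \<open>The Moebius map \<open>1 / (1 - w)\<close> sends the unit circle, apart from 1, to the
  line of real part 1/2 and the disc to the right of it.\<close>

lemma Re_inverse_one_minus_ge:
  assumes "cmod w \<le> 1" "w \<noteq> 1"
  shows "Re (1 / (1 - w)) \<ge> 1 / 2"
proof -
  have pos: "(cmod (1 - w))\<^sup>2 > 0" using assms(2) by simp
  have "(cmod w)\<^sup>2 \<le> 1" using assms(1) by (simp add: power_le_one)
  then have "(cmod (1 - w))\<^sup>2 \<le> 2 * Re (1 - w)"
    unfolding cmod_power2 by (simp add: power2_eq_square algebra_simps)
  moreover have "Re (1 / (1 - w)) = Re (1 - w) / (cmod (1 - w))\<^sup>2"
    by (simp add: Re_divide cmod_power2)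
  moreover have "1 / 2 \<le> Re (1 - w) / (cmod (1 - w))\<^sup>2"
    if "(cmod (1 - w))\<^sup>2 \<le> 2 * Re (1 - w)"
    using that pos by (simp add: pos_le_divide_eq)
  ultimately show ?thesis by simp
qed

text \<open>The logarithmic derivative is a sum of terms \<open>1 / (t - \<tau>)\<close>, and
  \<open>Re (t / (t - \<tau>)) \<ge> 1/2\<close> as soon as \<open>\<bar>\<tau>\<bar> \<le> \<bar>t\<bar>\<close>.\<close>

lemma poly_log_deriv_ge:
  fixes p :: "complex poly"
  assumes "poly p t \<noteq> 0" "\<And>\<tau>. poly p \<tau> = 0 \<Longrightarrow> cmod \<tau> \<le> cmod t" "t \<noteq> 0"
  shows "Re (t * poly (pderiv p) t / poly p t) \<ge> real (degree p) / 2"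
  using assms(1,2)
proof (induction "degree p" arbitrary: p)
  case 0
  then show ?case by (auto elim: degree_eq_zeroE simp: pderiv_pCons)
next
  case (Suc n)
  then obtain \<tau> where \<tau>: "poly p \<tau> = 0"
    using alg_closed_imp_poly_has_root[of p] by auto
  then obtain q where q: "p = [:-\<tau>, 1:] * q"
    by (metis dvd_def poly_eq_0_iff_dvd)
  have p0: "p \<noteq> 0" using Suc.prems(1) by auto
  then have "q \<noteq> 0" using q by auto
  then have dq: "degree p = Suc (degree q)"
    unfolding q by (subst degree_mult_eq) auto
  have nz: "poly q t \<noteq> 0" "t \<noteq> \<tau>" using Suc.prems(1) q by auto
  have IH: "Re (t * poly (pderiv q) t / poly q t) \<ge> real (degree q) / 2"
    using Suc.hyps(2) dq Suc.prems(2) q nz by (intro Suc.hyps(1)) auto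
  have "poly (pderiv p) t = poly q t + (t - \<tau>) * poly (pderiv q) t"
    unfolding q pderiv_mult by (simp add: pderiv_pCons algebra_simps)
  moreover have pp: "poly p t = (t - \<tau>) * poly q t" unfolding q by (simp add: algebra_simps)
  ultimately have "t * poly (pderiv p) t / poly p t = t / (t - \<tau>) + t * poly (pderiv q) t / poly q t"
    using nz by (simp only: pp) (simp add: field_simps)
  also have "t / (t - \<tau>) = 1 / (1 - \<tau> / t)"
    using \<open>t \<noteq> 0\<close> nz by (simp add: field_simps)
  finally have "Re (t * poly (pderiv p) t / poly p t) =
      Re (1 / (1 - \<tau> / t)) + Re (t * poly (pderiv q) t / poly q t)" by simp
  moreover have "Re (1 / (1 - \<tau> / t)) \<ge> 1 / 2"
    using Suc.prems(2)[OF \<tau>] \<open>t \<noteq> 0\<close> nz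
    by (intro Re_inverse_one_minus_ge) (auto simp: norm_divide divide_simps)
  ultimately show ?case using IH dq by simp
qed

section \<open>Growth, degree and large derivatives of the iterates\<close>

lemma poly_norm_le:
  fixes p :: "complex poly"
  shows "\<exists>C\<ge>0. \<forall>t. 1 \<le> cmod t \<longrightarrow> cmod (poly p t) \<le> C * cmod t ^ degree p"
proof (intro exI conjI allI impI)
  show "(\<Sum>i\<le>degree p. cmod (coeff p i)) \<ge> 0" by (intro sum_nonneg) auto
  fix t :: complex assume "1 \<le> cmod t"
  have "cmod (poly p t) \<le> (\<Sum>i\<le>degree p. cmod (coeff p i * t ^ i))"
    unfolding poly_altdef by (rule norm_sum)
  also have "\<dots> \<le> (\<Sum>i\<le>degree p. cmod (coeff p i) * cmod t ^ degree p)"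
    unfolding norm_mult norm_power using \<open>1 \<le> cmod t\<close>
    by (intro sum_mono mult_left_mono power_increasing) auto
  finally show "cmod (poly p t) \<le> (\<Sum>i\<le>degree p. cmod (coeff p i)) * cmod t ^ degree p"
    by (simp add: sum_distrib_right)
qed

lemma degree_ge_of_growth:
  fixes p :: "complex poly"
  assumes "c > 0" and growth: "\<And>t. \<rho> \<le> cmod t \<Longrightarrow> c * cmod t ^ N \<le> cmod (poly p t)"
  shows "N \<le> degree p"
proof (rule ccontr)
  assume "\<not> N \<le> degree p"
  then have N: "degree p < N" by simp
  obtain C where C: "C \<ge> 0" "\<And>t. 1 \<le> cmod t \<Longrightarrow> cmod (poly p t) \<le> C * cmod t ^ degree p"
    using poly_norm_le[of p] by blast
  define x where "x = max (max 1 \<rho>) (C / c + 1)"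
  have x: "x \<ge> 1" "x \<ge> \<rho>" "x > C / c" unfolding x_def by auto
  have "c * x ^ N \<le> C * x ^ degree p"
    using growth[of "of_real x"] C(2)[of "of_real x"] x by (simp add: norm_power)
  moreover have "x ^ N = x ^ degree p * x ^ (N - degree p)"
    using N by (simp flip: power_add)
  moreover have "x ^ (N - degree p) \<ge> x ^ 1"
    using N x by (intro power_increasing) auto
  moreover have "x ^ degree p > 0" using x by simp
  ultimately have "c * x \<le> C"
    using \<open>c > 0\<close> by (smt (verit, best) mult.assoc mult.commute mult_le_cancel_left_pos power_one_right)
  then show False using x \<open>c > 0\<close> by (simp add: field_simps)
qed

text \<open>The point \<open>t\<close> is an outermost point of the sublevel set \<open>S\<close>.
  There \<open>P n\<close> has modulus exactly \<open>\<rho>\<close>, while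
  \<open>cmod t < \<rho>\<close>, so \<open>\<rho>\<close> cancels in the estimate of the
  logarithmic derivative.\<close>

lemma quadratic_iterates_large_deriv:
  fixes P :: "nat \<Rightarrow> complex poly"
  assumes P0: "P 0 = [:0, 1:]" and \<rho>: "\<rho> > 0" and \<kappa>: "\<kappa> > 0"
    and sq: "\<And>n t. \<rho> \<le> cmod (poly (P n) t) \<Longrightarrow> \<kappa> * (cmod (poly (P n) t))\<^sup>2 \<le> cmod (poly (P (Suc n)) t)"
    and dbl: "\<And>n t. \<rho> \<le> cmod (poly (P n) t) \<Longrightarrow> 2 * cmod (poly (P n) t) \<le> cmod (poly (P (Suc n)) t)"
    and n: "n \<ge> 1"
  obtains t where "cmod t < \<rho>" "\<And>j. j \<le> n \<Longrightarrow> cmod (poly (P j) t) \<le> \<rho>"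
    "2 ^ n / 2 \<le> cmod (poly (pderiv (P n)) t)"
proof -
  have grow: "2 ^ m * cmod t \<le> cmod (poly (P m) t) \<and> \<rho> \<le> cmod (poly (P m) t)" if "\<rho> \<le> cmod t" for m t
  proof (induction m)
    case (Suc m)
    then show ?case using dbl[of m t] \<rho> by auto
  qed (use P0 that in simp)
  \<comment> \<open>The quadratic lower bound doubles the exponent at every step, which forces the
    degree of \<open>P n\<close> to be at least \<open>2 ^ n\<close>.\<close>
  have "\<exists>c>0. \<forall>t. \<rho> \<le> cmod t \<longrightarrow> c * cmod t ^ (2 ^ m) \<le> cmod (poly (P m) t)" for m
  proof (induction m)
    case (Suc m)
    then obtain c where c: "c > 0" "\<And>t. \<rho> \<le> cmod t \<Longrightarrow> c * cmod t ^ (2 ^ m) \<le> cmod (poly (P m) t)" by blast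
    have "\<kappa> * c\<^sup>2 * cmod t ^ (2 ^ Suc m) \<le> cmod (poly (P (Suc m)) t)" if "\<rho> \<le> cmod t" for t
    proof -
      have "\<kappa> * c\<^sup>2 * cmod t ^ (2 ^ Suc m) = \<kappa> * (c * cmod t ^ (2 ^ m))\<^sup>2"
        by (simp add: power_mult_distrib power_mult[symmetric] mult.commute)
      also have "\<dots> \<le> \<kappa> * (cmod (poly (P m) t))\<^sup>2"
        using c that \<kappa> by (intro mult_left_mono power_mono) auto
      also have "\<dots> \<le> cmod (poly (P (Suc m)) t)" using sq grow[OF that] by blast
      finally show ?thesis .
    qed
    then show ?case using c(1) \<kappa> by (intro exI[of _ "\<kappa> * c\<^sup>2"]) auto
  qed (use P0 in \<open>auto intro!: exI[of _ 1]\<close>)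
  then have deg: "2 ^ n \<le> degree (P n)" using degree_ge_of_growth by metis
  then have "degree (P n) > 0" by (metis gr0I le_zero_eq power_not_zero zero_neq_numeral)
  then obtain \<tau> where \<tau>: "poly (P n) \<tau> = 0" using alg_closed_imp_poly_has_root by blast
  define S where "S = {t. cmod (poly (P n) t) \<le> \<rho>}"
  have small: "cmod t < \<rho>" if "t \<in> S" for t
  proof (rule ccontr)
    assume "\<not> cmod t < \<rho>"
    then have "2 ^ n * cmod t \<le> \<rho>" "cmod t \<ge> \<rho>" using grow[of t n] that unfolding S_def by auto
    moreover have "(2::real) ^ n \<ge> 2 ^ 1" using n by (intro power_increasing) auto
    then have "2 ^ n * cmod t \<ge> 2 * cmod t" by (intro mult_right_mono) auto
    ultimately show False using \<rho> by linarith
  qed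
  have "closed S" unfolding S_def by (intro closed_Collect_le continuous_intros)
  moreover have "S \<subseteq> ball 0 \<rho>" using small by auto
  ultimately have "compact S" using bounded_subset[OF bounded_ball] compact_eq_bounded_closed by blast
  moreover have "\<tau> \<in> S" using \<tau> \<rho> unfolding S_def by simp
  moreover have "continuous_on S cmod" by (intro continuous_intros)
  ultimately obtain t where t: "t \<in> S" "\<And>s. s \<in> S \<Longrightarrow> cmod s \<le> cmod t"
    using continuous_attains_sup[of S cmod] by blast
  have Pt: "cmod (poly (P n) t) = \<rho>"
  proof (rule ccontr)
    assume "cmod (poly (P n) t) \<noteq> \<rho>"
    then have "cmod (poly (P n) t) < \<rho>" using t(1) unfolding S_def by simp
    moreover have "open {t. cmod (poly (P n) t) < \<rho>}" by (intro open_Collect_less continuous_intros)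
    ultimately obtain e where e: "e > 0" "ball t e \<subseteq> {t. cmod (poly (P n) t) < \<rho>}"
      using open_contains_ball by blast
    \<comment> \<open>The outward radial unit vector; at the origin every direction leads outward
      and 1 is taken. A small move along it would stay in \<open>S\<close> and contradict
      maximality.\<close>
    define u where "u = (if t = 0 then 1 else sgn t)"
    have u: "cmod u = 1" "t = of_real (cmod t) * u"
      unfolding u_def by (simp add: norm_sgn) (simp add: sgn_eq)
    have "t + of_real (e / 2) * u \<in> S"
      using e u unfolding S_def by (auto simp: subset_iff dist_norm norm_mult intro!: less_imp_le)
    moreover have "t + of_real (e / 2) * u = of_real (cmod t + e / 2) * u"
      using u(2) by (simp add: algebra_simps)
    then have "cmod (t + of_real (e / 2) * u) = cmod t + e / 2"
      using e(1) u(1) by (simp only: norm_mult norm_of_real) simp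
    ultimately show False using t(2) e(1) by fastforce
  qed
  \<comment> \<open>Zeros of \<open>P n\<close> belong to \<open>S\<close>, so none lies farther out
    than \<open>t\<close>.\<close>
  have roots: "cmod \<sigma> \<le> cmod t" if "poly (P n) \<sigma> = 0" for \<sigma>
    using t(2)[of \<sigma>] that \<rho> unfolding S_def by simp
  have nz: "poly (P n) t \<noteq> 0" using Pt \<rho> by auto
  have "t \<noteq> 0" using roots[OF \<tau>] \<tau> nz by auto
  have "real (2 ^ n) / 2 \<le> real (degree (P n)) / 2" using deg by (simp only: of_nat_le_iff divide_right_mono zero_le_numeral)
  also have "\<dots> \<le> Re (t * poly (pderiv (P n)) t / poly (P n) t)"
    using poly_log_deriv_ge[OF nz roots \<open>t \<noteq> 0\<close>] .
  also have "\<dots> \<le> cmod t * cmod (poly (pderiv (P n)) t) / \<rho>"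
    using complex_Re_le_cmod[of "t * poly (pderiv (P n)) t / poly (P n) t"] by (simp add: norm_mult norm_divide Pt)
  also have "\<dots> \<le> \<rho> * cmod (poly (pderiv (P n)) t) / \<rho>"
    using small[OF t(1)] \<rho> by (intro divide_right_mono mult_right_mono) auto
  finally have large: "2 ^ n / 2 \<le> cmod (poly (pderiv (P n)) t)" using \<rho> by simp
  \<comment> \<open>An orbit that has left the disc of radius \<open>\<rho>\<close> never returns,
    so smallness at time \<open>n\<close> implies smallness at all earlier times.\<close>
  have esc: "\<rho> < cmod (poly (P (j + m)) t)" if "\<rho> < cmod (poly (P j) t)" for j m
  proof (induction m)
    case (Suc m)
    then show ?case using dbl[of "j + m" t] \<rho> by simp
  qed (use that in simp)
  have "cmod (poly (P j) t) \<le> \<rho>" if "j \<le> n" for j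
    using esc[of j "n - j"] Pt that by fastforce
  with small[OF t(1)] show thesis using large by (rule that)
qed

text \<open>The total decrease is faster than \<open>n\<close> steps of ratio 2/3 allow, so some
  step has a smaller ratio. After the last such step \<open>j\<close> the decay is slow, so
  \<open>a j\<close> exceeds \<open>a n\<close> by at most the factor
  \<open>(3 / 2) ^ (n - j)\<close>, and 3/2 times 1/2 gives the rate 3/4.\<close>

lemma geometric_drop:
  fixes a :: "nat \<Rightarrow> real"
  assumes \<rho>: "\<rho> > 0" and a0: "\<rho> \<le> a 0" and an: "a n \<le> 4 * \<rho> / 2 ^ n" and n: "n \<ge> 5"
  obtains j where "j \<le> n" "j \<ge> 1" "a j \<le> 2 / 3 * a (j - 1)" "a j \<le> 4 * \<rho> * (3 / 4) ^ n"
proof -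
  define J where "J = {j. 1 \<le> j \<and> j \<le> n \<and> a j \<le> 2 / 3 * a (j - 1)}"
  have chain: "(2 / 3) ^ m * a i \<le> a (i + m)" if "i + m \<le> n" "\<And>k. i < k \<Longrightarrow> k \<le> n \<Longrightarrow> k \<notin> J" for i m
    using that(1)
  proof (induction m)
    case (Suc m)
    have "2 / 3 * a (i + m) < a (i + Suc m)"
      using that(2)[of "i + Suc m"] Suc.prems unfolding J_def by auto
    then show ?case using Suc by simp
  qed simp
  have "finite J" unfolding J_def by auto
  have "J \<noteq> {}"
  proof
    assume "J = {}"
    then have "(2 / 3) ^ n * a 0 \<le> a n" using chain[of 0 n] by simp
    moreover have "(2 / 3) ^ n * \<rho> \<le> (2 / 3) ^ n * a 0" using a0 by (intro mult_left_mono) auto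
    ultimately have "(2 / 3) ^ n * \<rho> \<le> 4 * \<rho> / 2 ^ n" using an by linarith
    then have "(4 / 3 :: real) ^ n \<le> 4"
      using \<rho> by (simp add: field_simps flip: power_mult_distrib)
    \<comment> \<open>Five is the least exponent for which this power exceeds 4.\<close>
    moreover have "(4 / 3 :: real) ^ 5 \<le> (4 / 3) ^ n" using n by (intro power_increasing) auto
    ultimately show False by (simp add: eval_nat_numeral)
  qed
  define j where "j = Max J"
  have j: "j \<in> J" unfolding j_def using \<open>finite J\<close> \<open>J \<noteq> {}\<close> by (rule Max_in)
  have jn: "j \<le> n" using j unfolding J_def by simp
  have "k \<notin> J" if "j < k" for k
    using Max_ge[OF \<open>finite J\<close>, of k] that unfolding j_def by auto
  then have "(2 / 3) ^ (n - j) * a j \<le> a n" using chain[of j "n - j"] jn by simp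
  then have 1: "(2 / 3) ^ (n - j) * a j \<le> 4 * \<rho> / 2 ^ n" using an by linarith
  have "a j = (3 / 2) ^ (n - j) * ((2 / 3) ^ (n - j) * a j)"
    by (simp flip: mult.assoc power_mult_distrib)
  also have "\<dots> \<le> (3 / 2) ^ (n - j) * (4 * \<rho> / 2 ^ n)" by (intro mult_left_mono 1) auto
  also have "\<dots> \<le> (3 / 2) ^ n * (4 * \<rho> / 2 ^ n)"
    using \<rho> by (intro mult_right_mono power_increasing) auto
  also have "\<dots> = 4 * \<rho> * (3 / 4) ^ n" by (simp add: power_divide field_simps flip: power_mult_distrib)
  finally show thesis using that jn j unfolding J_def by blast
qed

text \<open>Apply \<open>geometric_drop\<close> to the distances \<open>a j\<close> from
  \<open>t\<close> to the sets where \<open>P j\<close> has modulus at least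
  \<open>2 * \<rho>\<close>. At a large drop, the earlier iterate is still bounded on a disc that is
  larger by the factor 3/2 than the one on which \<open>P j\<close> first reaches this
  modulus.\<close>

lemma quadratic_iterates_small_discs:
  fixes P :: "nat \<Rightarrow> complex poly"
  assumes P0: "P 0 = [:0, 1:]" and \<rho>: "\<rho> > 0" and \<kappa>: "\<kappa> > 0"
    and sq: "\<And>n t. \<rho> \<le> cmod (poly (P n) t) \<Longrightarrow> \<kappa> * (cmod (poly (P n) t))\<^sup>2 \<le> cmod (poly (P (Suc n)) t)"
    and dbl: "\<And>n t. \<rho> \<le> cmod (poly (P n) t) \<Longrightarrow> 2 * cmod (poly (P n) t) \<le> cmod (poly (P (Suc n)) t)"
    and n: "n \<ge> 5"
  obtains t a j where "cmod t < \<rho>" "0 < a" "a \<le> 4 * \<rho> * (3 / 4) ^ n" "1 \<le> j" "j \<le> n"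
    "cmod (poly (P j) t) \<le> \<rho>"
    "\<And>w. w \<in> ball t (3 / 2 * a) \<Longrightarrow> cmod (poly (P (j - 1)) w) < 2 * \<rho>"
    "\<exists>w. dist t w = a \<and> 2 * \<rho> \<le> cmod (poly (P j) w)"
proof -
  obtain t where t: "cmod t < \<rho>" "\<And>j. j \<le> n \<Longrightarrow> cmod (poly (P j) t) \<le> \<rho>"
      "2 ^ n / 2 \<le> cmod (poly (pderiv (P n)) t)"
    using quadratic_iterates_large_deriv[of P \<rho> \<kappa> n] assms by auto
  define S where "S j = {w. 2 * \<rho> \<le> cmod (poly (P j) w)}" for j
  define a where "a j = infdist t (S j)" for j
  have S_Suc: "S j \<subseteq> S (Suc j)" for j
  proof
    fix w assume "w \<in> S j"
    then show "w \<in> S (Suc j)" using dbl[of j w] \<rho> unfolding S_def by simp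
  qed
  have clS: "closed (S j)" for j
    unfolding S_def by (intro closed_Collect_le continuous_intros)
  have "of_real (2 * \<rho>) \<in> S 0" using \<rho> unfolding S_def P0 by simp
  then have neS: "S j \<noteq> {}" for j
    using lift_Suc_mono_le[of S, OF S_Suc, of 0 j] by auto
  have att: "\<exists>w\<in>S j. dist t w = a j" for j
    using infdist_attains_inf[OF clS neS, of j t] unfolding a_def by metis
  have notS: "w \<notin> S j" if "w \<in> ball t (a j)" for w j
    using infdist_le[of w "S j" t] that unfolding a_def by auto
  have pos: "a j > 0" if "j \<le> n" for j
  proof -
    have "t \<notin> S j" using t(2)[OF that] \<rho> unfolding S_def by auto
    then show ?thesis
      unfolding a_def using infdist_pos_not_in_closed[OF clS neS] by blast
  qed
  have a0: "\<rho> \<le> a 0"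
  proof -
    obtain w where w: "w \<in> S 0" "dist t w = a 0" using att by blast
    have "2 * \<rho> \<le> cmod w" using w(1) unfolding S_def P0 by simp
    then show ?thesis using w(2) t(1) norm_triangle_sub[of w t] by (simp add: dist_norm norm_minus_commute)
  qed
  \<comment> \<open>On the disc of radius \<open>a n\<close> the polynomial is bounded by
    \<open>2 * \<rho>\<close>; Cauchy's estimate against the large derivative at \<open>t\<close>
    makes this radius small.\<close>
  have an: "a n \<le> 4 * \<rho> / 2 ^ n"
  proof -
    have "cmod ((deriv ^^ 1) (poly (P n)) t) \<le> fact 1 * (2 * \<rho>) / a n ^ 1"
    proof (rule Cauchy_higher_deriv_bound[where y = 0])
      show "poly (P n) w \<in> ball 0 (2 * \<rho>)" if "w \<in> ball t (a n)" for w
        using notS[OF that] unfolding S_def by simp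
    qed (use pos[of n] in \<open>auto intro!: holomorphic_intros continuous_intros\<close>)
    moreover have "deriv (poly (P n)) t = poly (pderiv (P n)) t"
      by (rule DERIV_imp_deriv poly_DERIV)+
    ultimately have "2 ^ n / 2 \<le> 2 * \<rho> / a n" using t(3) by simp
    then show ?thesis using pos[of n] by (simp add: field_simps)
  qed
  obtain j where j: "j \<le> n" "j \<ge> 1" "a j \<le> 2 / 3 * a (j - 1)" "a j \<le> 4 * \<rho> * (3 / 4) ^ n"
    using geometric_drop[OF \<rho> a0 an n] by blast
  show thesis
  proof (rule that[OF t(1) pos[OF j(1)] j(4,2,1) t(2)[OF j(1)]])
    show "cmod (poly (P (j - 1)) w) < 2 * \<rho>" if "w \<in> ball t (3 / 2 * a j)" for w
      using notS[of w "j - 1"] that j(3) unfolding S_def by auto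
    show "\<exists>w. dist t w = a j \<and> 2 * \<rho> \<le> cmod (poly (P j) w)"
      using att[of j] unfolding S_def by blast
  qed
qed

section \<open>Normal limits of rescaled discs\<close>

lemma uniform_limit_subseq:
  fixes s :: "nat \<Rightarrow> nat"
  assumes "uniform_limit K f g sequentially" "strict_mono s"
  shows "uniform_limit K (\<lambda>k. f (s k)) g sequentially"
  using filterlim_compose[OF assms(1) filterlim_subseq[OF assms(2)]] .

text \<open>The oscillation takes place on the closed unit disc, which is compact in the ball of
  radius 3/2, so it survives in the limit. A derivative of order \<open>M\<close> carries the factor
  \<open>a k ^ M\<close> of the rescaling, and for large \<open>M\<close> this beats the exponential
  growth of \<open>h\<close> along the iterates.\<close>

lemma limit_curve:
  fixes F :: "complex^2 \<Rightarrow> complex^2" and Q1 Q2 :: "nat \<Rightarrow> complex poly"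
    and \<xi> :: "complex^2 \<Rightarrow> complex"
  assumes \<xi>_eq: "\<And>z. \<xi> z = \<alpha> * z $ 1 + \<beta> * z $ 2"
    and contF: "continuous_on UNIV F"
    and Q: "\<And>n t. (F ^^ n) (t *s v) = vector [poly (Q1 n) t, poly (Q2 n) t]"
    and \<xi>v: "\<xi> v = 1"
    and G: "\<And>t. t *s v \<in> G" "\<And>z. z \<in> G \<Longrightarrow> F z \<in> G"
    and \<rho>: "\<rho> > 0" and \<kappa>: "\<kappa> > 0"
    and sq: "\<And>z. z \<in> G \<Longrightarrow> \<rho> \<le> cmod (\<xi> z) \<Longrightarrow> \<kappa> * (cmod (\<xi> z))\<^sup>2 \<le> cmod (\<xi> (F z))"
    and dbl: "\<And>z. z \<in> G \<Longrightarrow> \<rho> \<le> cmod (\<xi> z) \<Longrightarrow> 2 * cmod (\<xi> z) \<le> cmod (\<xi> (F z))"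
    and bnd: "\<And>z. z \<in> G \<Longrightarrow> cmod (\<xi> z) < 2 * \<rho> \<Longrightarrow> norm z \<le> B"
  obtains f1 f2 where "f1 holomorphic_on ball 0 (3/2)" "f2 holomorphic_on ball 0 (3/2)"
    "\<not> (f1 constant_on ball 0 (3/2) \<and> f2 constant_on ball 0 (3/2))"
    "\<And>r. r > 0 \<Longrightarrow> \<exists>M0. \<forall>M\<ge>M0. \<forall>h\<in>hol2.
       (\<exists>c\<ge>0. \<forall>n. \<forall>z\<in>(\<lambda>t. t *s v) ` cball 0 (2 * \<rho>). cmod (h ((F ^^ n) z)) \<le> c * r ^ n) \<longrightarrow>
       (\<forall>w\<in>ball 0 (3/2). (deriv ^^ M) (\<lambda>w. h (vector [f1 w, f2 w])) w = 0)"
proof -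
  define P where "P n = smult \<alpha> (Q1 n) + smult \<beta> (Q2 n)" for n
  have P: "poly (P n) t = \<xi> ((F ^^ n) (t *s v))" for n t
    unfolding P_def \<xi>_eq Q by simp
  have P0: "P 0 = [:0, 1:]"
  proof -
    have "poly (P 0) t = poly [:0, 1:] t" for t
    proof -
      have "poly (P 0) t = t * \<xi> v" unfolding P \<xi>_eq by (simp add: algebra_simps)
      then show ?thesis by (simp add: \<xi>v)
    qed
    then show ?thesis by (simp add: poly_eq_poly_eq_iff[symmetric] fun_eq_iff)
  qed
  have orb: "(F ^^ n) (t *s v) \<in> G" for n t
    by (induction n) (use G in auto)
  have "\<exists>t a j. cmod t < \<rho> \<and> 0 < a \<and> a \<le> 4 * \<rho> * (3 / 4) ^ (k + 5) \<and> 1 \<le> j \<and> j \<le> k + 5 \<and>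
    cmod (poly (P j) t) \<le> \<rho> \<and> (\<forall>w\<in>ball t (3 / 2 * a). cmod (poly (P (j - 1)) w) < 2 * \<rho>) \<and>
    (\<exists>w. dist t w = a \<and> 2 * \<rho> \<le> cmod (poly (P j) w))" for k
  proof (rule quadratic_iterates_small_discs[where P = P and \<rho> = \<rho> and \<kappa> = \<kappa> and n = "k + 5"])
    show "\<kappa> * (cmod (poly (P n) t))\<^sup>2 \<le> cmod (poly (P (Suc n)) t)" if "\<rho> \<le> cmod (poly (P n) t)" for n t
      using sq[OF orb, of n t] that unfolding P by simp
    show "2 * cmod (poly (P n) t) \<le> cmod (poly (P (Suc n)) t)" if "\<rho> \<le> cmod (poly (P n) t)" for n t
      using dbl[OF orb, of n t] that unfolding P by simp
  qed (use P0 \<rho> \<kappa> in \<open>simp; fail | blast\<close>)+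
  then obtain t a j where taj: "\<And>k. cmod (t k) < \<rho>" "\<And>k. 0 < a k" "\<And>k. a k \<le> 4 * \<rho> * (3 / 4) ^ (k + 5)"
    "\<And>k. 1 \<le> j k" "\<And>k. j k \<le> k + 5" "\<And>k. cmod (poly (P (j k)) (t k)) \<le> \<rho>"
    "\<And>k w. w \<in> ball (t k) (3 / 2 * a k) \<Longrightarrow> cmod (poly (P (j k - 1)) w) < 2 * \<rho>"
    "\<And>k. \<exists>w. dist (t k) w = a k \<and> 2 * \<rho> \<le> cmod (poly (P (j k)) w)"
    by metis
  \<comment> \<open>The rescaling maps the ball of radius 3/2 onto the disc on which the iterate
    before the \<open>j k\<close>-th is controlled.\<close>
  define p1 where "p1 k w = poly (Q1 (j k)) (of_real (a k) * w + t k)" for k w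
  define p2 where "p2 k w = poly (Q2 (j k)) (of_real (a k) * w + t k)" for k w
  have p: "vector [p1 k w, p2 k w] = (F ^^ j k) ((of_real (a k) * w + t k) *s v)" for k w
    unfolding p1_def p2_def Q ..
  have \<xi>p: "\<xi> (vector [p1 k w, p2 k w]) = poly (P (j k)) (of_real (a k) * w + t k)" for k w
    unfolding p P ..
  have "compact (F ` cball 0 B)"
    by (intro compact_continuous_image continuous_on_subset[OF contF]) auto
  then obtain B' where "\<forall>x\<in>F ` cball 0 B. norm x \<le> B'"
    using compact_imp_bounded bounded_iff by blast
  then have B': "norm (F z) \<le> B'" if "norm z \<le> B" for z using that by auto
  \<comment> \<open>The iterate of index \<open>j k - 1\<close> stays in the ball of radius
    \<open>B\<close>, so one further application of \<open>F\<close> lands in a fixed compact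
    set.\<close>
  have bound: "norm (vector [p1 k w, p2 k w] :: complex^2) \<le> B'" if "w \<in> ball 0 (3/2)" for k w
  proof -
    let ?u = "of_real (a k) * w + t k"
    have "?u \<in> ball (t k) (3 / 2 * a k)"
      using that taj(2)[of k] by (simp add: dist_norm norm_mult)
    then have "norm ((F ^^ (j k - 1)) (?u *s v)) \<le> B"
      using taj(7) bnd orb unfolding P by blast
    then have "norm (F ((F ^^ (j k - 1)) (?u *s v))) \<le> B'" by (rule B')
    moreover have "F ((F ^^ (j k - 1)) (?u *s v)) = (F ^^ j k) (?u *s v)"
      using taj(4)[of k] by (metis Suc_diff_1 comp_apply funpow.simps(2) less_le_trans zero_less_one)
    ultimately show ?thesis unfolding p by simp
  qed
  have bound12: "cmod (p1 k w) \<le> B'" "cmod (p2 k w) \<le> B'" if "w \<in> ball 0 (3/2)" for k w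
    using bound[OF that, of k] Finite_Cartesian_Product.norm_nth_le[of "vector [p1 k w, p2 k w] :: complex^2" 1]
      Finite_Cartesian_Product.norm_nth_le[of "vector [p1 k w, p2 k w] :: complex^2" 2] by auto
  have hol: "p1 k holomorphic_on A" "p2 k holomorphic_on A" for k A
    unfolding p1_def p2_def by (intro holomorphic_intros)+
  have bd: "\<exists>B. \<forall>h\<in>range p1. \<forall>z\<in>K. cmod (h z) \<le> B" "\<exists>B. \<forall>h\<in>range p2. \<forall>z\<in>K. cmod (h z) \<le> B"
    if "K \<subseteq> ball 0 (3/2)" for K
    using bound12 that by blast+
  have rng: "range (p2 \<circ> r) \<subseteq> range p2" for r :: "nat \<Rightarrow> nat" by auto
  obtain f1 r1 where f1: "f1 holomorphic_on ball 0 (3/2)" and r1: "strict_mono (r1 :: nat \<Rightarrow> nat)"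
    and ul1: "\<And>K. compact K \<Longrightarrow> K \<subseteq> ball 0 (3/2) \<Longrightarrow> uniform_limit K (p1 \<circ> r1) f1 sequentially"
    by (rule Montel[of "ball 0 (3/2)" "range p1" p1]) (use hol bd(1) in blast)+
  \<comment> \<open>The second extraction is made along the first subsequence, so that both
    components converge along \<open>s\<close>.\<close>
  obtain f2 r2 where f2: "f2 holomorphic_on ball 0 (3/2)" and r2: "strict_mono (r2 :: nat \<Rightarrow> nat)"
    and ul2: "\<And>K. compact K \<Longrightarrow> K \<subseteq> ball 0 (3/2) \<Longrightarrow> uniform_limit K ((p2 \<circ> r1) \<circ> r2) f2 sequentially"
    by (rule Montel[of "ball 0 (3/2)" "range p2" "p2 \<circ> r1"]) (use hol bd(2) rng in blast)+
  define s where "s = r1 \<circ> r2"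
  have s: "strict_mono s" unfolding s_def using r1 r2 by (rule strict_mono_o)
  have u1: "uniform_limit K (\<lambda>k. p1 (s k)) f1 sequentially" if "compact K" "K \<subseteq> ball 0 (3/2)" for K
    using uniform_limit_subseq[OF ul1[OF that] r2] unfolding s_def by (simp add: comp_def)
  have u2: "uniform_limit K (\<lambda>k. p2 (s k)) f2 sequentially" if "compact K" "K \<subseteq> ball 0 (3/2)" for K
    using ul2[OF that] unfolding s_def by (simp add: comp_def)
  have nonconst: "\<not> (f1 constant_on ball 0 (3/2) \<and> f2 constant_on ball 0 (3/2))"
  proof
    assume "f1 constant_on ball 0 (3/2) \<and> f2 constant_on ball 0 (3/2)"
    then obtain c1 c2 where c: "\<And>w. w \<in> ball 0 (3/2) \<Longrightarrow> f1 w = c1" "\<And>w. w \<in> ball 0 (3/2) \<Longrightarrow> f2 w = c2"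
      unfolding constant_on_def by blast
    define L where "L = cmod \<alpha> + cmod \<beta> + 1"
    have L: "L > 0" "cmod \<alpha> + cmod \<beta> \<le> L" unfolding L_def by (simp_all add: add_nonneg_pos)
    \<comment> \<open>Errors of this size in both components change \<open>\<xi>\<close> by at most
      \<open>\<rho> / 4\<close>, whereas \<open>\<xi>\<close> varies by at least
      \<open>\<rho>\<close> between 0 and the point \<open>y\<close> below.\<close>
    define e where "e = \<rho> / (4 * L)"
    have e: "e > 0" unfolding e_def using \<rho> L by simp
    have K: "compact (cball 0 1 :: complex set)" "cball 0 1 \<subseteq> ball 0 (3/2 :: real)"
      by auto
    have "\<forall>\<^sub>F k in sequentially. \<forall>w\<in>cball 0 1. dist (p1 (s k) w) (f1 w) < e"
      "\<forall>\<^sub>F k in sequentially. \<forall>w\<in>cball 0 1. dist (p2 (s k) w) (f2 w) < e"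
      using u1[OF K] u2[OF K] e by (auto simp: uniform_limit_iff)
    then have "\<forall>\<^sub>F k in sequentially. \<forall>w\<in>cball 0 1. dist (p1 (s k) w) (f1 w) < e \<and> dist (p2 (s k) w) (f2 w) < e"
      by eventually_elim auto
    then obtain k where k: "\<forall>w\<in>cball 0 1. dist (p1 (s k) w) (f1 w) < e \<and> dist (p2 (s k) w) (f2 w) < e"
      by (auto simp: eventually_sequentially)
    have close: "cmod (\<xi> (vector [p1 (s k) w, p2 (s k) w]) - (\<alpha> * c1 + \<beta> * c2)) \<le> \<rho> / 4" if "w \<in> cball 0 1" for w
    proof -
      have w: "cmod (p1 (s k) w - c1) \<le> e" "cmod (p2 (s k) w - c2) \<le> e"
        using k that c(1)[of w] c(2)[of w] K(2) by (auto simp: dist_norm intro: less_imp_le)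
      have "\<xi> (vector [p1 (s k) w, p2 (s k) w]) - (\<alpha> * c1 + \<beta> * c2) = \<alpha> * (p1 (s k) w - c1) + \<beta> * (p2 (s k) w - c2)"
        unfolding \<xi>_eq by (simp add: algebra_simps)
      also have "cmod \<dots> \<le> cmod \<alpha> * e + cmod \<beta> * e"
        unfolding norm_mult[symmetric] by (intro norm_triangle_mono) (auto simp: norm_mult intro!: mult_left_mono w)
      also have "\<dots> \<le> L * e" using L e by (simp flip: distrib_right)
      also have "\<dots> = \<rho> / 4" unfolding e_def using L by simp
      finally show ?thesis .
    qed
    obtain w where w: "dist (t (s k)) w = a (s k)" "2 * \<rho> \<le> cmod (poly (P (j (s k))) w)"
      using taj(8) by blast
    define y where "y = (w - t (s k)) / of_real (a (s k))"
    have y: "y \<in> cball 0 1" "of_real (a (s k)) * y + t (s k) = w"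
      using w(1) taj(2)[of "s k"] unfolding y_def by (auto simp: norm_divide dist_norm norm_minus_commute)
    have "cmod (\<xi> (vector [p1 (s k) y, p2 (s k) y])) \<ge> 2 * \<rho>"
      unfolding \<xi>p y(2) by (rule w(2))
    moreover have "cmod (\<xi> (vector [p1 (s k) 0, p2 (s k) 0])) \<le> \<rho>"
      unfolding \<xi>p using taj(6) by simp
    ultimately have "\<rho> \<le> cmod (\<xi> (vector [p1 (s k) y, p2 (s k) y]) - \<xi> (vector [p1 (s k) 0, p2 (s k) 0]))"
      using norm_triangle_ineq2[of "\<xi> (vector [p1 (s k) y, p2 (s k) y])" "\<xi> (vector [p1 (s k) 0, p2 (s k) 0])"]
      by linarith
    also have "\<dots> \<le> \<rho> / 4 + \<rho> / 4"
      using norm_triangle_ineq4[of "\<xi> (vector [p1 (s k) y, p2 (s k) y]) - (\<alpha> * c1 + \<beta> * c2)"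
          "\<xi> (vector [p1 (s k) 0, p2 (s k) 0]) - (\<alpha> * c1 + \<beta> * c2)"] close[OF y(1)] close[of 0]
      by simp
    finally show False using \<rho> by simp
  qed
  have vanish: "\<exists>M0. \<forall>M\<ge>M0. \<forall>h\<in>hol2.
       (\<exists>c\<ge>0. \<forall>n. \<forall>z\<in>(\<lambda>t. t *s v) ` cball 0 (2 * \<rho>). cmod (h ((F ^^ n) z)) \<le> c * r ^ n) \<longrightarrow>
       (\<forall>w\<in>ball 0 (3/2). (deriv ^^ M) (\<lambda>w. h (vector [f1 w, f2 w])) w = 0)" if "r > 0" for r
  proof -
    \<comment> \<open>A base of at least 1 allows the exponent \<open>j k\<close> to be replaced by
      its bound \<open>k + 5\<close>.\<close>
    define r' where "r' = max r 1"
    have r': "r' \<ge> 1" "r \<le> r'" unfolding r'_def by auto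
    obtain M0 where M0: "(3 / 4 :: real) ^ M0 < 1 / r'"
      using real_arch_pow_inv[of "1 / r'" "3 / 4"] r' by auto
    have "(deriv ^^ M) (\<lambda>w. h (vector [f1 w, f2 w])) w = 0"
      if M: "M \<ge> M0" and h: "h \<in> hol2" and c: "c \<ge> 0"
        "\<forall>n. \<forall>z\<in>(\<lambda>t. t *s v) ` cball 0 (2 * \<rho>). cmod (h ((F ^^ n) z)) \<le> c * r ^ n"
        and w: "w \<in> ball 0 (3/2)" for M h c w
    proof -
      define H where "H k = (\<lambda>w. h (vector [p1 k w, p2 k w]))" for k
      \<comment> \<open>The rescaling contributes \<open>(3 / 4) ^ ((k + 5) * M)\<close> and the
        growth of the iterates at most \<open>r' ^ (k + 5)\<close>; the product is
        \<open>q ^ (k + 5)\<close>, and \<open>M0\<close> is chosen to make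
        \<open>q < 1\<close>.\<close>
      define q where "q = r' * (3 / 4) ^ M"
      have q: "0 \<le> q" "q < 1"
      proof -
        show "0 \<le> q" unfolding q_def using r' by simp
        have "(3 / 4 :: real) ^ M \<le> (3 / 4) ^ M0" using M by (intro power_decreasing) auto
        then have "(3 / 4 :: real) ^ M < 1 / r'" using M0 by (rule le_less_trans)
        then show "q < 1" unfolding q_def using r' by (simp add: field_simps)
      qed
      define C where "C = (4 * \<rho>) ^ M * (fact M * c / (\<rho> / 2) ^ M)"
      \<comment> \<open>For such \<open>k\<close> the disc of radius \<open>\<rho> / 2\<close> about
        each rescaled point stays within radius \<open>2 * \<rho>\<close> of the origin, where the
        growth bound is available for Cauchy's estimate.\<close>
      have small: "\<forall>\<^sub>F k in sequentially. a k * (3 / 2) < \<rho> / 2"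
      proof -
        have "(\<lambda>k. 4 * \<rho> * ((3 / 4) ^ 5 * (3 / 4) ^ k) * (3 / 2)) \<longlonglongrightarrow> 4 * \<rho> * ((3 / 4) ^ 5 * 0) * (3 / 2)"
          by (intro tendsto_intros) auto
        moreover have "4 * \<rho> * ((3 / 4) ^ 5 * 0) * (3 / 2) < \<rho> / 2" using \<rho> by simp
        ultimately have "\<forall>\<^sub>F k in sequentially. 4 * \<rho> * ((3 / 4) ^ 5 * (3 / 4) ^ k) * (3 / 2) < \<rho> / 2"
          by (rule order_tendstoD(2))
        then show ?thesis
        proof eventually_elim
          case (elim k)
          have "a k * (3 / 2) \<le> 4 * \<rho> * ((3 / 4) ^ 5 * (3 / 4) ^ k) * (3 / 2)"
            using taj(3)[of k] by (intro mult_right_mono) (simp_all add: power_add mult.commute)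
          then show ?case using elim by simp
        qed
      qed
      have ev: "\<forall>\<^sub>F k in sequentially. cmod ((deriv ^^ M) (H k) w) \<le> C * q ^ (k + 5)"
        using small
      proof eventually_elim
        case (elim k)
        define X where "X = (\<lambda>u. h (vector [poly (Q1 (j k)) u, poly (Q2 (j k)) u]))"
        have X: "X holomorphic_on UNIV"
          unfolding X_def by (intro hol2_holomorphic_on h holomorphic_intros) auto
        have HX: "H k = (\<lambda>w. X (of_real (a k) * w + t k))" unfolding H_def X_def p1_def p2_def ..
        let ?u = "of_real (a k) * w + t k"
        have "cmod ((deriv ^^ M) X ?u) \<le> fact M * (c * r' ^ (k + 5)) / (\<rho> / 2) ^ M"
        proof (rule entire_deriv_bound[OF X])
          fix y assume y: "cmod (y - ?u) \<le> \<rho> / 2"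
          have "cmod (of_real (a k) * w) \<le> a k * (3 / 2)"
            unfolding norm_mult using w taj(2)[of k] by (auto intro!: mult_mono)
          then have "cmod y \<le> 2 * \<rho>"
            using norm_triangle_sub[of y ?u] y norm_triangle_ineq[of "of_real (a k) * w" "t k"] taj(1)[of k] elim
            by linarith
          then have "cmod (h ((F ^^ j k) (y *s v))) \<le> c * r ^ j k" using c(2) by auto
          also have "\<dots> \<le> c * r' ^ j k"
            using r' c(1) \<open>r > 0\<close> by (intro mult_left_mono power_mono) auto
          also have "\<dots> \<le> c * r' ^ (k + 5)"
            using r' c(1) taj(5) by (intro mult_left_mono power_increasing) auto
          finally show "cmod (X y) \<le> c * r' ^ (k + 5)" unfolding X_def Q .
        qed (use \<rho> in simp)
        moreover have "(deriv ^^ M) (H k) w = of_real (a k) ^ M * (deriv ^^ M) X ?u"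
          unfolding HX by (rule higher_deriv_compose_linear'[OF X open_UNIV open_UNIV]) auto
        then have "cmod ((deriv ^^ M) (H k) w) = a k ^ M * cmod ((deriv ^^ M) X ?u)"
          using taj(2)[of k] by (simp add: norm_mult norm_power)
        ultimately have "cmod ((deriv ^^ M) (H k) w) \<le> a k ^ M * (fact M * (c * r' ^ (k + 5)) / (\<rho> / 2) ^ M)"
          using taj(2)[of k] by (simp only:) (intro mult_left_mono, auto)
        also have "\<dots> \<le> (4 * \<rho> * (3 / 4) ^ (k + 5)) ^ M * (fact M * (c * r' ^ (k + 5)) / (\<rho> / 2) ^ M)"
          using taj(2,3)[of k] c(1) r' \<rho> by (intro mult_right_mono power_mono) (auto simp: less_imp_le)
        also have "\<dots> = C * (r' ^ (k + 5) * ((3 / 4) ^ (k + 5)) ^ M)"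
          unfolding C_def by (simp only: power_mult_distrib times_divide_eq_right times_divide_eq_left mult_ac)
        also have "r' ^ (k + 5) * ((3 / 4) ^ (k + 5)) ^ M = q ^ (k + 5)"
          unfolding q_def power_mult_distrib by (metis power_mult mult.commute)
        finally show ?case .
      qed
      have "(\<lambda>k. C * q ^ (k + 5)) \<longlonglongrightarrow> C * 0"
        by (rule tendsto_mult[OF tendsto_const LIMSEQ_ignore_initial_segment[OF LIMSEQ_realpow_zero[OF q]]])
      then have "(\<lambda>k. (deriv ^^ M) (H k) w) \<longlonglongrightarrow> 0"
        unfolding mult_zero_right by (rule Lim_null_comparison[OF ev])
      from LIMSEQ_subseq_LIMSEQ[OF this s] have lim0: "(\<lambda>k. (deriv ^^ M) (H (s k)) w) \<longlonglongrightarrow> 0"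
        unfolding comp_def .
      \<comment> \<open>A radius strictly between \<open>cmod w\<close> and 3/2: the closed disc is
        compact in the domain and \<open>w\<close> is interior to it.\<close>
      define d where "d = (cmod w + 3 / 2) / 2"
      have d: "cmod w < d" "d < 3 / 2" using w unfolding d_def by auto
      let ?K = "cball 0 d :: complex set"
      have K: "compact ?K" "?K \<subseteq> ball 0 (3/2)" using d(2) by auto
      have "uniform_limit ?K (\<lambda>k w. vector [p1 (s k) w, p2 (s k) w] :: complex^2) (\<lambda>w. vector [f1 w, f2 w]) sequentially"
      proof (rule uniform_limitI)
        fix e :: real assume "e > 0"
        then have "\<forall>\<^sub>F k in sequentially. \<forall>w\<in>?K. dist (p1 (s k) w) (f1 w) < e / 2"
          "\<forall>\<^sub>F k in sequentially. \<forall>w\<in>?K. dist (p2 (s k) w) (f2 w) < e / 2"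
          using uniform_limitD[OF u1[OF K] half_gt_zero] uniform_limitD[OF u2[OF K] half_gt_zero] by blast+
        then show "\<forall>\<^sub>F k in sequentially. \<forall>w\<in>?K.
            dist (vector [p1 (s k) w, p2 (s k) w] :: complex^2) (vector [f1 w, f2 w]) < e"
        proof eventually_elim
          case (elim k)
          show ?case
          proof
            fix w assume "w \<in> ?K"
            then have "cmod (p1 (s k) w - f1 w) < e / 2" "cmod (p2 (s k) w - f2 w) < e / 2"
              using elim by (auto simp: dist_norm)
            then show "dist (vector [p1 (s k) w, p2 (s k) w] :: complex^2) (vector [f1 w, f2 w]) < e"
              unfolding dist_norm
              using norm_vec2_le[of "vector [p1 (s k) w, p2 (s k) w] - vector [f1 w, f2 w]"] by simp
          qed
        qed
      qed
      then have "uniform_limit ?K (\<lambda>k. H (s k)) (\<lambda>w. h (vector [f1 w, f2 w])) sequentially"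
        unfolding H_def
      \<comment> \<open>All the discs lie in one closed ball, on which \<open>h\<close> is uniformly
        continuous.\<close>
      proof (rule uniform_limit_compose_uniformly_continuous_on)
        show "uniformly_continuous_on (cball 0 B') h"
          by (intro compact_uniformly_continuous hol2_continuous_on h) auto
        show "\<forall>\<^sub>F k in sequentially. \<forall>w\<in>?K. (vector [p1 (s k) w, p2 (s k) w] :: complex^2) \<in> cball 0 B'"
          using bound d(2) by (intro always_eventually) auto
      qed auto
      then have "uniform_limit (ball 0 d) (\<lambda>k. H (s k)) (\<lambda>w. h (vector [f1 w, f2 w])) sequentially"
        by (rule uniform_limit_on_subset) auto
      then have "(\<lambda>k. (deriv ^^ M) (H (s k)) w) \<longlonglongrightarrow> (deriv ^^ M) (\<lambda>w. h (vector [f1 w, f2 w])) w"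
      proof (rule higher_deriv_complex_uniform_limit)
        show "\<forall>\<^sub>F k in sequentially. H (s k) holomorphic_on ball 0 d"
          unfolding H_def by (intro always_eventually allI hol2_holomorphic_on h hol) auto
      qed (use d in auto)
      then show ?thesis using lim0 LIMSEQ_unique by blast
    qed
    then show ?thesis by blast
  qed
  show thesis by (rule that[OF f1 f2 nonconst vanish])
qed

section \<open>Leading forms of polynomial automorphisms\<close>

text \<open>The determinant of two vectors. Every linear form is \<open>cross2 u\<close> for some
  \<open>u\<close>, and for \<open>u \<noteq> 0\<close> its kernel is spanned by \<open>u\<close>,
  so forms and their zero directions are encoded by the same vector.\<close>

definition cross2 :: "complex^2 \<Rightarrow> complex^2 \<Rightarrow> complex" where
  "cross2 a b = a $ 1 * b $ 2 - a $ 2 * b $ 1"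

lemma cross2_linear:
  "cross2 a (b + c) = cross2 a b + cross2 a c" "cross2 a (b - c) = cross2 a b - cross2 a c"
  "cross2 a (k *s b) = k * cross2 a b" "cross2 (k *s a) b = k * cross2 a b"
  "cross2 (a + b) c = cross2 a c + cross2 b c"
  "cross2 a a = 0" "cross2 a 0 = 0"
  by (simp_all add: cross2_def algebra_simps)

lemma cross2_eq_0D:
  assumes "cross2 a b = 0" "a \<noteq> 0"
  shows "\<exists>k. b = k *s a"
proof (cases "a $ 1 = 0")
  case True
  then have "a $ 2 \<noteq> 0" using assms(2) by (auto simp: vec2_eq_iff)
  then show ?thesis
    using assms(1) True by (intro exI[of _ "b $ 2 / a $ 2"]) (auto simp: vec2_eq_iff cross2_def)
next
  case False
  then show ?thesis
    using assms(1) by (intro exI[of _ "b $ 1 / a $ 1"]) (auto simp: vec2_eq_iff cross2_def field_simps)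
qed

lemma cross2_Cramer:
  assumes "cross2 a b \<noteq> 0"
  shows "z = (cross2 z b / cross2 a b) *s a + (cross2 a z / cross2 a b) *s b"
proof -
  have "cross2 a b *s z = cross2 z b *s a + cross2 a z *s b"
    by (simp add: vec2_eq_iff cross2_def algebra_simps)
  then have "(1 / cross2 a b) *s (cross2 a b *s z) = (1 / cross2 a b) *s (cross2 z b *s a + cross2 a z *s b)"
    by (rule arg_cong)
  then show ?thesis using assms by (simp add: vec2_eq_iff field_simps)
qed

lemma ex_cross2_eq_1:
  assumes "u \<noteq> 0"
  shows "\<exists>w. cross2 u w = 1"
proof (cases "u $ 1 = 0")
  case True
  then have "u $ 2 \<noteq> 0" using assms by (auto simp: vec2_eq_iff)
  then show ?thesis by (intro exI[of _ "vector [- (1 / u $ 2), 0]"]) (simp add: cross2_def)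
next
  case False
  then show ?thesis by (intro exI[of _ "vector [0, 1 / u $ 1]"]) (simp add: cross2_def)
qed

lemma norm_cross2_le: "cmod (cross2 a b) \<le> 2 * norm a * norm b"
proof -
  have "cmod (cross2 a b) \<le> cmod (a $ 1) * cmod (b $ 2) + cmod (a $ 2) * cmod (b $ 1)"
    unfolding cross2_def norm_mult[symmetric] by (rule norm_triangle_ineq4)
  also have "\<dots> \<le> norm a * norm b + norm a * norm b"
    by (intro add_mono mult_mono Finite_Cartesian_Product.norm_nth_le) auto
  finally show ?thesis by simp
qed

lemma norm_vector_scalar: "norm (c *s z) = cmod c * norm z" for z :: "complex^2"
  by (simp add: norm_vec_def norm_mult L2_set_right_distrib)

section \<open>Polynomials on lines and leading homogeneous parts\<close>

lemma poly_fun2_on_curve: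
  assumes "poly_fun2 h"
  shows "\<exists>r. \<forall>t. h (vector [poly p t, poly q t]) = poly r t"
proof -
  obtain d and c :: "nat \<Rightarrow> nat \<Rightarrow> complex"
    where h: "\<And>z. h z = (\<Sum>i\<le>d. \<Sum>j\<le>d. c i j * (z $ 1) ^ i * (z $ 2) ^ j)"
    using assms unfolding poly_fun2_def by blast
  show ?thesis
    by (intro exI[of _ "\<Sum>i\<le>d. \<Sum>j\<le>d. smult (c i j) (p ^ i * q ^ j)"])
       (simp add: h poly_sum mult.assoc)
qed

lemma poly_fun2_on_line:
  assumes "poly_fun2 h"
  shows "\<exists>r. \<forall>t. h (t *s a + b) = poly r t"
proof -
  have "t *s a + b = vector [poly [:b $ 1, a $ 1:] t, poly [:b $ 2, a $ 2:] t]" for t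
    by (simp add: vec2_eq_iff algebra_simps)
  then show ?thesis
    using poly_fun2_on_curve[OF assms, of "[:b $ 1, a $ 1:]" "[:b $ 2, a $ 2:]"] by simp
qed

text \<open>The arguments on leading forms use polynomials only through their restrictions to lines;
  this avoids bookkeeping of coefficients.\<close>

definition line_poly :: "(complex^2 \<Rightarrow> complex) \<Rightarrow> bool" where
  "line_poly h \<longleftrightarrow> (\<forall>a b. \<exists>r. \<forall>t. h (t *s a + b) = poly r t)"

lemma line_polyE:
  assumes "line_poly h"
  obtains r where "\<And>t. h (t *s a + b) = poly r t"
  using assms unfolding line_poly_def by metis

lemma poly_fun2_line_poly: "poly_fun2 h \<Longrightarrow> line_poly h"
  unfolding line_poly_def using poly_fun2_on_line by blast

lemma line_poly_linear_comb:
  assumes "line_poly h" "line_poly k"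
  shows "line_poly (\<lambda>z. c * h z + d * k z)"
  unfolding line_poly_def
proof (intro allI)
  fix a b
  obtain p q where "\<And>t. h (t *s a + b) = poly p t" "\<And>t. k (t *s a + b) = poly q t"
    using line_polyE[OF assms(1)] line_polyE[OF assms(2)] by metis
  then show "\<exists>r. \<forall>t. c * h (t *s a + b) + d * k (t *s a + b) = poly r t"
    by (intro exI[of _ "smult c p + smult d q"]) simp
qed

text \<open>The leading homogeneous part of the map as a whole: one component of
  \<open>\<tau>\<close> may vanish. The lower terms enter only through their size.\<close>

definition top_part :: "(complex^2 \<Rightarrow> complex^2) \<Rightarrow> nat \<Rightarrow> (complex^2 \<Rightarrow> complex^2) \<Rightarrow> bool" where
  "top_part f d \<tau> \<longleftrightarrow> poly_map2 \<tau> \<and> (\<forall>c z. \<tau> (c *s z) = c ^ d *s \<tau> z) \<and> (\<exists>z. \<tau> z \<noteq> 0) \<and>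
     (\<exists>C\<ge>0. \<forall>z. norm (f z - \<tau> z) \<le> C * (1 + norm z) ^ (d - 1))"

lemma ex_top_part:
  assumes f: "poly_map2 f" and naff: "\<not> (\<exists>(A :: complex^2^2) b. \<forall>z. f z = A *v z + b)"
  shows "\<exists>d \<tau>. d \<ge> 2 \<and> top_part f d \<tau>"
proof -
  define repr where "repr h d c \<longleftrightarrow>
      (\<forall>z :: complex^2. h z = (\<Sum>i\<le>d. \<Sum>j\<le>d. c i j * (z $ 1) ^ i * (z $ 2) ^ j))"
    for h :: "complex^2 \<Rightarrow> complex" and d :: nat and c :: "nat \<Rightarrow> nat \<Rightarrow> complex"
  have "\<forall>k. \<exists>d c. repr (\<lambda>z. f z $ k) d c"
    using f unfolding poly_map2_def poly_fun2_def repr_def .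
  then obtain D c where "\<And>k. repr (\<lambda>z. f z $ k) (D k) (c k)"
    by metis
  then have c: "f z $ k = (\<Sum>i\<le>D k. \<Sum>j\<le>D k. c k i j * (z $ 1) ^ i * (z $ 2) ^ j)" for k z
    unfolding repr_def by blast
  \<comment> \<open>Coefficients extended by zero give both components one finite index set
    \<open>I\<close> of exponent pairs.\<close>
  define e where "e k p = (if fst p \<le> D k \<and> snd p \<le> D k then c k (fst p) (snd p) else 0)" for k p
  define m where "m z p = (z $ 1) ^ fst p * (z $ 2) ^ snd p" for z :: "complex^2" and p
  define I where "I = {p. \<exists>k. e k p \<noteq> 0}"
  have "I \<subseteq> (\<Union>k. {..D k} \<times> {..D k})" unfolding I_def e_def by (auto split: if_splits)
  then have finI: "finite I" by (rule finite_subset) auto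
  have fI: "f z $ k = (\<Sum>p\<in>I. e k p * m z p)" for z k
  proof -
    have "f z $ k = (\<Sum>p\<in>{..D k} \<times> {..D k}. c k (fst p) (snd p) * m z p)"
      by (simp add: c m_def sum.cartesian_product mult.assoc split_beta)
    also have "\<dots> = (\<Sum>p\<in>{..D k} \<times> {..D k}. e k p * m z p)"
      by (intro sum.cong refl) (auto simp: e_def)
    also have "\<dots> = (\<Sum>p\<in>{..D k} \<times> {..D k} \<inter> I. e k p * m z p)"
      by (rule sum.mono_neutral_right) (auto simp: I_def)
    also have "\<dots> = (\<Sum>p\<in>I. e k p * m z p)"
      by (rule sum.mono_neutral_left) (use finI in \<open>auto simp: e_def split: if_splits\<close>)
    finally show ?thesis .
  qed
  define deg where "deg p = fst p + snd p" for p :: "nat \<times> nat"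
  have "\<exists>p\<in>I. deg p \<ge> 2"
  proof (rule ccontr)
    assume "\<not> (\<exists>p\<in>I. deg p \<ge> 2)"
    then have "deg p \<le> 1" if "p \<in> I" for p using that by force
    then have sub: "I \<subseteq> {(0, 0), (1, 0), (0, 1)}" unfolding deg_def by force
    have "f z $ k = (\<Sum>p\<in>{(0, 0), (1, 0), (0, 1)}. e k p * m z p)" for z k
      unfolding fI by (rule sum.mono_neutral_left) (use sub in \<open>auto simp: I_def\<close>)
    then have "f z $ k = e k (0, 0) + e k (1, 0) * z $ 1 + e k (0, 1) * z $ 2" for z k
      by (simp add: m_def)
    then have "f z = (\<chi> k j. if j = 1 then e k (1, 0) else e k (0, 1)) *v z + (\<chi> k. e k (0, 0))" for z
      by (simp add: vec_eq_iff matrix_vector_mult_def sum_2)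
    then show False using naff by blast
  qed
  then obtain p0 where p0: "p0 \<in> I" "deg p0 \<ge> 2" by blast
  define d where "d = Max (deg ` I)"
  have dmax: "deg p \<le> d" if "p \<in> I" for p unfolding d_def using finI that by simp
  have "d \<in> deg ` I" unfolding d_def using finI p0 by (intro Max_in) auto
  then obtain p1 where p1: "p1 \<in> I" "deg p1 = d" by blast
  have d2: "d \<ge> 2" using p0(2) dmax[OF p0(1)] by simp
  define J where "J = {p \<in> I. deg p = d}"
  have finJ: "finite J" unfolding J_def using finI by simp
  define \<tau> where "\<tau> z = (\<chi> k. \<Sum>p\<in>J. e k p * m z p)" for z
  have "poly_fun2 (\<lambda>z. \<tau> z $ k)" for k
  proof -
    define b where "b i j = (if (i, j) \<in> J then e k (i, j) else 0)" for i j
    have "\<tau> z $ k = (\<Sum>i\<le>d. \<Sum>j\<le>d. b i j * (z $ 1) ^ i * (z $ 2) ^ j)" for z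
    proof -
      have "(\<Sum>i\<le>d. \<Sum>j\<le>d. b i j * (z $ 1) ^ i * (z $ 2) ^ j) = (\<Sum>p\<in>{..d} \<times> {..d}. b (fst p) (snd p) * m z p)"
        by (simp add: m_def sum.cartesian_product mult.assoc split_beta)
      also have "\<dots> = (\<Sum>p\<in>J. b (fst p) (snd p) * m z p)"
        by (rule sum.mono_neutral_right) (auto simp: b_def J_def deg_def)
      also have "\<dots> = \<tau> z $ k" unfolding \<tau>_def by (auto simp: b_def intro!: sum.cong)
      finally show ?thesis by simp
    qed
    then show ?thesis unfolding poly_fun2_def by blast
  qed
  moreover have "\<tau> (s *s z) = s ^ d *s \<tau> z" for s z
  proof -
    have "m (s *s z) p = s ^ d * m z p" if "p \<in> J" for p
      using that unfolding m_def J_def deg_def by (auto simp: power_mult_distrib power_add algebra_simps)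
    then show ?thesis
      unfolding \<tau>_def by (simp add: vec_eq_iff sum_distrib_left mult_ac cong: sum.cong)
  qed
  moreover have "\<exists>z. \<tau> z \<noteq> 0"
  proof (rule ccontr)
    assume "\<nexists>z. \<tau> z \<noteq> 0"
    then have z0: "\<tau> z = 0" for z by blast
    obtain k where k: "e k p1 \<noteq> 0" using p1(1) unfolding I_def by blast
    \<comment> \<open>On the line of points \<open>(t, 1)\<close> the monomials of \<open>J\<close>
      remain distinct, since in degree \<open>d\<close> the first exponent determines the
      second.\<close>
    define r where "r = (\<Sum>p\<in>J. monom (e k p) (fst p))"
    have "poly r t = \<tau> (vector [t, 1]) $ k" for t
      unfolding r_def \<tau>_def m_def by (simp add: poly_sum poly_monom)
    then have "r = 0" using z0 poly_all_0_iff_0[of r] by simp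
    have "coeff r (fst p1) = (\<Sum>p\<in>J. if p = p1 then e k p else 0)"
      unfolding r_def coeff_sum coeff_monom
      by (intro sum.cong refl) (use p1 in \<open>auto simp: J_def deg_def\<close>)
    also have "\<dots> = e k p1" using p1 finJ by (simp add: J_def)
    finally show False using \<open>r = 0\<close> k by simp
  qed
  moreover have "\<exists>C\<ge>0. \<forall>z. norm (f z - \<tau> z) \<le> C * (1 + norm z) ^ (d - 1)"
  proof (intro exI conjI allI)
    let ?C = "\<lambda>k. \<Sum>p\<in>I - J. cmod (e k p)"
    show "?C 1 + ?C 2 \<ge> 0" by (intro add_nonneg_nonneg sum_nonneg) auto
    fix z
    have comp: "cmod ((f z - \<tau> z) $ k) \<le> ?C k * (1 + norm z) ^ (d - 1)" for k
    proof -
      have "(f z - \<tau> z) $ k = (\<Sum>p\<in>I - J. e k p * m z p)"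
        unfolding vector_minus_component fI \<tau>_def using finI by (simp add: sum_diff J_def)
      also have "cmod \<dots> \<le> (\<Sum>p\<in>I - J. cmod (e k p) * (1 + norm z) ^ (d - 1))"
      proof (intro sum_norm_le)
        fix p assume p: "p \<in> I - J"
        have "cmod (m z p) \<le> (1 + norm z) ^ fst p * (1 + norm z) ^ snd p"
          unfolding m_def norm_mult norm_power
          by (intro mult_mono power_mono order_trans[OF Finite_Cartesian_Product.norm_nth_le]) auto
        also have "\<dots> \<le> (1 + norm z) ^ (d - 1)"
          unfolding power_add[symmetric] using p dmax[of p]
          by (intro power_increasing) (auto simp: J_def deg_def)
        finally show "cmod (e k p * m z p) \<le> cmod (e k p) * (1 + norm z) ^ (d - 1)"
          unfolding norm_mult by (rule mult_left_mono) simp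
      qed
      finally show ?thesis by (simp add: sum_distrib_right)
    qed
    show "norm (f z - \<tau> z) \<le> (?C 1 + ?C 2) * (1 + norm z) ^ (d - 1)"
      using norm_vec2_le[of "f z - \<tau> z"] comp[of 1] comp[of 2] by (simp add: distrib_right)
  qed
  ultimately show ?thesis
    using d2 unfolding top_part_def poly_map2_def by blast
qed

section \<open>Directions at infinity of the fibres\<close>

lemma poly_eq_off_0:
  fixes p q :: "complex poly"
  assumes "\<And>t. t \<noteq> 0 \<Longrightarrow> poly p t = poly q t"
  shows "p = q"
proof (rule ccontr)
  assume "p \<noteq> q"
  then have "finite {x. poly (p - q) x = 0}" by (intro poly_roots_finite) auto
  moreover have "- {0} \<subseteq> {x. poly (p - q) x = 0}" using assms by auto
  ultimately have "finite (- {0 :: complex})" by (rule finite_subset[rotated])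
  then show False using infinite_UNIV_char_0[where 'a = complex] by (simp add: finite_compl)
qed

text \<open>A zero at infinity of the leading form \<open>T\<close> is a limit of zeros of \<open>h\<close>, by Hurwitz's theorem
  applied to \<open>h (N z) / N ^ d\<close>.\<close>

lemma zeros_near_asymptotic_direction:
  assumes hT: "\<And>z. cmod (h z - T z) \<le> C * (1 + norm z) ^ (d - 1)" and "C \<ge> 0" and d: "d \<ge> 1"
    and T: "line_poly T" "\<And>c z. T (c *s z) = c ^ d * T z" and h: "line_poly h"
    and q: "T q = 0" "T q' \<noteq> 0" and \<delta>: "\<delta> > 0"
  shows "\<exists>n>N. \<exists>\<eta>. cmod \<eta> < \<delta> \<and> h (of_nat n *s (\<eta> *s q' + q)) = 0"
proof (rule ccontr)
  assume neg: "\<not> ?thesis"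
  obtain r where r: "\<And>t. T (t *s q' + q) = poly r t" using T(1) unfolding line_poly_def by metis
  have "\<exists>p. \<forall>t. h (of_nat n *s (t *s q' + q)) = poly p t" for n :: nat
  proof -
    obtain p where "\<And>t. h (t *s (of_nat n *s q') + of_nat n *s q) = poly p t"
      using h unfolding line_poly_def by metis
    moreover have "of_nat n *s (t *s q' + q) = t *s (of_nat n *s q') + of_nat n *s q" for t
      by (simp add: vec2_eq_iff algebra_simps)
    ultimately show ?thesis by metis
  qed
  then obtain p where p: "\<And>n t. h (of_nat n *s (t *s q' + q)) = poly (p n) t" by metis
  \<comment> \<open>The shift by \<open>N + 1\<close> keeps the scale above \<open>N\<close> and
    nonzero.\<close>
  define X where "X n \<eta> = poly (p (n + N + 1)) \<eta> / of_nat (n + N + 1) ^ d" for n \<eta>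
  have "poly r 0 \<noteq> 0"
  proof (rule Hurwitz_no_zeros[of "ball 0 \<delta>" X "poly r"])
    show "open (ball (0 :: complex) \<delta>)" "connected (ball (0 :: complex) \<delta>)" "(0 :: complex) \<in> ball 0 \<delta>"
      using \<delta> by auto
    show "X n holomorphic_on ball 0 \<delta>" for n
      unfolding X_def by (intro holomorphic_intros) auto
    show "poly r holomorphic_on ball 0 \<delta>" by (intro holomorphic_intros)
    show "X n z \<noteq> 0" if "z \<in> ball 0 \<delta>" for n z
    proof -
      have "h (of_nat m *s (z *s q' + q)) \<noteq> 0" if "m > N" for m
        using neg that \<open>z \<in> ball 0 \<delta>\<close> unfolding mem_ball_0 by blast
      then have "poly (p (n + N + 1)) z \<noteq> 0" unfolding p by simp
      then show ?thesis
        unfolding X_def divide_eq_0_iff power_eq_0_iff of_nat_eq_0_iff by simp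
    qed
    show "\<not> poly r constant_on ball 0 \<delta>"
    proof
      assume "poly r constant_on ball 0 \<delta>"
      then obtain c where c: "\<And>x. x \<in> ball 0 \<delta> \<Longrightarrow> poly r x = c" unfolding constant_on_def by blast
      have "poly r 0 = 0" using q(1) r[of 0] by simp
      then have "c = 0" using c[of 0] \<delta> by simp
      then have "ball 0 \<delta> \<subseteq> {x. poly r x = 0}" using c by auto
      moreover have "infinite (ball 0 \<delta> :: complex set)"
        using \<delta> finite_imp_not_open[of "ball (0 :: complex) \<delta>"] by auto
      ultimately have "infinite {x. poly r x = 0}" using infinite_super by blast
      then have r0: "r = 0" using poly_roots_finite by blast
      \<comment> \<open>Inverting the parameter carries the line through \<open>q\<close> to the
        line through \<open>q'\<close>: vanishing of \<open>T\<close> on the former would give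
        \<open>T q' = 0\<close> by homogeneity.\<close>
      obtain s where s: "\<And>t. T (t *s q + q') = poly s t" using T(1) unfolding line_poly_def by metis
      have "s = 0"
      proof (rule poly_eq_off_0)
        fix t :: complex assume "t \<noteq> 0"
        then have "t *s q + q' = t *s ((1 / t) *s q' + q)" by (simp add: vec2_eq_iff field_simps)
        then have "poly s t = t ^ d * T ((1 / t) *s q' + q)" using s T(2) by metis
        then show "poly s t = poly 0 t" unfolding r r0 by simp
      qed
      then show False using s[of 0] q(2) by simp
    qed
    fix K :: "complex set" assume "compact K" "K \<subseteq> ball 0 \<delta>"
    define B where "B = norm q + \<delta> * norm q'"
    have B: "B \<ge> 0" unfolding B_def using \<delta> by simp
    \<comment> \<open>The remainder has one degree less than \<open>T\<close>, so after division by
      \<open>m ^ d\<close> it decays like \<open>1 / m\<close>.\<close>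
    have est: "cmod (X n \<eta> - poly r \<eta>) \<le> C * (1 + B) ^ (d - 1) * inverse (Suc n)" if "\<eta> \<in> K" for n \<eta>
    proof -
      let ?z = "\<eta> *s q' + q"
      define m where "m = n + N + 1"
      have m: "m \<noteq> 0" "Suc n \<le> m" unfolding m_def by auto
      have \<eta>: "cmod \<eta> \<le> \<delta>" using that \<open>K \<subseteq> ball 0 \<delta>\<close> by (auto intro: less_imp_le)
      have "norm ?z \<le> cmod \<eta> * norm q' + norm q"
        using norm_triangle_ineq[of "\<eta> *s q'" q] by (simp add: norm_vector_scalar)
      also have "\<dots> \<le> B" unfolding B_def using \<eta> by (simp add: mult_right_mono)
      finally have z: "norm ?z \<le> B" .
      have "X n \<eta> - poly r \<eta> = (h (of_nat m *s ?z) - T (of_nat m *s ?z)) / of_nat m ^ d"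
        unfolding X_def T(2) r p m_def[symmetric] using m(1) by (simp add: diff_divide_distrib)
      then have "cmod (X n \<eta> - poly r \<eta>) \<le> C * (1 + norm (of_nat m *s ?z)) ^ (d - 1) / real m ^ d"
        using hT[of "of_nat m *s ?z"] by (simp add: norm_divide norm_power divide_right_mono)
      also have "\<dots> \<le> C * (real m * (1 + B)) ^ (d - 1) / real m ^ d"
      proof (intro divide_right_mono mult_left_mono power_mono \<open>C \<ge> 0\<close>)
        have "norm (of_nat m *s ?z) \<le> real m * B"
          unfolding norm_vector_scalar norm_of_nat by (intro mult_left_mono z) auto
        then show "1 + norm (of_nat m *s ?z) \<le> real m * (1 + B)"
          using m by (simp add: distrib_left)
      qed auto
      also have "\<dots> = C * (1 + B) ^ (d - 1) * (real m ^ (d - 1) / real m ^ d)"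
        by (simp add: power_mult_distrib)
      also have "real m ^ (d - 1) / real m ^ d = inverse (real m)"
        using d m by (cases d) (simp_all add: field_simps)
      also have "C * (1 + B) ^ (d - 1) * inverse (real m) \<le> C * (1 + B) ^ (d - 1) * inverse (Suc n)"
        using \<open>C \<ge> 0\<close> B m by (intro mult_left_mono le_imp_inverse_le) auto
      finally show ?thesis .
    qed
    show "uniform_limit K X (poly r) sequentially"
    proof (rule uniform_limitI)
      fix e :: real assume "e > 0"
      have "(\<lambda>n. C * (1 + B) ^ (d - 1) * inverse (real (Suc n))) \<longlonglongrightarrow> C * (1 + B) ^ (d - 1) * 0"
        by (intro tendsto_intros LIMSEQ_inverse_real_of_nat)
      then have "\<forall>\<^sub>F n in sequentially. C * (1 + B) ^ (d - 1) * inverse (real (Suc n)) < e"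
        using \<open>e > 0\<close> by (intro order_tendstoD(2)) auto
      then show "\<forall>\<^sub>F n in sequentially. \<forall>y\<in>K. dist (X n y) (poly r y) < e"
        by eventually_elim (auto simp: dist_norm intro!: le_less_trans[OF est])
    qed
  qed
  then show False using r[of 0] q(1) by simp
qed

text \<open>The fibre \<open>{h = 0}\<close> is the image under \<open>g\<close> of a line, hence a polynomial curve, which has
  only one direction \<open>u\<close> at infinity.\<close>

lemma fibre_unique_direction:
  assumes g: "poly_map2 g" and fg: "\<And>z. f (g z) = z" and gf: "\<And>z. g (f z) = z"
    and l: "l1 \<noteq> 0 \<or> l2 \<noteq> 0" and h: "\<And>z. h z = l1 * f z $ 1 + l2 * f z $ 2"
    and hT: "\<And>z. cmod (h z - T z) \<le> C * (1 + norm z) ^ (d - 1)" and "C \<ge> 0" and d: "d \<ge> 1"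
    and T: "line_poly T" "\<And>c z. T (c *s z) = c ^ d * T z" and lh: "line_poly h"
    and q': "T q' \<noteq> 0"
  shows "\<exists>u. u \<noteq> 0 \<and> (\<forall>q. T q = 0 \<longrightarrow> cross2 u q = 0)"
proof -
  \<comment> \<open>The vector \<open>w0\<close> spans the kernel of the form with coefficients
    \<open>l1\<close>, \<open>l2\<close>, so the zero set of \<open>h\<close> is the image of the
    line through \<open>w0\<close> under \<open>g\<close>.\<close>
  define w0 where "w0 = (vector [- l2, l1] :: complex^2)"
  have w0: "w0 \<noteq> 0" using l unfolding w0_def by (auto simp: vec2_eq_iff)
  obtain G1 where G1: "\<And>t. g (t *s w0) $ 1 = poly G1 t"
    using poly_fun2_on_line[of "\<lambda>z. g z $ 1" w0 0] g unfolding poly_map2_def by auto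
  obtain G2 where G2: "\<And>t. g (t *s w0) $ 2 = poly G2 t"
    using poly_fun2_on_line[of "\<lambda>z. g z $ 2" w0 0] g unfolding poly_map2_def by auto
  define m where "m = max (degree G1) (degree G2)"
  have m: "m \<ge> 1"
  proof (rule ccontr)
    assume "\<not> m \<ge> 1"
    then have "degree G1 = 0" "degree G2 = 0" unfolding m_def by auto
    then have "g (1 *s w0) = g (0 *s w0)"
      unfolding vec2_eq_iff G1 G2 by (auto elim!: degree_eq_zeroE)
    then have "1 *s w0 = 0 *s w0" using fg by metis
    then show False using w0 by simp
  qed
  \<comment> \<open>The component of larger degree bounds the size of the curve from below.\<close>
  define H where "H = (if degree G1 \<ge> degree G2 then G1 else G2)"
  have H: "degree H = m" unfolding H_def m_def by auto
  have Hle: "cmod (poly H t) \<le> norm (g (t *s w0))" for t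
    unfolding H_def using Finite_Cartesian_Product.norm_nth_le[of "g (t *s w0)" 1]
      Finite_Cartesian_Product.norm_nth_le[of "g (t *s w0)" 2] by (simp add: G1 G2)
  \<comment> \<open>The leading coefficient vector of the curve. The form \<open>cross2 u\<close>
    cancels this leading term, so along the curve it is of smaller order than the curve
    itself.\<close>
  define u where "u = (vector [coeff G1 m, coeff G2 m] :: complex^2)"
  have "coeff H m \<noteq> 0" using H m by (metis degree_0 leading_coeff_0_iff not_one_le_zero)
  moreover have "u $ 1 = coeff H m \<or> u $ 2 = coeff H m" unfolding H_def u_def by simp
  ultimately have u: "u \<noteq> 0" by (metis zero_index)
  define R where "R = smult (u $ 1) G2 - smult (u $ 2) G1"
  have R: "cross2 u (g (t *s w0)) = poly R t" for t
    unfolding cross2_def G1 G2 R_def by simp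
  have dR: "degree R < m"
  proof -
    have "degree R \<le> m"
      unfolding R_def m_def by (intro degree_diff_le order_trans[OF degree_smult_le]) auto
    moreover have "coeff R m = 0" unfolding R_def u_def by simp
    ultimately show ?thesis using m by (metis degree_0 leading_coeff_0_iff le_neq_implies_less less_le_trans zero_less_one)
  qed
  have "cross2 u q = 0" if q: "T q = 0" for q
  proof (rule ccontr)
    assume "cross2 u q \<noteq> 0"
    define e where "e = cmod (cross2 u q)"
    have e: "e > 0" unfolding e_def using \<open>cross2 u q \<noteq> 0\<close> by simp
    \<comment> \<open>The first bound changes the norm of \<open>q\<close> by at most 1, the second
      changes \<open>cross2 u q\<close> by at most half its modulus.\<close>
    define \<delta> where "\<delta> = min (1 / (norm q' + 1)) (e / (2 * (cmod (cross2 u q') + 1)))"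
    have \<delta>: "\<delta> > 0" unfolding \<delta>_def using e
      by (simp add: add_nonneg_pos)
    have \<delta>1: "\<delta> * norm q' \<le> 1"
    proof -
      have "\<delta> * norm q' \<le> 1 / (norm q' + 1) * norm q'" unfolding \<delta>_def by (intro mult_right_mono) auto
      also have "\<dots> \<le> 1" by (simp add: divide_simps add_nonneg_pos)
      finally show ?thesis .
    qed
    have \<delta>2: "\<delta> * cmod (cross2 u q') \<le> e / 2"
    proof -
      have "\<delta> * cmod (cross2 u q') \<le> e / (2 * (cmod (cross2 u q') + 1)) * cmod (cross2 u q')"
        unfolding \<delta>_def by (intro mult_right_mono) auto
      also have "\<dots> = e / 2 * (cmod (cross2 u q') / (cmod (cross2 u q') + 1))"
        by (simp add: field_simps)
      also have "\<dots> \<le> e / 2 * 1" using e by (intro mult_left_mono) (auto simp: divide_simps add_nonneg_pos)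
      finally show ?thesis by simp
    qed
    \<comment> \<open>With this value the upper bound for \<open>cross2 u z\<close> becomes
      \<open>n * e / 4\<close>, half of the lower bound \<open>n * e / 2\<close>.\<close>
    define e' where "e' = e / (4 * (norm q + 1))"
    have e': "e' > 0" unfolding e'_def using e by (simp add: add_nonneg_pos)
    have "((\<lambda>x. poly R x / poly H x) \<longlongrightarrow> 0) at_infinity"
      using dR H by (intro poly_divide_tendsto_0_at_infinity) simp
    then have "\<forall>\<^sub>F x in at_infinity. dist (poly R x / poly H x) 0 < e'"
      using e' by (rule tendstoD)
    then obtain b where b: "\<And>x. b \<le> cmod x \<Longrightarrow> cmod (poly R x / poly H x) < e'"
      unfolding eventually_at_infinity by auto
    have "\<forall>\<^sub>F x in at_infinity. poly H x \<noteq> 0"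
    proof -
      have "H \<noteq> 0" using H m by auto
      then have "bounded {x. poly H x = 0}" using poly_roots_finite finite_imp_bounded by blast
      then obtain c where "\<forall>x\<in>{x. poly H x = 0}. norm x \<le> c" unfolding bounded_iff by blast
      then show ?thesis unfolding eventually_at_infinity by (intro exI[of _ "c + 1"]) auto
    qed
    then obtain b' where b': "\<And>x. b' \<le> cmod x \<Longrightarrow> poly H x \<noteq> 0"
      unfolding eventually_at_infinity by auto
    have "compact (poly R ` cball 0 (max b b'))"
      by (intro compact_continuous_image continuous_intros) auto
    then obtain M where "\<forall>x\<in>poly R ` cball 0 (max b b'). norm x \<le> M"
      using compact_imp_bounded bounded_iff by blast
    then have M: "cmod (poly R x) \<le> M" if "cmod x \<le> max b b'" for x using that by auto
    \<comment> \<open>Beyond \<open>N\<close> the value of \<open>R\<close> exceeds its maximum on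
      the disc, so the curve parameter \<open>s\<close> must be large.\<close>
    obtain N :: nat where N: "M < real N * (e / 2)"
      using reals_Archimedean3[of "e / 2"] e by auto
    obtain n \<eta> where n: "n > N" "cmod \<eta> < \<delta>" "h (of_nat n *s (\<eta> *s q' + q)) = 0"
      using zeros_near_asymptotic_direction[OF hT \<open>C \<ge> 0\<close> d T lh q q' \<delta>] by blast
    define z where "z = of_nat n *s (\<eta> *s q' + q)"
    have "cross2 w0 (f z) = 0"
      using n(3) unfolding z_def[symmetric] h w0_def cross2_def
      by (simp add: algebra_simps) (metis add.commute add_eq_0_iff)
    then obtain s where "f z = s *s w0" using cross2_eq_0D w0 by blast
    then have z: "z = g (s *s w0)" using gf by metis
    have "cross2 u z = of_nat n * (\<eta> * cross2 u q' + cross2 u q)"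
      unfolding z_def by (simp add: cross2_linear algebra_simps)
    then have "cmod (poly R s) = real n * cmod (\<eta> * cross2 u q' + cross2 u q)"
      unfolding R[symmetric] z[symmetric] by (simp add: norm_mult)
    moreover have "e / 2 \<le> cmod (\<eta> * cross2 u q' + cross2 u q)"
    proof -
      have "cmod (\<eta> * cross2 u q') \<le> \<delta> * cmod (cross2 u q')"
        unfolding norm_mult using n(2) by (intro mult_right_mono) auto
      moreover have "e \<le> cmod (\<eta> * cross2 u q' + cross2 u q) + cmod (\<eta> * cross2 u q')"
        unfolding e_def using norm_triangle_ineq4[of "\<eta> * cross2 u q' + cross2 u q" "\<eta> * cross2 u q'"] by simp
      ultimately show ?thesis using \<delta>2 by linarith
    qed
    ultimately have low: "real n * (e / 2) \<le> cmod (poly R s)"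
      by (simp only:) (rule mult_left_mono, auto)
    have "real N * (e / 2) \<le> real n * (e / 2)" using n(1) e by (intro mult_right_mono) auto
    then have "M < cmod (poly R s)" using N low by linarith
    then have s: "max b b' < cmod s" using M[of s] by linarith
    then have "cmod (poly R s) < e' * cmod (poly H s)"
      using b[of s] b'[of s] by (simp add: norm_divide divide_simps)
    also have "\<dots> \<le> e' * norm z" unfolding z using e' by (intro mult_left_mono Hle) auto
    also have "\<dots> \<le> e' * (real n * (1 + norm q))"
    proof -
      have "norm (\<eta> *s q' + q) \<le> cmod \<eta> * norm q' + norm q"
        using norm_triangle_ineq[of "\<eta> *s q'" q] by (simp add: norm_vector_scalar)
      also have "\<dots> \<le> \<delta> * norm q' + norm q" using n(2) by (intro add_mono mult_right_mono) auto
      finally have "norm (\<eta> *s q' + q) \<le> 1 + norm q" using \<delta>1 by linarith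
      then have "norm z \<le> real n * (1 + norm q)"
        unfolding z_def norm_vector_scalar norm_of_nat by (intro mult_left_mono) auto
      then show ?thesis using e' by (intro mult_left_mono) auto
    qed
    also have "\<dots> = real n * e / 4"
    proof -
      have "norm q + 1 \<noteq> 0" using norm_ge_zero[of q] by linarith
      then show ?thesis unfolding e'_def by (simp add: field_simps)
    qed
    finally have "cmod (poly R s) < real n * e / 4" .
    moreover have "real n * e > 0" using e n(1) by simp
    ultimately show False using low by simp
  qed
  then show ?thesis using u by blast
qed

text \<open>On the line through \<open>w\<close> in direction \<open>u\<close> the form
  \<open>cross2 u\<close> equals 1, so \<open>T\<close> has no zero there and is constant;
  homogeneity determines the rest.\<close>

lemma form_eq_cross2_power:
  assumes T: "line_poly T" "\<And>c z. T (c *s z) = c ^ d * T z" and d: "d \<ge> 1"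
    and u: "u \<noteq> 0" "\<And>q. T q = 0 \<Longrightarrow> cross2 u q = 0"
  shows "\<exists>c. \<forall>z. T z = c * cross2 u z ^ d"
proof -
  obtain w where w: "cross2 u w = 1" using ex_cross2_eq_1[OF u(1)] by blast
  have const: "T (a *s u + w) = T w" for a
  proof -
    obtain r where r: "\<And>t. T (t *s u + w) = poly r t" using T(1) unfolding line_poly_def by metis
    have "poly r t \<noteq> 0" for t
      using u(2)[of "t *s u + w"] w by (auto simp: r[symmetric] cross2_linear)
    then have "degree r = 0" using alg_closed_imp_poly_has_root[of r] by blast
    then obtain c where "r = [:c:]" by (rule degree_eq_zeroE)
    then show ?thesis using r[of a] r[of 0] by simp
  qed
  have *: "T (b *s w + a *s u) = T w * b ^ d" for a b
  proof -
    obtain r where r: "\<And>t. T (t *s w + a *s u) = poly r t" using T(1) unfolding line_poly_def by metis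
    have "r = monom (T w) d"
    proof (rule poly_eq_off_0)
      fix t :: complex assume "t \<noteq> 0"
      then have "t *s w + a *s u = t *s ((a / t) *s u + w)" by (simp add: vec2_eq_iff field_simps)
      then have "T (t *s w + a *s u) = t ^ d * T w" by (simp only: T(2) const)
      then show "poly r t = poly (monom (T w) d) t" by (simp add: r[symmetric] poly_monom)
    qed
    then show ?thesis by (simp add: r poly_monom)
  qed
  have "T z = T w * cross2 u z ^ d" for z
  proof -
    have "z = cross2 u z *s w + cross2 z w *s u"
      using cross2_Cramer[of u w z] w by (simp add: add.commute)
    then show ?thesis using * by metis
  qed
  then show ?thesis by blast
qed

text \<open>A nonzero combination of the components of \<open>\<tau>\<close> vanishes in at most one
  direction, hence is a multiple of the power of one form. It remains to see that two nonzero
  components have proportional forms.\<close>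

lemma top_part_eq_cross2_power:
  assumes f: "poly_map2 f" and g: "poly_map2 g" and fg: "\<And>z. f (g z) = z" and gf: "\<And>z. g (f z) = z"
    and d: "d \<ge> 2" and top: "top_part f d \<tau>"
  shows "\<exists>u v. u \<noteq> 0 \<and> v \<noteq> 0 \<and> (\<forall>z. \<tau> z = cross2 u z ^ d *s v)"
proof -
  have \<tau>: "poly_map2 \<tau>" "\<And>c z. \<tau> (c *s z) = c ^ d *s \<tau> z" "\<exists>z. \<tau> z \<noteq> 0"
    using top unfolding top_part_def by blast+
  obtain C where C: "C \<ge> 0" "\<And>z. norm (f z - \<tau> z) \<le> C * (1 + norm z) ^ (d - 1)"
    using top unfolding top_part_def by blast
  define T where "T l1 l2 z = l1 * \<tau> z $ 1 + l2 * \<tau> z $ 2" for l1 l2 z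
  have lT: "line_poly (T l1 l2)" for l1 l2
    unfolding T_def using \<tau>(1) unfolding poly_map2_def
    by (intro line_poly_linear_comb poly_fun2_line_poly) auto
  have hT: "T l1 l2 (c *s z) = c ^ d * T l1 l2 z" for l1 l2 c z
    unfolding T_def \<tau>(2) by (simp add: algebra_simps)
  have dir: "\<exists>u. u \<noteq> 0 \<and> (\<forall>q. T l1 l2 q = 0 \<longrightarrow> cross2 u q = 0)" if "T l1 l2 q' \<noteq> 0" for l1 l2 q'
  proof (rule fibre_unique_direction[OF g fg gf])
    show "l1 \<noteq> 0 \<or> l2 \<noteq> 0" using that unfolding T_def by auto
    show "cmod (l1 * f z $ 1 + l2 * f z $ 2 - T l1 l2 z) \<le> (cmod l1 + cmod l2) * C * (1 + norm z) ^ (d - 1)" for z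
    proof -
      have "l1 * f z $ 1 + l2 * f z $ 2 - T l1 l2 z = l1 * (f z - \<tau> z) $ 1 + l2 * (f z - \<tau> z) $ 2"
        unfolding T_def by (simp add: algebra_simps)
      also have "cmod \<dots> \<le> cmod l1 * norm (f z - \<tau> z) + cmod l2 * norm (f z - \<tau> z)"
        by (intro norm_triangle_mono) (auto simp: norm_mult simp del: vector_minus_component
              intro!: mult_left_mono Finite_Cartesian_Product.norm_nth_le)
      also have "\<dots> = (cmod l1 + cmod l2) * norm (f z - \<tau> z)" by (simp add: algebra_simps)
      also have "\<dots> \<le> (cmod l1 + cmod l2) * (C * (1 + norm z) ^ (d - 1))"
        by (intro mult_left_mono C(2)) auto
      finally show ?thesis by (simp add: mult_ac)
    qed
    show "line_poly (\<lambda>z. l1 * f z $ 1 + l2 * f z $ 2)"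
      using f unfolding poly_map2_def by (intro line_poly_linear_comb poly_fun2_line_poly) auto
  qed (use C(1) d lT hT that in auto)
  have power: "\<exists>u c. u \<noteq> 0 \<and> (\<forall>z. T l1 l2 z = c * cross2 u z ^ d)" for l1 l2
  proof (cases "\<exists>q'. T l1 l2 q' \<noteq> 0")
    case True
    then obtain u where u: "u \<noteq> 0" "\<And>q. T l1 l2 q = 0 \<Longrightarrow> cross2 u q = 0" using dir by blast
    have "\<exists>c. \<forall>z. T l1 l2 z = c * cross2 u z ^ d"
      by (rule form_eq_cross2_power[OF lT hT _ u]) (use d in auto)
    then show ?thesis using u(1) by blast
  next
    case False
    \<comment> \<open>A combination that vanishes identically gets the constant 0 and an arbitrary
      nonzero vector.\<close>
    then show ?thesis by (intro exI[of _ "axis 1 1"] exI[of _ 0]) (auto simp: axis_eq_0_iff)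
  qed
  obtain u1 c1 where 1: "u1 \<noteq> 0" "\<And>z. T 1 0 z = c1 * cross2 u1 z ^ d" using power[of 1 0] by blast
  obtain u2 c2 where 2: "u2 \<noteq> 0" "\<And>z. T 0 1 z = c2 * cross2 u2 z ^ d" using power[of 0 1] by blast
  have \<tau>12: "\<tau> z $ 1 = c1 * cross2 u1 z ^ d" "\<tau> z $ 2 = c2 * cross2 u2 z ^ d" for z
    using 1(2)[of z] 2(2)[of z] unfolding T_def by simp_all
  have form: "\<exists>u v. u \<noteq> 0 \<and> (\<forall>z. \<tau> z = cross2 u z ^ d *s v)"
  proof (cases "c1 = 0 \<or> c2 = 0")
    case True
    then show ?thesis
    proof
      assume "c1 = 0"
      then show ?thesis using 2(1)
        by (intro exI[of _ u2] exI[of _ "vector [0, c2]"]) (simp add: vec2_eq_iff \<tau>12)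
    next
      assume "c2 = 0"
      then show ?thesis using 1(1)
        by (intro exI[of _ u1] exI[of _ "vector [c1, 0]"]) (simp add: vec2_eq_iff \<tau>12)
    qed
  next
    case False
    show ?thesis
    proof (cases "cross2 u1 u2 = 0")
      case True
      then obtain k where k: "u2 = k *s u1" using cross2_eq_0D 1(1) by blast
      have "\<tau> z = cross2 u1 z ^ d *s vector [c1, c2 * k ^ d]" for z
        by (simp add: vec2_eq_iff \<tau>12) (simp add: k cross2_linear power_mult_distrib)
      then show ?thesis using 1(1) by blast
    next
      case indep: False
      \<comment> \<open>A difference \<open>X ^ d - Y ^ d\<close> of two independent forms vanishes in \<open>d > 1\<close> directions.\<close>
      define \<delta> where "\<delta> = cross2 u1 u2"
      \<comment> \<open>\<open>pt x y\<close> is the point at which the two forms take the values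
        \<open>x\<close> and \<open>y\<close>.\<close>
      define pt where "pt x y = (- y / \<delta>) *s u1 + (x / \<delta>) *s u2" for x y
      have sw: "cross2 u2 u1 = - \<delta>" unfolding \<delta>_def cross2_def by simp
      have pt: "cross2 u1 (pt x y) = x" "cross2 u2 (pt x y) = y" for x y
        using indep unfolding pt_def by (simp_all add: cross2_linear sw) (simp_all add: \<delta>_def)
      have Tpt: "T c2 (- c1) (pt x y) = c1 * c2 * (x ^ d - y ^ d)" for x y
        unfolding T_def \<tau>12 pt by (simp add: algebra_simps)
      have "T c2 (- c1) (pt 1 0) \<noteq> 0" unfolding Tpt using False d by (simp add: power_0_left)
      then obtain u where u: "u \<noteq> 0" "\<And>q. T c2 (- c1) q = 0 \<Longrightarrow> cross2 u q = 0" using dir by blast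
      have "card {z :: complex. z ^ d = 1} = d" using d by (intro card_roots_unity_eq) auto
      then have "{z :: complex. z ^ d = 1} \<noteq> {1}" using d by auto
      \<comment> \<open>The points \<open>pt 1 1\<close> and \<open>pt 1 \<omega>\<close> are both
        zeros of the combination, yet they are not proportional.\<close>
      then obtain \<omega> :: complex where \<omega>: "\<omega> ^ d = 1" "\<omega> \<noteq> 1" by force
      have "cross2 u (pt 1 1) = 0" "cross2 u (pt 1 \<omega>) = 0" using \<omega> by (auto intro!: u(2) simp: Tpt)
      then obtain k l where k: "pt 1 1 = k *s u" "pt 1 \<omega> = l *s u" using cross2_eq_0D u(1) by metis
      have "k * cross2 u1 u = 1" "l * cross2 u1 u = 1" "k * cross2 u2 u = 1" "l * cross2 u2 u = \<omega>"
        using pt[of 1 1] pt[of 1 \<omega>] unfolding k by (simp_all add: cross2_linear)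
      then have "k = l" by (metis mult.commute mult.left_commute mult.right_neutral)
      then have False using \<open>k * cross2 u2 u = 1\<close> \<open>l * cross2 u2 u = \<omega>\<close> \<omega>(2) by simp
      then show ?thesis ..
    qed
  qed
  then obtain u v where "u \<noteq> 0" "\<And>z. \<tau> z = cross2 u z ^ d *s v" by blast
  moreover from this have "v \<noteq> 0" using \<tau>(3) by auto
  ultimately show ?thesis by blast
qed

text \<open>The composition is the identity, of degree 1; if \<open>cross2 u v'\<close> were
  nonzero, the leading parts would compose to one of degree \<open>d * e\<close>. Growth is compared
  along the points \<open>n w\<close>, where \<open>cross2 u'\<close> equals
  \<open>n\<close>.\<close>

lemma top_parts_compose_vanish:
  assumes fg: "\<And>z. f (g z) = z" and d: "d \<ge> 2" and e: "e \<ge> 2"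
    and f: "\<And>z. norm (f z - cross2 u z ^ d *s v) \<le> C * (1 + norm z) ^ (d - 1)" "C \<ge> 0"
    and g: "\<And>z. norm (g z - cross2 u' z ^ e *s v') \<le> C' * (1 + norm z) ^ (e - 1)" "C' \<ge> 0"
    and nz: "v \<noteq> 0" "u' \<noteq> 0"
  shows "cross2 u v' = 0"
proof (rule ccontr)
  assume neg: "cross2 u v' \<noteq> 0"
  obtain w where w: "cross2 u' w = 1" using ex_cross2_eq_1[OF nz(2)] by blast
  define W where "W = 1 + norm w"
  have W: "W \<ge> 1" unfolding W_def by simp
  define L where "L = norm v' + C' * W ^ e"
  have L: "L \<ge> 0" unfolding L_def using W g(2) by simp
  define a where "a = cmod (cross2 u v')"
  define b where "b = 2 * norm u * C' * W ^ e"
  have a: "a > 0" unfolding a_def using neg by simp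
  have b0: "b \<ge> 0" unfolding b_def using g(2) W by simp
  define y where "y n = g (of_nat n *s w)" for n :: nat
  have yest: "norm (y n - of_nat n ^ e *s v') \<le> C' * W ^ e * real n ^ (e - 1)" if "n \<ge> 1" for n
  proof -
    have "norm (y n - of_nat n ^ e *s v') \<le> C' * (1 + norm (of_nat n *s w)) ^ (e - 1)"
      using g(1)[of "of_nat n *s w"] unfolding y_def by (simp add: cross2_linear w)
    also have "\<dots> \<le> C' * (real n * W) ^ (e - 1)"
      using g(2) that unfolding norm_vector_scalar norm_of_nat W_def
      by (intro mult_left_mono power_mono) (auto simp: distrib_left)
    also have "\<dots> = C' * W ^ (e - 1) * real n ^ (e - 1)" by (simp add: power_mult_distrib)
    also have "\<dots> \<le> C' * W ^ e * real n ^ (e - 1)"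
      using g(2) W by (intro mult_right_mono mult_left_mono power_increasing) auto
    finally show ?thesis .
  qed
  have ynorm: "norm (y n) \<le> L * real n ^ e" if "n \<ge> 1" for n
  proof -
    have "norm (y n) \<le> norm (of_nat n ^ e *s v') + norm (y n - of_nat n ^ e *s v')"
      by (rule norm_triangle_sub)
    also have "\<dots> \<le> norm v' * real n ^ e + C' * W ^ e * real n ^ e"
    proof (intro add_mono order_trans[OF yest[OF that]] mult_left_mono power_increasing)
      show "norm (of_nat n ^ e *s v') \<le> norm v' * real n ^ e"
        by (simp add: norm_vector_scalar norm_power)
    qed (use that g(2) W in auto)
    finally show ?thesis unfolding L_def by (simp add: algebra_simps)
  qed
  have low: "real n ^ (e - 1) * (a * real n - b) \<le> cmod (cross2 u (y n))" if "n \<ge> 1" for n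
  proof -
    have "cross2 u (y n) = of_nat n ^ e * cross2 u v' + cross2 u (y n - of_nat n ^ e *s v')"
      by (simp add: cross2_linear)
    then have "cmod (of_nat n ^ e * cross2 u v') \<le> cmod (cross2 u (y n)) + cmod (cross2 u (y n - of_nat n ^ e *s v'))"
      by (metis add_diff_cancel_right' norm_triangle_ineq4)
    moreover have "cmod (of_nat n ^ e * cross2 u v') = real n ^ (e - 1) * (a * real n)"
      unfolding a_def using e by (cases e) (simp_all add: norm_mult norm_power mult_ac)
    moreover have "cmod (cross2 u (y n - of_nat n ^ e *s v')) \<le> real n ^ (e - 1) * b"
    proof -
      have "cmod (cross2 u (y n - of_nat n ^ e *s v')) \<le> 2 * norm u * (C' * W ^ e * real n ^ (e - 1))"
        by (intro order_trans[OF norm_cross2_le] mult_left_mono yest that) auto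
      then show ?thesis unfolding b_def by (simp add: mult_ac)
    qed
    ultimately show ?thesis by (simp add: algebra_simps)
  qed
  define K where "K = norm w + C * (1 + L) ^ (d - 1)"
  have K: "K \<ge> 0" unfolding K_def using f(2) L by simp
  \<comment> \<open>At \<open>y n\<close> the map \<open>f\<close> has only the value
    \<open>n w\<close>, so its leading term must be compensated by the remainder, of order
    \<open>n ^ (e * (d - 1))\<close>.\<close>
  have up: "cmod (cross2 u (y n)) ^ d * norm v \<le> K * real n ^ (e * (d - 1))" if "n \<ge> 1" for n
  proof -
    have "cmod (cross2 u (y n)) ^ d * norm v = norm (cross2 u (y n) ^ d *s v)"
      by (simp add: norm_vector_scalar norm_power)
    also have "\<dots> \<le> norm (f (y n)) + norm (f (y n) - cross2 u (y n) ^ d *s v)"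
      by (metis norm_minus_commute norm_triangle_sub)
    also have "\<dots> \<le> real n * norm w + C * (1 + norm (y n)) ^ (d - 1)"
      using f(1)[of "y n"] unfolding y_def fg by (simp add: norm_vector_scalar)
    also have "\<dots> \<le> real n ^ (e * (d - 1)) * norm w + C * ((1 + L) * real n ^ e) ^ (d - 1)"
    proof (intro add_mono mult_right_mono mult_left_mono power_mono)
      have "1 \<le> e * (d - 1)" using e d by simp
      then show "real n \<le> real n ^ (e * (d - 1))"
        using that power_increasing[of 1 "e * (d - 1)" "real n"] by simp
      have "1 \<le> real n ^ e" using that by simp
      then show "1 + norm (y n) \<le> (1 + L) * real n ^ e" using ynorm[OF that] by (simp add: distrib_right)
    qed (use f(2) in auto)
    also have "\<dots> = K * real n ^ (e * (d - 1))"
      unfolding K_def power_mult_distrib power_mult by (simp only: distrib_left distrib_right mult_ac)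
    finally show ?thesis .
  qed
  define c where "c = (a / 2) ^ d * norm v"
  have c: "c > 0" unfolding c_def using a nz(1) by simp
  \<comment> \<open>The threshold \<open>2 * b / a\<close> absorbs the error into half of the main
    term; \<open>K / c\<close> contradicts the final comparison.\<close>
  obtain n :: nat where n: "real n > max (max 1 (2 * b / a)) (K / c)" using reals_Archimedean2 by blast
  then have n1: "n \<ge> 1" "a * real n \<ge> 2 * b" "c * real n > K" using a c by (auto simp: field_simps)
  have "real n ^ e * (a / 2) = real n ^ (e - 1) * (a * real n / 2)" using e by (cases e) simp_all
  also have "\<dots> \<le> real n ^ (e - 1) * (a * real n - b)" using n1 by (intro mult_left_mono) auto
  also have "\<dots> \<le> cmod (cross2 u (y n))" by (rule low[OF n1(1)])
  finally have "(real n ^ e * (a / 2)) ^ d * norm v \<le> cmod (cross2 u (y n)) ^ d * norm v"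
    using a by (intro mult_right_mono power_mono) auto
  also have "\<dots> \<le> K * real n ^ (e * (d - 1))" by (rule up[OF n1(1)])
  finally have "(real n ^ e * (a / 2)) ^ d * norm v \<le> K * real n ^ (e * (d - 1))" .
  moreover have "(real n ^ e * (a / 2)) ^ d * norm v = c * real n ^ (e * d)"
    unfolding c_def power_mult_distrib power_mult by (simp only: mult_ac)
  ultimately have "c * real n ^ (e * d) \<le> K * real n ^ (e * (d - 1))" by simp
  moreover have "real n ^ (e * d) = real n ^ (e * (d - 1)) * real n ^ e"
    using d by (simp add: power_add[symmetric] algebra_simps)
  ultimately have "real n ^ (e * (d - 1)) * (c * real n ^ e) \<le> real n ^ (e * (d - 1)) * K"
    by (simp add: mult_ac)
  then have "c * real n ^ e \<le> K" using n1(1) by (simp add: mult_le_cancel_left)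
  moreover have "c * real n ^ 1 \<le> c * real n ^ e" using n1(1) e c by (intro mult_left_mono power_increasing) auto
  ultimately show False using n1(3) by simp
qed

section \<open>The escape region of a regular automorphism\<close>

text \<open>The threshold \<open>2 * C / c\<close> leaves at least half of the leading term,
  \<open>4 / c\<close> gives doubling, and 1 makes powers increase with the exponent.\<close>

lemma power_dominates:
  fixes c C :: real
  assumes "c > 0" "d \<ge> 2"
  shows "\<exists>\<rho>\<ge>1. \<forall>x\<ge>\<rho>. C * x ^ (d - 1) \<le> c / 2 * x ^ d \<and> c / 2 * x\<^sup>2 \<le> c / 2 * x ^ d \<and> 2 * x \<le> c / 2 * x\<^sup>2"
proof (intro exI conjI allI impI)
  let ?\<rho> = "max 1 (max (2 * C / c) (4 / c))"
  show "?\<rho> \<ge> 1" by simp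
  fix x assume "x \<ge> ?\<rho>"
  then have x: "x \<ge> 1" "2 * C \<le> c * x" "4 \<le> c * x" using assms(1) by (auto simp: field_simps)
  have "C * x ^ (d - 1) \<le> (c / 2 * x) * x ^ (d - 1)" using x by (intro mult_right_mono) auto
  also have "\<dots> = c / 2 * x ^ d" using assms(2) by (cases d) simp_all
  finally show "C * x ^ (d - 1) \<le> c / 2 * x ^ d" .
  show "c / 2 * x\<^sup>2 \<le> c / 2 * x ^ d" using assms x by (intro mult_left_mono power_increasing) auto
  have "4 * x \<le> c * x * x" using x by (intro mult_right_mono) auto
  then show "2 * x \<le> c / 2 * x\<^sup>2" by (simp add: power2_eq_square)
qed

text \<open>The filtration of a Henon map: \<open>F\<close> expands \<open>\<xi>\<close> where
  \<open>\<xi>\<close> dominates, and its inverse expands \<open>\<eta>\<close> where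
  \<open>\<eta>\<close> dominates. Both follow from the leading parts, which point along
  \<open>v\<close> and \<open>v2\<close>.\<close>

lemma escape_region:
  fixes F f g :: "complex^2 \<Rightarrow> complex^2" and A :: "complex^2^2" and b :: "complex^2"
  assumes F: "\<And>z. F z = f (A *v z + b)"
    and gf: "\<And>z. g (f z) = z" and d: "d \<ge> 2" and e: "e \<ge> 2"
    and f: "\<And>z. norm (f z - cross2 u z ^ d *s v) \<le> C * (1 + norm z) ^ (d - 1)" "C \<ge> 0"
    and g: "\<And>z. norm (g z - cross2 u' z ^ e *s v') \<le> C' * (1 + norm z) ^ (e - 1)" "C' \<ge> 0"
    and nz: "v \<noteq> 0" "v' \<noteq> 0" "u' \<noteq> 0" and orth: "cross2 u v' = 0" "cross2 u' v = 0"
    and A: "invertible A" and reg: "cross2 u (A *v v) \<noteq> 0"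
  obtains \<xi> \<alpha> \<beta> \<rho> \<kappa> B G where "\<And>z. \<xi> z = \<alpha> * z $ 1 + \<beta> * z $ 2" "\<xi> v = 1"
    "\<And>t. t *s v \<in> G" "\<And>z. z \<in> G \<Longrightarrow> F z \<in> G" "\<rho> > 0" "\<kappa> > 0"
    "\<And>z. z \<in> G \<Longrightarrow> \<rho> \<le> cmod (\<xi> z) \<Longrightarrow> \<kappa> * (cmod (\<xi> z))\<^sup>2 \<le> cmod (\<xi> (F z))"
    "\<And>z. z \<in> G \<Longrightarrow> \<rho> \<le> cmod (\<xi> z) \<Longrightarrow> 2 * cmod (\<xi> z) \<le> cmod (\<xi> (F z))"
    "\<And>z. z \<in> G \<Longrightarrow> cmod (\<xi> z) < 2 * \<rho> \<Longrightarrow> norm z \<le> B"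
proof -
  obtain Ai where Ai: "A ** Ai = mat 1" "Ai ** A = mat 1" using A unfolding invertible_def by blast
  have AAi: "A *v (Ai *v z) = z" "Ai *v (A *v z) = z" for z
    by (simp_all add: matrix_vector_mul_assoc Ai)
  define a where "a = cross2 u (A *v v)"
  have a: "a \<noteq> 0" using reg unfolding a_def .
  define \<xi> where "\<xi> z = cross2 u (A *v z) / a" for z
  define \<eta> where "\<eta> z = cross2 v z" for z
  have \<xi>_eq: "\<xi> z = (u $ 1 * A $ 2 $ 1 - u $ 2 * A $ 1 $ 1) / a * z $ 1 + (u $ 1 * A $ 2 $ 2 - u $ 2 * A $ 1 $ 2) / a * z $ 2" for z
    unfolding \<xi>_def cross2_def matrix_vector_mult_def by (simp add: sum_2 add_divide_distrib diff_divide_distrib algebra_simps)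
  have \<xi>_lin: "\<xi> (x + y) = \<xi> x + \<xi> y" "\<xi> (c *s x) = c * \<xi> x" for x y c
    unfolding \<xi>_def by (simp_all add: matrix_vector_right_distrib vector_scalar_commute cross2_linear add_divide_distrib)
  have \<xi>v: "\<xi> v = 1" unfolding \<xi>_def using a by (simp add: a_def)
  \<comment> \<open>The leading part of the inverse of \<open>F\<close> points along
    \<open>v2\<close>, on which \<open>\<xi>\<close> vanishes because
    \<open>cross2 u v' = 0\<close>. As \<open>\<xi> v = 1\<close>, the vectors \<open>v\<close> and
    \<open>v2\<close> form a basis.\<close>
  define v2 where "v2 = Ai *v v'"
  have \<xi>v2: "\<xi> v2 = 0" unfolding \<xi>_def v2_def AAi by (simp add: orth)
  have \<eta>v2: "\<eta> v2 \<noteq> 0"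
  proof
    assume "\<eta> v2 = 0"
    then obtain k where k: "v2 = k *s v" unfolding \<eta>_def using cross2_eq_0D nz(1) by blast
    then have "k = 0" using \<xi>v2 by (simp add: \<xi>_lin \<xi>v)
    then have "v2 = 0" using k by simp
    then have "v' = 0" using AAi(1)[of v'] unfolding v2_def by simp
    then show False using nz(2) by simp
  qed
  have decomp: "z = \<xi> z *s v + (\<eta> z / \<eta> v2) *s v2" for z
  proof -
    have z: "z = (cross2 z v2 / \<eta> v2) *s v + (\<eta> z / \<eta> v2) *s v2"
      using cross2_Cramer[of v v2 z] \<eta>v2 unfolding \<eta>_def by blast
    then have "\<xi> z = \<xi> ((cross2 z v2 / \<eta> v2) *s v + (\<eta> z / \<eta> v2) *s v2)" by (rule arg_cong)
    also have "\<dots> = cross2 z v2 / \<eta> v2" unfolding \<xi>_lin \<xi>v \<xi>v2 by simp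
    finally show ?thesis using z by simp
  qed
  define K where "K = norm v + norm v2 / cmod (\<eta> v2)"
  have K: "K \<ge> 0" unfolding K_def by simp
  have zK: "norm z \<le> K * (cmod (\<xi> z) + cmod (\<eta> z))" for z
  proof -
    have "norm z \<le> norm (\<xi> z *s v) + norm ((\<eta> z / \<eta> v2) *s v2)"
      using norm_triangle_ineq decomp by metis
    also have "\<dots> = norm v * cmod (\<xi> z) + norm v2 / cmod (\<eta> v2) * cmod (\<eta> z)"
      by (simp add: norm_vector_scalar norm_divide)
    also have "\<dots> \<le> K * cmod (\<xi> z) + K * cmod (\<eta> z)"
      unfolding K_def by (intro add_mono mult_right_mono) auto
    finally show ?thesis by (simp add: distrib_left)
  qed
  define W where "W = 1 + 2 * K"
  have W: "W \<ge> 1" unfolding W_def using K by simp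
  have zW: "1 + norm z \<le> W * x" if "x \<ge> 1" "cmod (\<xi> z) \<le> x" "cmod (\<eta> z) \<le> x" for z x
  proof -
    have "K * (cmod (\<xi> z) + cmod (\<eta> z)) \<le> K * (x + x)" using that K by (intro mult_left_mono) auto
    then show ?thesis unfolding W_def using zK[of z] that(1) by (simp add: algebra_simps)
  qed
  obtain WA where WA: "WA > 0" "\<And>z. norm (A *v z) \<le> norm z * WA"
    using bounded_linear.pos_bounded[OF matrix_vector_mul_bounded_linear[of A]] by blast
  obtain WI where WI: "WI > 0" "\<And>z. norm (Ai *v z) \<le> norm z * WI"
    using bounded_linear.pos_bounded[OF matrix_vector_mul_bounded_linear[of Ai]] by blast
  define L where "L = max (2 * norm u * WA / cmod a) (2 * norm v)"
  have L: "L \<ge> 0" unfolding L_def by (simp add: le_max_iff_disj)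
  have \<xi>L: "cmod (\<xi> z) \<le> L * norm z" for z
  proof -
    have "cmod (\<xi> z) \<le> 2 * norm u * (norm z * WA) / cmod a"
      unfolding \<xi>_def norm_divide
      by (intro divide_right_mono order_trans[OF norm_cross2_le] mult_left_mono WA(2)) auto
    also have "\<dots> = 2 * norm u * WA / cmod a * norm z" by simp
    also have "\<dots> \<le> L * norm z" unfolding L_def by (intro mult_right_mono) auto
    finally show ?thesis .
  qed
  have \<eta>L: "cmod (\<eta> z) \<le> L * norm z" for z
    unfolding \<eta>_def by (rule order_trans[OF norm_cross2_le]) (auto simp: L_def intro!: mult_right_mono)
  define V where "V = 1 + norm b + WA"
  have V: "V \<ge> 1" unfolding V_def using WA(1) by simp
  have Fest: "cmod (\<xi> (F z) - (a * \<xi> z + cross2 u b) ^ d) \<le> L * C * V ^ (d - 1) * (1 + norm z) ^ (d - 1)" for z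
  proof -
    have Az: "cross2 u (A *v z + b) = a * \<xi> z + cross2 u b"
      unfolding \<xi>_def using a by (simp add: cross2_linear)
    have "1 + norm (A *v z + b) \<le> 1 + (norm z * WA + norm b)"
      using norm_triangle_ineq[of "A *v z" b] WA(2)[of z] by linarith
    also have "\<dots> \<le> V * (1 + norm z)"
      unfolding V_def using WA(1) by (simp add: algebra_simps)
    finally have "(1 + norm (A *v z + b)) ^ (d - 1) \<le> (V * (1 + norm z)) ^ (d - 1)"
      by (intro power_mono) auto
    then have "norm (F z - (a * \<xi> z + cross2 u b) ^ d *s v) \<le> C * (V * (1 + norm z)) ^ (d - 1)"
      using f(1)[of "A *v z + b"] f(2) mult_left_mono unfolding F Az by (meson order_trans)
    then have "L * norm (F z - (a * \<xi> z + cross2 u b) ^ d *s v) \<le> L * (C * (V * (1 + norm z)) ^ (d - 1))"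
      using L by (intro mult_left_mono) auto
    moreover have "\<xi> (F z) - (a * \<xi> z + cross2 u b) ^ d = \<xi> (F z - (a * \<xi> z + cross2 u b) ^ d *s v)"
      using \<xi>_lin(1)[of "F z - (a * \<xi> z + cross2 u b) ^ d *s v" "(a * \<xi> z + cross2 u b) ^ d *s v"]
      by (simp add: \<xi>_lin(2) \<xi>v)
    ultimately show ?thesis
      using \<xi>L[of "F z - (a * \<xi> z + cross2 u b) ^ d *s v"] by (simp add: power_mult_distrib mult_ac)
  qed
  define Fi where "Fi z = Ai *v (g z - b)" for z
  have FiF: "Fi (F z) = z" for z unfolding Fi_def F gf by (simp add: AAi)
  \<comment> \<open>Orthogonality makes \<open>u'\<close> proportional to \<open>v\<close>, so the
    leading form of \<open>g\<close> is a power of a multiple of \<open>\<eta>\<close>.\<close>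
  have "cross2 v u' = 0" using orth(2) unfolding cross2_def by (simp add: algebra_simps)
  then obtain k where k: "u' = k *s v" using cross2_eq_0D nz(1) by blast
  have k0: "k \<noteq> 0" using k nz(3) by auto
  define C2 where "C2 = L * (WI * C' + norm (Ai *v b))"
  have C2: "C2 \<ge> 0" unfolding C2_def using L WI(1) g(2) by simp
  have Fiest: "L * norm (Fi z - (k * \<eta> z) ^ e *s v2) \<le> C2 * (1 + norm z) ^ (e - 1)" for z
  proof -
    have "Fi z - (k * \<eta> z) ^ e *s v2 = Ai *v (g z - (k * \<eta> z) ^ e *s v') - Ai *v b"
      unfolding Fi_def v2_def by (simp add: matrix_vector_mult_diff_distrib vector_scalar_commute)
    also have "norm \<dots> \<le> norm (g z - (k * \<eta> z) ^ e *s v') * WI + norm (Ai *v b)"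
      by (intro order_trans[OF norm_triangle_ineq4] add_mono WI(2)) auto
    also have "\<dots> \<le> C' * (1 + norm z) ^ (e - 1) * WI + norm (Ai *v b) * (1 + norm z) ^ (e - 1)"
    proof (intro add_mono mult_right_mono)
      show "norm (g z - (k * \<eta> z) ^ e *s v') \<le> C' * (1 + norm z) ^ (e - 1)"
        using g(1)[of z] unfolding k \<eta>_def by (simp add: cross2_linear)
      have "1 \<le> (1 + norm z) ^ (e - 1)" by (intro one_le_power) auto
      then show "norm (Ai *v b) \<le> norm (Ai *v b) * (1 + norm z) ^ (e - 1)"
        using mult_left_mono[of 1 _ "norm (Ai *v b)"] by simp
    qed (use WI(1) in auto)
    finally have "norm (Fi z - (k * \<eta> z) ^ e *s v2) \<le> (WI * C' + norm (Ai *v b)) * (1 + norm z) ^ (e - 1)"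
      by (simp add: algebra_simps)
    then show ?thesis unfolding C2_def mult.assoc using L by (rule mult_left_mono)
  qed
  have Fi\<eta>: "cmod (\<eta> (Fi z) - (k * \<eta> z) ^ e * \<eta> v2) \<le> C2 * (1 + norm z) ^ (e - 1)" for z
  proof -
    have "\<eta> (Fi z) - (k * \<eta> z) ^ e * \<eta> v2 = \<eta> (Fi z - (k * \<eta> z) ^ e *s v2)"
      unfolding \<eta>_def by (simp add: cross2_linear)
    then show ?thesis using \<eta>L[of "Fi z - (k * \<eta> z) ^ e *s v2"] Fiest[of z] by simp
  qed
  have Fi\<xi>: "cmod (\<xi> (Fi z)) \<le> C2 * (1 + norm z) ^ (e - 1)" for z
  proof -
    have "\<xi> (Fi z) = \<xi> (Fi z - (k * \<eta> z) ^ e *s v2)"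
      using \<xi>_lin(1)[of "Fi z - (k * \<eta> z) ^ e *s v2" "(k * \<eta> z) ^ e *s v2"] by (simp add: \<xi>_lin(2) \<xi>v2)
    then show ?thesis using \<xi>L[of "Fi z - (k * \<eta> z) ^ e *s v2"] Fiest[of z] by simp
  qed
  define c where "c = (cmod a / 2) ^ d"
  have c: "c > 0" unfolding c_def using a by simp
  obtain \<rho>1 where \<rho>1: "\<rho>1 \<ge> 1" "\<And>x. x \<ge> \<rho>1 \<Longrightarrow> L * C * V ^ (d - 1) * W ^ (d - 1) * x ^ (d - 1) \<le> c / 2 * x ^ d \<and>
      c / 2 * x\<^sup>2 \<le> c / 2 * x ^ d \<and> 2 * x \<le> c / 2 * x\<^sup>2"
    using power_dominates[OF c d, of "L * C * V ^ (d - 1) * W ^ (d - 1)"] by blast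
  define c' where "c' = cmod k ^ e * cmod (\<eta> v2)"
  have c': "c' > 0" unfolding c'_def using k0 \<eta>v2 by simp
  obtain \<rho>2 where \<rho>2: "\<rho>2 \<ge> 1" "\<And>x. x \<ge> \<rho>2 \<Longrightarrow> C2 * W ^ (e - 1) * x ^ (e - 1) \<le> c' / 2 * x ^ e \<and>
      c' / 2 * x\<^sup>2 \<le> c' / 2 * x ^ e \<and> 2 * x \<le> c' / 2 * x\<^sup>2"
    using power_dominates[OF c' e, of "C2 * W ^ (e - 1)"] by blast
  \<comment> \<open>The last entry makes the contribution of the translation \<open>b\<close> at
    most half of the linear term.\<close>
  define \<rho> where "\<rho> = max (max \<rho>1 \<rho>2) (2 * cmod (cross2 u b) / cmod a)"
  have \<rho>: "\<rho> \<ge> \<rho>1" "\<rho> \<ge> \<rho>2" "\<rho> \<ge> 1" "2 * cmod (cross2 u b) \<le> cmod a * \<rho>"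
  proof -
    have "2 * cmod (cross2 u b) / cmod a \<le> \<rho>" unfolding \<rho>_def by simp
    then show "2 * cmod (cross2 u b) \<le> cmod a * \<rho>" using a by (simp add: field_simps)
  qed (use \<rho>1(1) in \<open>auto simp: \<rho>_def\<close>)
  \<comment> \<open>The complement of the region dominated by large \<open>\<eta>\<close>. In
    \<open>G\<close>, a value \<open>cmod (\<xi> z) \<ge> \<rho>\<close> forces \<open>\<xi>\<close>
    to dominate \<open>\<eta>\<close>.\<close>
  define G where "G = {z. \<not> (\<rho> \<le> cmod (\<eta> z) \<and> cmod (\<xi> z) \<le> cmod (\<eta> z))}"
  have grow: "c / 2 * (cmod (\<xi> z))\<^sup>2 \<le> cmod (\<xi> (F z))" "2 * cmod (\<xi> z) \<le> c / 2 * (cmod (\<xi> z))\<^sup>2"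
    if "z \<in> G" "\<rho> \<le> cmod (\<xi> z)" for z
  proof -
    define x where "x = cmod (\<xi> z)"
    have x: "x \<ge> \<rho>" "x \<ge> 1" "cmod (\<eta> z) \<le> x" using that \<rho>(3) unfolding x_def G_def by auto
    have dom: "L * C * V ^ (d - 1) * W ^ (d - 1) * x ^ (d - 1) \<le> c / 2 * x ^ d"
      "c / 2 * x\<^sup>2 \<le> c / 2 * x ^ d" "2 * x \<le> c / 2 * x\<^sup>2"
      using \<rho>1(2)[of x] x(1) \<rho>(1) by auto
    show "2 * cmod (\<xi> z) \<le> c / 2 * (cmod (\<xi> z))\<^sup>2" using dom(3) unfolding x_def .
    have "cmod a * \<rho> \<le> cmod a * x" using x by (intro mult_left_mono) auto
    then have "cmod a / 2 * x \<le> cmod (a * \<xi> z) - cmod (cross2 u b)"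
      using \<rho>(4) unfolding norm_mult x_def by (simp add: algebra_simps)
    also have "\<dots> \<le> cmod (a * \<xi> z + cross2 u b)" by (rule norm_diff_ineq)
    finally have "(cmod a / 2 * x) ^ d \<le> cmod (a * \<xi> z + cross2 u b) ^ d" using x by (intro power_mono) auto
    then have "c * x ^ d \<le> cmod ((a * \<xi> z + cross2 u b) ^ d)"
      unfolding c_def by (simp only: power_mult_distrib norm_power)
    moreover have "cmod ((a * \<xi> z + cross2 u b) ^ d) \<le> cmod (\<xi> (F z)) + cmod (\<xi> (F z) - (a * \<xi> z + cross2 u b) ^ d)"
      by (metis norm_minus_commute norm_triangle_sub)
    moreover have "(1 + norm z) ^ (d - 1) \<le> (W * x) ^ (d - 1)"
      using x by (intro power_mono zW) (auto simp: x_def)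
    then have "L * C * V ^ (d - 1) * (1 + norm z) ^ (d - 1) \<le> L * C * V ^ (d - 1) * (W * x) ^ (d - 1)"
      using L f(2) V by (intro mult_left_mono) auto
    ultimately have "c * x ^ d \<le> cmod (\<xi> (F z)) + L * C * V ^ (d - 1) * W ^ (d - 1) * x ^ (d - 1)"
      using Fest[of z] by (simp add: power_mult_distrib mult_ac)
    then show "c / 2 * (cmod (\<xi> z))\<^sup>2 \<le> cmod (\<xi> (F z))" using dom(1,2) unfolding x_def by simp
  qed
  \<comment> \<open>Forward invariance of \<open>G\<close> is backward invariance of its complement,
    where the inverse of \<open>F\<close> enlarges \<open>\<eta>\<close> and keeps it
    dominant.\<close>
  have inv: "F z \<in> G" if "z \<in> G" for z
  proof (rule ccontr)
    assume "F z \<notin> G"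
    define w where "w = F z"
    define y where "y = cmod (\<eta> w)"
    have y: "y \<ge> \<rho>" "y \<ge> 1" "cmod (\<xi> w) \<le> y" using \<open>F z \<notin> G\<close> \<rho>(3) unfolding y_def w_def G_def by auto
    have dom: "C2 * W ^ (e - 1) * y ^ (e - 1) \<le> c' / 2 * y ^ e" "2 * y \<le> c' / 2 * y ^ e"
      using \<rho>2(2)[of y] y(1) \<rho>(2) by auto
    have "(1 + norm w) ^ (e - 1) \<le> (W * y) ^ (e - 1)"
      using y by (intro power_mono zW) (auto simp: y_def)
    then have "C2 * (1 + norm w) ^ (e - 1) \<le> C2 * (W * y) ^ (e - 1)" using C2 by (rule mult_left_mono)
    then have C2w: "C2 * (1 + norm w) ^ (e - 1) \<le> c' / 2 * y ^ e" using dom(1) by (simp add: power_mult_distrib)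
    have "c' * y ^ e = cmod ((k * \<eta> w) ^ e * \<eta> v2)"
      unfolding c'_def y_def by (simp add: norm_mult norm_power power_mult_distrib mult_ac)
    also have "\<dots> \<le> cmod (\<eta> (Fi w)) + cmod (\<eta> (Fi w) - (k * \<eta> w) ^ e * \<eta> v2)"
      by (metis norm_minus_commute norm_triangle_sub)
    finally have "c' / 2 * y ^ e \<le> cmod (\<eta> (Fi w))" using Fi\<eta>[of w] C2w by simp
    moreover have "cmod (\<xi> (Fi w)) \<le> c' / 2 * y ^ e" using Fi\<xi>[of w] C2w by linarith
    ultimately have "\<rho> \<le> cmod (\<eta> (Fi w))" "cmod (\<xi> (Fi w)) \<le> cmod (\<eta> (Fi w))" using dom(2) y(1) \<rho>(3) by auto
    then show False using that unfolding w_def FiF G_def by simp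
  qed
  have bnd: "norm z \<le> K * (4 * \<rho>)" if "z \<in> G" "cmod (\<xi> z) < 2 * \<rho>" for z
  proof -
    have "cmod (\<eta> z) \<le> 2 * \<rho>" using that \<rho>(3) unfolding G_def by auto
    then have "K * (cmod (\<xi> z) + cmod (\<eta> z)) \<le> K * (4 * \<rho>)" using that K by (intro mult_left_mono) auto
    then show ?thesis using zK[of z] by linarith
  qed
  show thesis
  proof (rule that[OF \<xi>_eq \<xi>v _ inv])
    show "t *s v \<in> G" for t using \<rho>(3) unfolding G_def \<eta>_def by (simp add: cross2_linear)
    show "\<rho> > 0" "c / 2 > 0" using \<rho>(3) c by auto
    show "2 * cmod (\<xi> z) \<le> cmod (\<xi> (F z))" if "z \<in> G" "\<rho> \<le> cmod (\<xi> z)" for z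
      using grow[OF that] by linarith
  qed (use grow(1) bnd in auto)
qed

section \<open>Iterates on a line, regular values and the conclusion\<close>

lemma poly_map2_continuous_on:
  assumes "poly_map2 f"
  shows "continuous_on S f"
proof -
  have "continuous_on S (\<lambda>z. f z $ k)" for k
  proof -
    have "poly_fun2 (\<lambda>z. f z $ k)" using assms unfolding poly_map2_def by blast
    then obtain d and c :: "nat \<Rightarrow> nat \<Rightarrow> complex"
      where "\<And>z. f z $ k = (\<Sum>i\<le>d. \<Sum>j\<le>d. c i j * (z $ 1) ^ i * (z $ 2) ^ j)"
      unfolding poly_fun2_def by blast
    then show ?thesis by (simp add: continuous_intros)
  qed
  then have "continuous_on S (\<lambda>z. \<chi> k. f z $ k)" by (rule continuous_on_vec_lambda)
  then show ?thesis by simp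
qed

lemma poly_map2_iterate_on_line:
  fixes A :: "complex^2^2"
  assumes "poly_map2 f"
  shows "\<exists>p q. \<forall>t. ((\<lambda>z. f (A *v z + b)) ^^ n) (t *s v) = vector [poly p t, poly q t]"
proof (induction n)
  case 0
  have "t *s v = vector [poly [:0, v $ 1:] t, poly [:0, v $ 2:] t]" for t by (simp add: vec2_eq_iff)
  then show ?case unfolding funpow_0 by blast
next
  case (Suc n)
  then obtain p q where pq: "\<And>t. ((\<lambda>z. f (A *v z + b)) ^^ n) (t *s v) = vector [poly p t, poly q t]" by blast
  define p' where "p' = smult (A $ 1 $ 1) p + smult (A $ 1 $ 2) q + [:b $ 1:]"
  define q' where "q' = smult (A $ 2 $ 1) p + smult (A $ 2 $ 2) q + [:b $ 2:]"
  have "A *v vector [poly p t, poly q t] + b = vector [poly p' t, poly q' t]" for t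
    by (simp add: vec2_eq_iff matrix_vector_mult_def sum_2 p'_def q'_def)
  then have step: "((\<lambda>z. f (A *v z + b)) ^^ Suc n) (t *s v) = f (vector [poly p' t, poly q' t])" for t
    by (simp add: pq)
  obtain r where r: "\<And>t. f (vector [poly p' t, poly q' t]) $ 1 = poly r t"
    using poly_fun2_on_curve[of "\<lambda>z. f z $ 1"] assms unfolding poly_map2_def by blast
  obtain s where s: "\<And>t. f (vector [poly p' t, poly q' t]) $ 2 = poly s t"
    using poly_fun2_on_curve[of "\<lambda>z. f z $ 2"] assms unfolding poly_map2_def by blast
  have "((\<lambda>z. f (A *v z + b)) ^^ Suc n) (t *s v) = vector [poly r t, poly s t]" for t
    unfolding step by (simp add: vec2_eq_iff r s)
  then show ?case by blast
qed

text \<open>The exceptional set consists of points, so infinitely many images are needed, not just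
  parameters. On a small disc of regular points, a finite image would make \<open>f\<close> constant
  by connectedness.\<close>

lemma holomorphic_nonconst_regular_values_infinite:
  fixes f :: "complex \<Rightarrow> complex"
  assumes f: "f holomorphic_on ball a r" and nc: "\<not> f constant_on ball a r"
  shows "infinite (f ` {w \<in> ball a r. deriv f w \<noteq> 0})"
proof
  let ?U = "{w \<in> ball a r. deriv f w \<noteq> 0}"
  assume fin: "finite (f ` ?U)"
  have der: "(f has_field_derivative deriv f w) (at w)" if "w \<in> ball a r" for w
    using holomorphic_derivI[OF f open_ball that] .
  have "\<exists>w0\<in>ball a r. deriv f w0 \<noteq> 0"
  proof (rule ccontr)
    assume "\<not> ?thesis"
    then have "(f has_field_derivative 0) (at w within ball a r)" if "w \<in> ball a r" for w
      using der[OF that] that by (simp add: has_field_derivative_at_within)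
    then have "\<exists>c. \<forall>w\<in>ball a r. f w = c" by (intro has_field_derivative_zero_constant) auto
    then show False using nc unfolding constant_on_def by blast
  qed
  then obtain w0 where w0: "w0 \<in> ?U" by blast
  have "continuous_on (ball a r) (deriv f)"
    by (intro holomorphic_on_imp_continuous_on holomorphic_deriv f open_ball)
  then have "open (ball a r \<inter> deriv f -` (- {0}))"
    by (intro continuous_open_preimage) auto
  moreover have "?U = ball a r \<inter> deriv f -` (- {0})" by auto
  ultimately obtain e where e: "e > 0" "ball w0 e \<subseteq> ?U"
    using w0 open_contains_ball by metis
  have "f constant_on ball w0 e"
  proof (rule continuous_finite_range_constant)
    show "continuous_on (ball w0 e) f"
      by (rule continuous_on_subset[OF holomorphic_on_imp_continuous_on[OF f]]) (use e(2) in auto)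
    show "finite (f ` ball w0 e)" using finite_subset[OF image_mono[OF e(2)] fin] .
  qed simp
  then obtain c where c: "\<And>w. w \<in> ball w0 e \<Longrightarrow> f w = c" unfolding constant_on_def by blast
  have "((\<lambda>_. c) has_field_derivative deriv f w0) (at w0)"
  proof (rule has_field_derivative_transform_within_open[OF der])
    show "w0 \<in> ball a r" "w0 \<in> ball w0 e" using w0 e by auto
  qed (use c in auto)
  then have "deriv f w0 = 0" using DERIV_const DERIV_unique by blast
  then show False using w0 by simp
qed

theorem theorem1p3:
  fixes V :: "(complex^2 \<Rightarrow> complex) set"
    and T :: "(complex^2 \<Rightarrow> complex) topology"
    and f :: "complex^2 \<Rightarrow> complex^2"
  assumes "V \<subseteq> hol2"
    and "quasi_banach V T"
    and "continuous_map T hol2_topology (\<lambda>h. h)"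
    and "finite {p. \<not> infinite {n. kappa_injective V n p}}"
    and "cmat.span (G2 V T) = UNIV"
    and "poly_automorphism2 f"
    and "bounded_comp V T f"
  shows "\<exists>(A :: complex^2^2) b. invertible A \<and> (\<forall>z. f z = A *v z + b)"
proof -
  obtain g where f: "poly_map2 f" and g: "poly_map2 g" and "f \<circ> g = id" "g \<circ> f = id"
    using assms(6) unfolding poly_automorphism2_def by blast
  then have fg: "f (g z) = z" and gf: "g (f z) = z" for z by (simp_all add: pointfree_idE)
  have inv: "invertible A" if aff: "\<And>z. h z = A *v z + b" and hk: "\<And>z. k (h z) = z"
    for A :: "complex^2^2" and b h and k :: "complex^2 \<Rightarrow> complex^2"
  proof -
    have "inj ((*v) A)"
    proof (rule injI)
      fix x y assume "A *v x = A *v y"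
      then have "h x = h y" by (simp add: aff)
      then show "x = y" using hk by metis
    qed
    then show ?thesis using matrix_left_invertible_injective invertible_left_inverse by blast
  qed
  show ?thesis
  proof (cases "\<exists>(A :: complex^2^2) b. \<forall>z. f z = A *v z + b")
    case True
    then show ?thesis using inv gf by blast
  next
    case naff: False
    \<comment> \<open>An affine inverse would make \<open>f\<close> affine, so both maps have
      leading parts of degree at least 2.\<close>
    have "\<not> (\<exists>(A :: complex^2^2) b. \<forall>z. g z = A *v z + b)"
    proof
      assume "\<exists>(A :: complex^2^2) b. \<forall>z. g z = A *v z + b"
      then obtain A :: "complex^2^2" and b where gA: "\<And>z. g z = A *v z + b" by blast
      have "invertible A" using inv[OF gA fg] .
      then obtain B where B: "B ** A = mat 1" unfolding invertible_def by blast
      have "f z = B *v z + (- (B *v b))" for z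
      proof -
        have "B *v (g (f z) - b) = f z" unfolding gA by (simp add: matrix_vector_mul_assoc B)
        then show ?thesis unfolding gf by (simp add: matrix_vector_mult_diff_distrib)
      qed
      then show False using naff by blast
    qed
    then obtain e \<sigma> where e: "e \<ge> 2" "top_part g e \<sigma>" using ex_top_part[OF g] by blast
    obtain d \<tau> where d: "d \<ge> 2" "top_part f d \<tau>" using ex_top_part[OF f naff] by blast
    obtain u v where uv: "u \<noteq> 0" "v \<noteq> 0" "\<And>z. \<tau> z = cross2 u z ^ d *s v"
      using top_part_eq_cross2_power[OF f g fg gf d] by blast
    obtain u' v' where uv': "u' \<noteq> 0" "v' \<noteq> 0" "\<And>z. \<sigma> z = cross2 u' z ^ e *s v'"
      using top_part_eq_cross2_power[OF g f gf fg e] by blast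
    obtain C where C: "C \<ge> 0" "\<And>z. norm (f z - cross2 u z ^ d *s v) \<le> C * (1 + norm z) ^ (d - 1)"
      using d(2) uv(3) unfolding top_part_def by auto
    obtain C' where C': "C' \<ge> 0" "\<And>z. norm (g z - cross2 u' z ^ e *s v') \<le> C' * (1 + norm z) ^ (e - 1)"
      using e(2) uv'(3) unfolding top_part_def by auto
    have orth: "cross2 u v' = 0"
      by (rule top_parts_compose_vanish[OF fg d(1) e(1) C(2,1) C'(2,1) uv(2) uv'(1)])
    have orth': "cross2 u' v = 0"
      by (rule top_parts_compose_vanish[OF gf e(1) d(1) C'(2,1) C(2,1) uv'(2) uv(1)])
    obtain A where A: "A \<in> G2 V T" "cross2 u (A *v v) \<noteq> 0"
    proof (rule ccontr)
      assume "\<not> thesis"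
      then have "G2 V T \<subseteq> {A. cross2 u (A *v v) = 0}" using that by blast
      moreover have ms: "mscale c A *v v = c *s (A *v v)" for c A
        by (simp add: vec_eq_iff matrix_vector_mult_def mscale_def sum_distrib_left mult_ac)
      have "cmat.subspace {A. cross2 u (A *v v) = 0}"
        by (rule cmat.subspaceI)
           (auto simp: ms matrix_vector_mult_add_rdistrib cross2_linear)
      ultimately have all: "cross2 u (A *v v) = 0" for A
        using cmat.span_minimal[of "G2 V T" "{A. cross2 u (A *v v) = 0}"] assms(5) by blast
      obtain w where w: "cross2 u w = 1" using ex_cross2_eq_1[OF uv(1)] by blast
      obtain y where y: "cross2 v y = 1" using ex_cross2_eq_1[OF uv(2)] by blast
      \<comment> \<open>The rank one matrix sending \<open>z\<close> to
        \<open>cross2 z y *s w\<close>, hence \<open>v\<close> to \<open>w\<close>, where the form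
        \<open>cross2 u\<close> is 1.\<close>
      define A :: "complex^2^2" where "A = (\<chi> i j. w $ i * (if j = 1 then y $ 2 else - y $ 1))"
      have "A *v v = cross2 v y *s w"
        by (simp add: vec_eq_iff matrix_vector_mult_def sum_2 A_def cross2_def algebra_simps)
      then have "cross2 u (A *v v) = 1" using w y by simp
      then show False using all by simp
    qed
    then obtain b where Ainv: "invertible A" and bA: "bounded_comp V T (\<lambda>z. A *v z + b)"
      unfolding G2_def by blast
    \<comment> \<open>Precomposition with the affine map keeps the operator bounded and prevents the
      leading form from vanishing on the direction \<open>v\<close> of its own values.\<close>
    define F where "F = (\<lambda>z. f (A *v z + b))"
    have F: "F z = f (A *v z + b)" for z unfolding F_def ..
    have bF: "bounded_comp V T F"
      using bounded_comp_compose[OF assms(7) bA] unfolding F_def comp_def .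
    obtain \<xi> \<alpha> \<beta> \<rho> \<kappa> B G where region: "\<And>z. \<xi> z = \<alpha> * z $ 1 + \<beta> * z $ 2" "\<xi> v = 1"
      "\<And>t. t *s v \<in> G" "\<And>z. z \<in> G \<Longrightarrow> F z \<in> G" "\<rho> > 0" "\<kappa> > 0"
      "\<And>z. z \<in> G \<Longrightarrow> \<rho> \<le> cmod (\<xi> z) \<Longrightarrow> \<kappa> * (cmod (\<xi> z))\<^sup>2 \<le> cmod (\<xi> (F z))"
      "\<And>z. z \<in> G \<Longrightarrow> \<rho> \<le> cmod (\<xi> z) \<Longrightarrow> 2 * cmod (\<xi> z) \<le> cmod (\<xi> (F z))"
      "\<And>z. z \<in> G \<Longrightarrow> cmod (\<xi> z) < 2 * \<rho> \<Longrightarrow> norm z \<le> B"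
      by (rule escape_region[of F, OF F gf d(1) e(1) C(2,1) C'(2,1) uv(2) uv'(2,1) orth orth' Ainv A(2)])
        (rule that; assumption)
    have "\<exists>Q1 Q2. \<forall>n t. (F ^^ n) (t *s v) = vector [poly (Q1 n) t, poly (Q2 n) t]"
      using poly_map2_iterate_on_line[OF f, where A = A and b = b and v = v] unfolding F_def by metis
    then obtain Q1 Q2 where Q: "\<And>n t. (F ^^ n) (t *s v) = vector [poly (Q1 n) t, poly (Q2 n) t]" by blast
    have contF: "continuous_on UNIV F"
      unfolding F_def
      by (intro continuous_on_compose2[OF poly_map2_continuous_on[OF f, of UNIV]] continuous_intros
          bounded_linear.continuous_on[OF matrix_vector_mul_bounded_linear]) auto
    obtain f1 f2 where f12: "f1 holomorphic_on ball 0 (3/2)" "f2 holomorphic_on ball 0 (3/2)"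
      and nc: "\<not> (f1 constant_on ball 0 (3/2) \<and> f2 constant_on ball 0 (3/2))"
      and van: "\<And>r. r > 0 \<Longrightarrow> \<exists>M0. \<forall>M\<ge>M0. \<forall>h\<in>hol2.
       (\<exists>c\<ge>0. \<forall>n. \<forall>z\<in>(\<lambda>t. t *s v) ` cball 0 (2 * \<rho>). cmod (h ((F ^^ n) z)) \<le> c * r ^ n) \<longrightarrow>
       (\<forall>w\<in>ball 0 (3/2). (deriv ^^ M) (\<lambda>w. h (vector [f1 w, f2 w])) w = 0)"
      using limit_curve[OF region(1) contF Q region(2-9)] by blast
    have "continuous_on (cball 0 (2 * \<rho>)) (\<lambda>t. t *s v)"
      unfolding vector_scalar_mult_def by (intro continuous_on_vec_lambda continuous_intros)
    then have "compact ((\<lambda>t. t *s v) ` cball 0 (2 * \<rho>))"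
      by (intro compact_continuous_image) auto
    then obtain r where r: "r > 0" "\<And>h. h \<in> V \<Longrightarrow>
        \<exists>c\<ge>0. \<forall>n. \<forall>z\<in>(\<lambda>t. t *s v) ` cball 0 (2 * \<rho>). cmod (h ((F ^^ n) z)) \<le> c * r ^ n"
      using bounded_comp_iterate_bound[OF assms(2,3) bF] by blast
    obtain M0 where M0: "\<And>M h w. M \<ge> M0 \<Longrightarrow> h \<in> V \<Longrightarrow> w \<in> ball 0 (3/2) \<Longrightarrow>
        (deriv ^^ M) (\<lambda>w. h (vector [f1 w, f2 w])) w = 0"
      using van[OF r(1)] r(2) assms(1) by blast
    \<comment> \<open>The parameters at which the limit disc is immersed, so that derivatives along
      it have full order.\<close>
    define U where "U = {w \<in> ball 0 (3/2). deriv f1 w \<noteq> 0 \<or> deriv f2 w \<noteq> 0}"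
    have noninj: "\<not> kappa_injective V n (vector [f1 w, f2 w])" if w: "w \<in> U" and n: "n \<ge> M0" for w n
    proof (rule not_kappa_injective[of V f1 w "3 / 2 - cmod w" f2, OF assms(1)])
      have "ball w (3 / 2 - cmod w) \<subseteq> ball 0 (3/2)" by (auto simp: ball_subset_ball_iff)
      then show "f1 holomorphic_on ball w (3 / 2 - cmod w)" "f2 holomorphic_on ball w (3 / 2 - cmod w)"
        using f12 holomorphic_on_subset by blast+
      show "3 / 2 - cmod w > 0" "deriv f1 w \<noteq> 0 \<or> deriv f2 w \<noteq> 0"
        using w unfolding U_def by auto
      fix h assume "h \<in> V"
      then show "(deriv ^^ n) (\<lambda>w. h (vector [f1 w, f2 w])) w = 0"
        using M0[OF n] w unfolding U_def by blast
    qed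
    have "finite {n. kappa_injective V n (vector [f1 w, f2 w])}" if "w \<in> U" for w
    proof (rule finite_subset)
      show "{n. kappa_injective V n (vector [f1 w, f2 w])} \<subseteq> {..<M0}"
        using noninj[OF that] by (auto simp: not_le[symmetric])
    qed simp
    \<comment> \<open>At each image point only orders below \<open>M0\<close> can be injective, so
      all these points are exceptional.\<close>
    then have exceptional: "(\<lambda>w. vector [f1 w, f2 w]) ` U \<subseteq> {p. \<not> infinite {n. kappa_injective V n p}}"
      by auto
    have fin: "finite ((\<lambda>w. vector [f1 w, f2 w] :: complex^2) ` U)"
      using exceptional assms(4) by (rule finite_subset)
    have "f1 ` U = (\<lambda>p. p $ 1) ` (\<lambda>w. vector [f1 w, f2 w] :: complex^2) ` U"
      "f2 ` U = (\<lambda>p. p $ 2) ` (\<lambda>w. vector [f1 w, f2 w] :: complex^2) ` U"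
      by (simp_all add: image_image)
    then have "finite (f1 ` U)" "finite (f2 ` U)" using fin by simp_all
    moreover have "f1 ` {w \<in> ball 0 (3/2). deriv f1 w \<noteq> 0} \<subseteq> f1 ` U"
      "f2 ` {w \<in> ball 0 (3/2). deriv f2 w \<noteq> 0} \<subseteq> f2 ` U"
      unfolding U_def by auto
    ultimately have False
      using nc holomorphic_nonconst_regular_values_infinite f12 finite_subset by metis
    then show ?thesis ..
  qed
qed

end
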